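(* Let $\mathbb{K}$ be a field, let $G$ be a weakly closed graph on $n$ vertices, and let $X=(x_{ij})$ be the generic $m\times n$ matrix over $\mathbb{K}$. Let $f\in\mathbb{K}[X]$ be the product of all the minors of $X$ corresponding to all the diagonals of $X$. Then, for some labeling of the vertices of $G$ by $[n]=\{1,\dots,n\}$, the generalized binomial edge ideal satisfies $\mathfrak{J}_G\in\mathcal{C}_f$ (so $\mathfrak{J}_G$ is a Knutson ideal). In particular, if $\mathbb{K}$ has positive characteristic, then $\mathbb{K}[X]/\mathfrak{J}_G$ is $F$-pure.
   Context: $\mathbb{K}[X]=\mathbb{K}[x_{ij}\mid 1\le i\le m,\ 1\le j\le n]$ with $m\ge 2$. For a simple graph $G$ with vertices labeled by $[n]$ and edge set $E(G)$, the generalized binomial edge ideal is $$\mathfrak{J}_G=\sum_{\{i,j\}\in E(G)} I_2\begin{pmatrix}x_{1i}&x_{1j}\\ x_{2i}&x_{2j}\\ \vdots&\vdots\\ x_{mi}&x_{mj}\end{pmatrix}\subseteq\mathbb{K}[X],$$ where $I_2$ denotes the ideal generated by the $2$-minors. $G$ is weakly closed if there exists a labeling of its vertices by $[n]$ such that for all integers $1\le i<j<k\le n$, if $\{i,k\}\in E(G)$ then $\{i,j\}\in E(G)$ or $\{j,k\}\in E(G)$. The polynomial $f$: for each integer $c$ with $-(m-1)\le c\le n-1$, the corresponding diagonal of $X$ is the set of entries $x_{i,i+c}$ with $1\le i\le m$ and $1\le i+c\le n$; the minor corresponding to it is the determinant of the square submatrix of $X$ on consecutive rows and consecutive columns whose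 main diagonal is this set. Then $f$ is the product of these $m+n-1$ minors. (With respect to a diagonal term order, the leading monomial of $f$ is $\prod_{i,j}x_{ij}$.) Knutson ideals: for a polynomial $f$ in a polynomial ring $A$ over $\mathbb{K}$ whose leading term is a squarefree monomial for some term order, $\mathcal{C}_f$ is the smallest set of ideals of $A$ such that: (1) $(f)\in\mathcal{C}_f$; (2) if $I\in\mathcal{C}_f$ then $I:J\in\mathcal{C}_f$ for every ideal $J\subseteq A$; (3) if $I,J\in\mathcal{C}_f$ then $I+J\in\mathcal{C}_f$ and $I\cap J\in\mathcal{C}_f$. An ideal in $\mathcal{C}_f$ is called a Knutson ideal associated with $f$.
   Formalization: Membership of the edge ideal in C_f is claimed only for graphs with at least one edge: for an edgeless graph the ideal is 0, while every ideal in C_f contains f, which is nonzero. F-purity is proved for all weakly closed graphs, edgeless ones included. *)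

theory Defs
  imports
    "HOL-Library.Poly_Mapping"
    "HOL-Algebra.QuotRing"
    "HOL-Algebra.Free_Abelian_Groups"
    "Jordan_Normal_Form.Determinant"
begin

section \<open>The polynomial ring on the entries of a generic matrix\<close>

text \<open>An exponent vector is a finitely supported map from index pairs to \<open>nat\<close>; a polynomial is a
  finitely supported map from exponent vectors to coefficients, multiplied by convolution.\<close>

type_synonym 'k mpoly = "((nat \<times> nat) \<Rightarrow>\<^sub>0 nat) \<Rightarrow>\<^sub>0 'k"

text \<open>The type has infinitely many variables; the carrier keeps those \<open>x i j\<close> with
  \<open>1 \<le> i \<le> m\<close> and \<open>1 \<le> j \<le> n\<close>.\<close>

definition mpoly_ring :: "nat \<Rightarrow> nat \<Rightarrow> 'k::field mpoly ring" where
  "mpoly_ring m n =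
     \<lparr>carrier = {p. \<forall>t \<in> Poly_Mapping.keys p. Poly_Mapping.keys t \<subseteq> {1..m} \<times> {1..n}},
      monoid.mult = (*), monoid.one = 1, ring.zero = 0, ring.add = (+)\<rparr>"

definition xvar :: "nat \<Rightarrow> nat \<Rightarrow> 'k::field mpoly" where
  "xvar i j = Poly_Mapping.single (Poly_Mapping.single (i, j) 1) 1"

text \<open>The minor of the generic matrix on the given lists of (1-based) rows and columns;
  used only for lists of equal length.\<close>

definition minor :: "nat list \<Rightarrow> nat list \<Rightarrow> 'k::field mpoly" where
  "minor rs cs = det (mat (length rs) (length cs) (\<lambda>(a, b). xvar (rs ! a) (cs ! b)))"


section \<open>The product of the minors along the diagonals\<close>

definition diagonal_rows :: "nat \<Rightarrow> nat \<Rightarrow> int \<Rightarrow> nat list" where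
  "diagonal_rows m n c = filter (\<lambda>i. 1 \<le> int i + c \<and> int i + c \<le> int n) [1..<Suc m]"

definition diagonal_minor :: "nat \<Rightarrow> nat \<Rightarrow> int \<Rightarrow> 'k::field mpoly" where
  "diagonal_minor m n c =
     minor (diagonal_rows m n c) (map (\<lambda>i. nat (int i + c)) (diagonal_rows m n c))"

definition diagonal_product :: "nat \<Rightarrow> nat \<Rightarrow> 'k::field mpoly" where
  "diagonal_product m n = (\<Prod>c \<in> {- (int m - 1)..int n - 1}. diagonal_minor m n c)"


section \<open>Graphs and generalized binomial edge ideals\<close>

definition simple_graph :: "'v set \<Rightarrow> 'v set set \<Rightarrow> bool" where
  "simple_graph V E \<longleftrightarrow> finite V \<and> (\<forall>e \<in> E. e \<subseteq> V \<and> card e = 2)"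

definition labeling :: "'v set \<Rightarrow> ('v \<Rightarrow> nat) \<Rightarrow> bool" where
  "labeling V \<sigma> \<longleftrightarrow> bij_betw \<sigma> V {1..card V}"

definition labeled_edges :: "('v \<Rightarrow> nat) \<Rightarrow> 'v set set \<Rightarrow> nat set set" where
  "labeled_edges \<sigma> E = (\<lambda>e. \<sigma> ` e) ` E"

definition weakly_closed :: "'v set \<Rightarrow> 'v set set \<Rightarrow> bool" where
  "weakly_closed V E \<longleftrightarrow>
     (\<exists>\<sigma>. labeling V \<sigma> \<and>
        (\<forall>i j k. 1 \<le> i \<and> i < j \<and> j < k \<and> k \<le> card V \<and> {i, k} \<in> labeled_edges \<sigma> E \<longrightarrow>
           {i, j} \<in> labeled_edges \<sigma> E \<or> {j, k} \<in> labeled_edges \<sigma> E))"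

text \<open>The ideal of 2-minors of the columns \<open>i\<close> and \<open>j\<close>.\<close>

definition two_minors_ideal :: "nat \<Rightarrow> nat \<Rightarrow> nat \<Rightarrow> nat \<Rightarrow> 'k::field mpoly set" where
  "two_minors_ideal m n i j =
     Idl\<^bsub>mpoly_ring m n\<^esub> {minor [a, b] [i, j] | a b. 1 \<le> a \<and> a < b \<and> b \<le> m}"

text \<open>The sum of a family of ideals is the ideal generated by their union. Here \<open>E\<close> is a set of
  edges on the vertex set \<open>{1..n}\<close>.\<close>

definition gen_binomial_edge_ideal :: "nat \<Rightarrow> nat \<Rightarrow> nat set set \<Rightarrow> 'k::field mpoly set" where
  "gen_binomial_edge_ideal m n E =
     Idl\<^bsub>mpoly_ring m n\<^esub> (\<Union>{two_minors_ideal m n i j | i j. {i, j} \<in> E})"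


section \<open>Knutson ideals\<close>

definition ideal_colon :: "('a, 'c) ring_scheme \<Rightarrow> 'a set \<Rightarrow> 'a set \<Rightarrow> 'a set" where
  "ideal_colon R I J = {a \<in> carrier R. \<forall>b \<in> J. a \<otimes>\<^bsub>R\<^esub> b \<in> I}"

inductive_set knutson_ideals :: "('a, 'c) ring_scheme \<Rightarrow> 'a \<Rightarrow> 'a set set"
  for R :: "('a, 'c) ring_scheme" and f :: 'a where
  principal: "PIdl\<^bsub>R\<^esub> f \<in> knutson_ideals R f"
| colon: "I \<in> knutson_ideals R f \<Longrightarrow> ideal J R \<Longrightarrow> ideal_colon R I J \<in> knutson_ideals R f"
| sum: "I \<in> knutson_ideals R f \<Longrightarrow> J \<in> knutson_ideals R f \<Longrightarrow>
          I <+>\<^bsub>R\<^esub> J \<in> knutson_ideals R f"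
| inter: "I \<in> knutson_ideals R f \<Longrightarrow> J \<in> knutson_ideals R f \<Longrightarrow> I \<inter> J \<in> knutson_ideals R f"


section \<open>F-purity\<close>

text \<open>The tensor product \<open>M \<otimes>\<^sub>R N\<close> (as an abelian group) is the quotient of the free abelian group
  on \<open>carrier M \<times> carrier N\<close> by the subgroup generated by the following relations.\<close>

definition tensor_relations ::
  "('a, 'c) ring_scheme \<Rightarrow> ('a, 'b, 'd) module_scheme \<Rightarrow> ('a, 'e, 'g) module_scheme \<Rightarrow>
     ('b \<times> 'e \<Rightarrow>\<^sub>0 int) set" where
  "tensor_relations R M N =
     {frag_of (x \<oplus>\<^bsub>M\<^esub> x', y) - frag_of (x, y) - frag_of (x', y) | x x' y.
        x \<in> carrier M \<and> x' \<in> carrier M \<and> y \<in> carrier N} \<union>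
     {frag_of (x, y \<oplus>\<^bsub>N\<^esub> y') - frag_of (x, y) - frag_of (x, y') | x y y'.
        x \<in> carrier M \<and> y \<in> carrier N \<and> y' \<in> carrier N} \<union>
     {frag_of (r \<odot>\<^bsub>M\<^esub> x, y) - frag_of (x, r \<odot>\<^bsub>N\<^esub> y) | r x y.
        r \<in> carrier R \<and> x \<in> carrier M \<and> y \<in> carrier N}"

definition pure_tensor ::
  "('a, 'c) ring_scheme \<Rightarrow> ('a, 'b, 'd) module_scheme \<Rightarrow> ('a, 'e, 'g) module_scheme \<Rightarrow>
     'b \<Rightarrow> 'e \<Rightarrow> ('b \<times> 'e \<Rightarrow>\<^sub>0 int) set" where
  "pure_tensor R M N x y =
     (let A = free_Abelian_group (carrier M \<times> carrier N)
      in generate A (tensor_relations R M N) #>\<^bsub>A\<^esub> frag_of (x, y))"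

text \<open>\<open>R\<close> as a module over itself via the \<open>p\<close>-power map.\<close>

definition frobenius_module :: "nat \<Rightarrow> ('a, 'c) ring_scheme \<Rightarrow> ('a, 'a) module" where
  "frobenius_module p R =
     \<lparr>carrier = carrier R, monoid.mult = monoid.mult R, monoid.one = monoid.one R,
      ring.zero = ring.zero R, ring.add = ring.add R,
      module.smult = (\<lambda>r x. (r [^]\<^bsub>R\<^esub> p) \<otimes>\<^bsub>R\<^esub> x)\<rparr>"

text \<open>A ring \<open>R\<close> of prime characteristic \<open>p\<close> is F-pure if the Frobenius map \<open>R \<rightarrow> F\<^sub>*R\<close> is pure,
  that is, if \<open>M \<rightarrow> M \<otimes>\<^sub>R F\<^sub>*R\<close>, \<open>x \<mapsto> x \<otimes> 1\<close>, is injective for every \<open>R\<close>-module \<open>M\<close>. HOL cannot quantify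
  over types inside a formula, so the type \<open>'b\<close> of the elements of \<open>M\<close> is a parameter; left free in
  a theorem, it is universally quantified.\<close>

definition F_pure :: "'b itself \<Rightarrow> nat \<Rightarrow> ('a, 'c) ring_scheme \<Rightarrow> bool" where
  "F_pure (_ :: 'b itself) p R \<longleftrightarrow>
     cring R \<and> prime p \<and> [p] \<cdot>\<^bsub>R\<^esub> \<one>\<^bsub>R\<^esub> = \<zero>\<^bsub>R\<^esub> \<and>
     (\<forall>M :: ('a, 'b) module. module R M \<longrightarrow>
        inj_on (\<lambda>x. pure_tensor R M (frobenius_module p R) x \<one>\<^bsub>R\<^esub>) (carrier M))"


section \<open>Basic facts\<close>

lemma mpoly_ring_simps [simp]:
  "monoid.mult (mpoly_ring m n) = (*)" "monoid.one (mpoly_ring m n) = 1"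
  "ring.zero (mpoly_ring m n) = 0" "ring.add (mpoly_ring m n) = (+)"
  by (simp_all add: mpoly_ring_def)

lemma mpoly_ring_carrier:
  "p \<in> carrier (mpoly_ring m n) \<longleftrightarrow>
     (\<forall>t \<in> Poly_Mapping.keys p. Poly_Mapping.keys t \<subseteq> {1..m} \<times> {1..n})"
  by (simp add: mpoly_ring_def)

lemma mpoly_ring_mult_closed:
  assumes "p \<in> carrier (mpoly_ring m n)" "q \<in> carrier (mpoly_ring m n)"
  shows "p * q \<in> carrier (mpoly_ring m n)"
  unfolding mpoly_ring_carrier
proof
  fix t assume "t \<in> Poly_Mapping.keys (p * q)"
  then obtain a b where t: "t = a + b" and "a \<in> Poly_Mapping.keys p" "b \<in> Poly_Mapping.keys q"
    using keys_mult[of p q] by blast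
  then have "Poly_Mapping.keys a \<subseteq> {1..m} \<times> {1..n}" "Poly_Mapping.keys b \<subseteq> {1..m} \<times> {1..n}"
    using assms unfolding mpoly_ring_carrier by blast+
  then show "Poly_Mapping.keys t \<subseteq> {1..m} \<times> {1..n}"
    using Poly_Mapping.keys_add[of a b] t by blast
qed

lemma mpoly_ring_add_closed:
  assumes "p \<in> carrier (mpoly_ring m n)" "q \<in> carrier (mpoly_ring m n)"
  shows "p + q \<in> carrier (mpoly_ring m n)"
  using assms Poly_Mapping.keys_add[of p q] unfolding mpoly_ring_carrier by blast

lemma cring_mpoly_ring: "cring (mpoly_ring m n :: 'k::field mpoly ring)"
proof (rule cringI)
  show "abelian_group (mpoly_ring m n :: 'k mpoly ring)"
  proof (rule abelian_groupI)
    fix x :: "'k mpoly" assume "x \<in> carrier (mpoly_ring m n)"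
    then show "\<exists>y \<in> carrier (mpoly_ring m n). y \<oplus>\<^bsub>mpoly_ring m n\<^esub> x = \<zero>\<^bsub>mpoly_ring m n\<^esub>"
      by (intro bexI[of _ "- x"]) (simp_all add: mpoly_ring_carrier)
  qed (auto simp: mpoly_ring_add_closed algebra_simps, simp add: mpoly_ring_carrier)
  show "Group.comm_monoid (mpoly_ring m n :: 'k mpoly ring)"
    by (rule Group.comm_monoidI)
      (auto simp: mpoly_ring_mult_closed algebra_simps, simp add: mpoly_ring_carrier)
qed (simp add: algebra_simps)

lemma ideal_ideal_colon:
  assumes "cring R" "ideal I R" "ideal J R"
  shows "ideal (ideal_colon R I J) R" "I \<subseteq> ideal_colon R I J"
proof -
  interpret cring R by fact
  interpret I: ideal I R by fact
  interpret J: ideal J R by fact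
  have mem: "a \<in> ideal_colon R I J \<longleftrightarrow> a \<in> carrier R \<and> (\<forall>b \<in> J. a \<otimes>\<^bsub>R\<^esub> b \<in> I)" for a
    by (simp add: ideal_colon_def)
  have mult: "x \<otimes>\<^bsub>R\<^esub> a \<in> ideal_colon R I J"
    if "a \<in> ideal_colon R I J" "x \<in> carrier R" for a x
  proof -
    have "x \<otimes>\<^bsub>R\<^esub> a \<otimes>\<^bsub>R\<^esub> b \<in> I" if "b \<in> J" for b
      using \<open>a \<in> _\<close> \<open>x \<in> _\<close> that I.I_l_closed J.a_Hcarr m_assoc mem by simp
    then show ?thesis using that mem by simp
  qed
  show "ideal (ideal_colon R I J) R"
  proof (rule idealI)
    show "ring R" by (rule ring_axioms)
    show "subgroup (ideal_colon R I J) (add_monoid R)"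
    proof (rule add.subgroupI)
      show "ideal_colon R I J \<subseteq> carrier R" using mem by blast
      have "\<zero>\<^bsub>R\<^esub> \<in> ideal_colon R I J"
        using mem I.zero_closed J.a_Hcarr by simp
      then show "ideal_colon R I J \<noteq> {}" by blast
      fix a assume a: "a \<in> ideal_colon R I J"
      have "\<ominus>\<^bsub>R\<^esub> \<one>\<^bsub>R\<^esub> \<otimes>\<^bsub>R\<^esub> a \<in> ideal_colon R I J"
        using a mult by simp
      then show "\<ominus>\<^bsub>R\<^esub> a \<in> ideal_colon R I J"
        using a mem by (simp add: l_minus)
      fix b assume b: "b \<in> ideal_colon R I J"
      show "a \<oplus>\<^bsub>R\<^esub> b \<in> ideal_colon R I J"
        using a b mem J.a_Hcarr by (simp add: l_distr I.a_closed)
    qed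
    fix a x assume "a \<in> ideal_colon R I J" "x \<in> carrier R"
    then show "x \<otimes>\<^bsub>R\<^esub> a \<in> ideal_colon R I J" "a \<otimes>\<^bsub>R\<^esub> x \<in> ideal_colon R I J"
      using mult[of a x] mem m_comm by auto
  qed
  show "I \<subseteq> ideal_colon R I J"
    by (auto simp: ideal_colon_def I.I_r_closed)
qed

text \<open>Every member of \<open>knutson_ideals R f\<close> contains \<open>f\<close>; so if \<open>f \<noteq> 0\<close> the zero ideal, which
  is the binomial edge ideal of a graph without edges, is never a member.\<close>

lemma knutson_ideals_contain:
  assumes "cring R" "f \<in> carrier R" "I \<in> knutson_ideals R f"
  shows "ideal I R" "f \<in> I"
proof -
  interpret cring R by fact
  have "ideal I R \<and> f \<in> I"
    using assms(3)
  proof induction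
    case principal
    then show ?case using assms(2) cgenideal_ideal cgenideal_self by blast
  next
    case (colon I J)
    then show ?case using ideal_ideal_colon[OF assms(1)] by blast
  next
    case (sum I J)
    interpret I: ideal I R using sum by blast
    interpret J: ideal J R using sum by blast
    have "f \<oplus>\<^bsub>R\<^esub> \<zero>\<^bsub>R\<^esub> \<in> I <+>\<^bsub>R\<^esub> J"
      using sum J.zero_closed unfolding set_add_def' by blast
    then show ?case using sum add_ideals assms(2) by auto
  next
    case (inter I J)
    then show ?case using i_intersect by auto
  qed
  then show "ideal I R" "f \<in> I" by auto
qed

end

theory Submission
  imports Defs "HOL-Library.Product_Lexorder"
begin

text \<open>
  Work with a weakly closed labeling of \<open>G\<close>, and write \<open>D\<^sub>c\<close> for the minor on the diagonal \<open>j - i = c\<close>,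
  so that \<open>f\<close> is the product of the \<open>D\<^sub>c\<close>. Everything rests on one way of producing members of the
  class \<open>C\<^sub>f\<close> (\<open>knutson_kernel\<close>): if \<open>I \<in> C\<^sub>f\<close> is contained in a prime \<open>P\<close> and some \<open>h \<notin> P\<close> satisfies
  \<open>h P \<subseteq> I\<close>, then \<open>P = I : h \<in> C\<^sub>f\<close>. Each \<open>(D\<^sub>c)\<close> is the colon of \<open>(f)\<close> by the product of the other
  factors, so sums of such ideals are available as \<open>I\<close>.

  Two families of primes arise in this way from Cramer's rule. A column \<open>j\<close> meets the \<open>m\<close> diagonals
  \<open>c = j - b\<close> with \<open>1 \<le> b \<le> m\<close>, and \<open>D\<^sub>c\<close> is a linear form in the entries of that column whose coefficients
  are cofactors. Hence the determinant \<open>h\<close> of the \<open>m \<times> m\<close> matrix of these cofactors multiplies every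
  entry of column \<open>j\<close> into the ideal of the \<open>D\<^sub>c\<close>, and the ideal of the column belongs to \<open>C\<^sub>f\<close>
  (\<open>knutson_column\<close>). Similarly \<open>x\<^bsub>1s\<^esub> D\<^sub>c\<close> is a linear form in the 2-minors on rows \<open>1, i\<close> and columns
  \<open>s, s + 1\<close>, which gives the ideal of 2-minors of two adjacent columns (\<open>knutson_adjacent_columns\<close>).
  That \<open>h\<close> is nonzero is a statement about initial terms: for the weight \<open>2 i j\<close> of \<open>x\<^bsub>ij\<^esub>\<close> the product of
  a diagonal strictly dominates its minor, so the matrix of cofactors has a dominating diagonal too
  (\<open>lead_det\<close>). The primality needed for 2-minors is the classical fact that they generate the kernel
  of the Segre substitution \<open>x\<^bsub>ij\<^esub> \<mapsto> s\<^sub>i t\<^sub>j\<close> (\<open>segre_kernel\<close>); it also lets adjacent columns be glued to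
  intervals of columns (\<open>knutson_column_interval\<close>).

  The graph enters through the identity \<open>J\<^sub>G = J\<^bsub>G'\<^esub> \<inter> (J\<^bsub>G\<^esub> + (column v))\<close>, where \<open>G'\<close> completes the
  neighbourhood of \<open>v\<close> (\<open>graph_ideal_split\<close>). Completing neighbourhoods and deleting vertices preserve
  weak closedness, and after finitely many steps the neighbourhood of every remaining vertex is
  complete. Then weak closedness says that the vertices between two adjacent ones are deleted or adjacent
  to both, so the ideal is a sum of ideals of columns and of intervals of columns
  (\<open>graph_ideal_locally_complete\<close>). This proves membership in \<open>C\<^sub>f\<close> (\<open>knutson_graph_ideal\<close>).

  In characteristic \<open>p > 0\<close>, compose multiplication by \<open>f\<^bsup>p-1\<^esup>\<close> with the trace \<open>Tr\<close> that keeps the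
  monomials \<open>x\<^bsup>p-1\<^esup> u\<^bsup>p\<^esup>\<close>, where \<open>x\<close> is the product of all variables, and sends them to \<open>u\<close>. The
  initial term of \<open>f\<close> is \<open>x\<close>, so \<open>g \<mapsto> Tr (f\<^bsup>p-1\<^esup> g)\<close> maps \<open>1\<close> to \<open>1\<close> and splits the Frobenius map
  (\<open>trace_lead\<close>). It maps \<open>(f)\<close> into itself, and this property passes to colons, sums and
  intersections, hence to all of \<open>C\<^sub>f\<close> (\<open>knutson_compatible\<close>); for a graph without edges the ideal is
  zero. So the splitting descends to the quotient by \<open>J\<^sub>G\<close>, and a split Frobenius map is pure
  (\<open>F_pure_if_splitting\<close>).
\<close>

section \<open>Polynomials in a given set of variables\<close>

text \<open>The lexicographic order on index pairs orders the exponent vectors, which makes the type of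
  polynomials an integral domain.\<close>
type_synonym expo = "(nat \<times> nat) \<Rightarrow>\<^sub>0 nat"

abbreviation mon :: "expo \<Rightarrow> 'k::field mpoly" where
  "mon t \<equiv> Poly_Mapping.single t 1"

lemma xvar_eq_mon: "xvar i j = mon (Poly_Mapping.single (i, j) 1)"
  by (simp add: xvar_def)

lemma mpoly_induct [case_names zero single add]:
  fixes p :: "'k::field mpoly"
  assumes "P 0" "\<And>t c. c \<noteq> 0 \<Longrightarrow> P (Poly_Mapping.single t c)" "\<And>p q. P p \<Longrightarrow> P q \<Longrightarrow> P (p + q)"
  shows "P p"
proof (induction p rule: update_induct)
  case const
  show ?case by (rule assms(1))
next
  case (update f t c)
  have "Poly_Mapping.update t c f = f + Poly_Mapping.single t c"
    using update by (intro poly_mapping_eqI) (auto simp: lookup_update lookup_add lookup_single when_def in_keys_iff)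
  then show ?case using update assms by metis
qed

lemma mpoly_eq_sum: "(\<Sum>t\<in>Poly_Mapping.keys p. Poly_Mapping.single t (Poly_Mapping.lookup p t)) = (p :: 'k::field mpoly)"
  by (rule poly_mapping_eqI)
    (auto simp: lookup_sum lookup_single when_def in_keys_iff)

definition poly_over :: "(nat \<times> nat) set \<Rightarrow> 'k::field mpoly set" where
  "poly_over S = {p. \<forall>t \<in> Poly_Mapping.keys p. Poly_Mapping.keys t \<subseteq> S}"

lemma carrier_eq_poly_over: "carrier (mpoly_ring m n) = poly_over ({1..m} \<times> {1..n})"
  by (auto simp: poly_over_def mpoly_ring_def)

lemma poly_over_mono: "S \<subseteq> T \<Longrightarrow> p \<in> poly_over S \<Longrightarrow> p \<in> poly_over T"
  by (auto simp: poly_over_def)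

lemma poly_over_single: "Poly_Mapping.keys t \<subseteq> S \<Longrightarrow> Poly_Mapping.single t c \<in> poly_over S"
  by (simp add: poly_over_def)

lemma poly_over_zero [simp]: "0 \<in> poly_over S" by (simp add: poly_over_def)

lemma poly_over_one [simp]: "1 \<in> poly_over S" by (simp add: poly_over_def)

lemma poly_over_add: "p \<in> poly_over S \<Longrightarrow> q \<in> poly_over S \<Longrightarrow> p + q \<in> poly_over S"
  using Poly_Mapping.keys_add[of p q] unfolding poly_over_def by blast

lemma poly_over_uminus: "p \<in> poly_over S \<Longrightarrow> - p \<in> poly_over S"
  by (simp add: poly_over_def)

lemma poly_over_diff: "p \<in> poly_over S \<Longrightarrow> q \<in> poly_over S \<Longrightarrow> p - q \<in> poly_over S"
  using poly_over_add[of p S "- q"] poly_over_uminus[of q S] by simp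

lemma poly_over_mult:
  assumes "p \<in> poly_over S" "q \<in> poly_over S" shows "p * q \<in> poly_over S"
proof -
  have "Poly_Mapping.keys t \<subseteq> S" if "t \<in> Poly_Mapping.keys (p * q)" for t
  proof -
    obtain a b where t: "t = a + b" and "a \<in> Poly_Mapping.keys p" "b \<in> Poly_Mapping.keys q"
      using keys_mult[of p q] \<open>t \<in> Poly_Mapping.keys (p * q)\<close> by blast
    then have "Poly_Mapping.keys a \<subseteq> S" "Poly_Mapping.keys b \<subseteq> S"
      using assms unfolding poly_over_def by blast+
    then show ?thesis using Poly_Mapping.keys_add[of a b] t by blast
  qed
  then show ?thesis by (simp add: poly_over_def)
qed

lemma poly_over_sum: "(\<And>x. x \<in> A \<Longrightarrow> p x \<in> poly_over S) \<Longrightarrow> sum p A \<in> poly_over S"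
  by (induction A rule: infinite_finite_induct) (auto intro: poly_over_add)

lemma poly_over_prod: "(\<And>x. x \<in> A \<Longrightarrow> p x \<in> poly_over S) \<Longrightarrow> prod p A \<in> poly_over S"
  by (induction A rule: infinite_finite_induct) (auto intro: poly_over_mult)

lemma poly_over_power: "p \<in> poly_over S \<Longrightarrow> p ^ k \<in> poly_over S"
  by (induction k) (auto intro: poly_over_mult)

lemma xvar_in_poly_over: "(i, j) \<in> S \<Longrightarrow> xvar i j \<in> poly_over S"
  by (auto simp: xvar_def intro!: poly_over_single)

lemma signof_cases: "signof \<pi> = (1 :: 'a::comm_ring_1) \<or> signof \<pi> = (- 1 :: 'a)"
  by (simp add: sign_def)

lemma poly_over_signof: "signof \<pi> \<in> poly_over S"
  using signof_cases[of \<pi>] poly_over_one[of S] poly_over_uminus[OF poly_over_one, of S] by metis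

lemma poly_over_det:
  assumes "A \<in> carrier_mat k k" "\<And>i j. i < k \<Longrightarrow> j < k \<Longrightarrow> A $$ (i, j) \<in> poly_over S"
  shows "det A \<in> poly_over S"
  unfolding det_def'[OF assms(1)]
  by (intro poly_over_sum poly_over_mult poly_over_prod poly_over_signof assms(2))
    (auto dest: permutes_in_image)

section \<open>Substitutions that act on monomials\<close>

text \<open>The \<open>\<bbbK>\<close>-linear extension of a map from monomials to polynomials; scalars enter as the
  constants \<open>single 0 c\<close>. It is a ring homomorphism as soon as \<open>F\<close> is multiplicative, which covers both
  substitutions needed below: setting a column to zero, and the Segre substitution.\<close>
definition monomial_hom :: "(expo \<Rightarrow> 'k mpoly) \<Rightarrow> 'k::field mpoly \<Rightarrow> 'k mpoly" where
  "monomial_hom F p = (\<Sum>t\<in>Poly_Mapping.keys p. Poly_Mapping.single 0 (Poly_Mapping.lookup p t) * F t)"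

lemma monomial_hom_superset:
  assumes "finite A" "Poly_Mapping.keys p \<subseteq> A"
  shows "monomial_hom F p = (\<Sum>t\<in>A. Poly_Mapping.single 0 (Poly_Mapping.lookup p t) * F t)"
  unfolding monomial_hom_def
  by (rule sum.mono_neutral_left) (use assms in \<open>auto simp: in_keys_iff\<close>)

lemma monomial_hom_zero [simp]: "monomial_hom F 0 = 0" by (simp add: monomial_hom_def)

lemma monomial_hom_single [simp]: "monomial_hom F (Poly_Mapping.single t c) = Poly_Mapping.single 0 c * F t"
  by (cases "c = 0") (simp_all add: monomial_hom_def)

lemma monomial_hom_add: "monomial_hom F (p + q) = monomial_hom F p + monomial_hom F q"
proof -
  let ?A = "Poly_Mapping.keys p \<union> Poly_Mapping.keys q"
  have "Poly_Mapping.keys (p + q) \<subseteq> ?A" by (rule Poly_Mapping.keys_add)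
  then show ?thesis
    by (simp add: monomial_hom_superset[of ?A] lookup_add single_add distrib_right sum.distrib)
qed

lemma monomial_hom_uminus: "monomial_hom F (- p) = - monomial_hom F p"
  by (metis add_eq_0_iff monomial_hom_add monomial_hom_zero)

lemma monomial_hom_diff: "monomial_hom F (p - q) = monomial_hom F p - monomial_hom F q"
  by (metis add_uminus_conv_diff monomial_hom_add monomial_hom_uminus)

lemma monomial_hom_mult:
  assumes "\<And>s t. F (s + t) = F s * F t"
  shows "monomial_hom F (p * q) = monomial_hom F p * monomial_hom F q"
proof (induction p rule: mpoly_induct)
  case (single t c)
  show ?case
  proof (induction q rule: mpoly_induct)
    case (single s d)
    have "Poly_Mapping.single 0 (c * d) = Poly_Mapping.single 0 c * (Poly_Mapping.single 0 d :: 'a mpoly)"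
      by (simp add: mult_single)
    then show ?case by (simp add: mult_single assms mult_ac)
  qed (simp_all add: monomial_hom_add distrib_left)
qed (simp_all add: monomial_hom_add distrib_right)

section \<open>Weights and dominating terms\<close>

text \<open>The weight \<open>2 i j\<close> of \<open>x\<^bsub>ij\<^esub>\<close> is a diagonal weight: among the terms of a minor it is largest on
  the main diagonal, by the rearrangement inequality. The factor 2 lets the potentials used below be
  integers.\<close>
definition expo_weight :: "expo \<Rightarrow> int" where
  "expo_weight t = (\<Sum>v\<in>Poly_Mapping.keys t. int (Poly_Mapping.lookup t v * (2 * fst v * snd v)))"

lemma expo_weight_zero [simp]: "expo_weight 0 = 0" by (simp add: expo_weight_def)

lemma expo_weight_superset:
  assumes "finite A" "Poly_Mapping.keys t \<subseteq> A"
  shows "expo_weight t = (\<Sum>v\<in>A. int (Poly_Mapping.lookup t v * (2 * fst v * snd v)))"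
  unfolding expo_weight_def
  by (rule sum.mono_neutral_left) (use assms in \<open>auto simp: in_keys_iff\<close>)

lemma expo_weight_add: "expo_weight (s + t) = expo_weight s + expo_weight t"
proof -
  let ?A = "Poly_Mapping.keys s \<union> Poly_Mapping.keys t"
  have "Poly_Mapping.keys (s + t) \<subseteq> ?A" by (rule Poly_Mapping.keys_add)
  then show ?thesis
    by (simp add: expo_weight_superset[of ?A] lookup_add distrib_right sum.distrib)
qed

lemma expo_weight_sum: "expo_weight (sum T A) = (\<Sum>a\<in>A. expo_weight (T a))"
  by (induction A rule: infinite_finite_induct) (auto simp: expo_weight_add)

lemma expo_weight_single: "expo_weight (Poly_Mapping.single (i, j) 1) = 2 * int i * int j"
  by (simp add: expo_weight_def)

text \<open>An upper bound for the weights of all terms; a strict bound by \<open>w\<close> is expressed as \<open>weight_le p (w - 1)\<close>.\<close>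
definition weight_le :: "'k::field mpoly \<Rightarrow> int \<Rightarrow> bool" where
  "weight_le p w \<longleftrightarrow> (\<forall>t \<in> Poly_Mapping.keys p. expo_weight t \<le> w)"

lemma weight_le_zero [simp]: "weight_le 0 w" by (simp add: weight_le_def)

lemma weight_le_one: "weight_le 1 0" by (simp add: weight_le_def)

lemma weight_le_mono: "weight_le p w \<Longrightarrow> w \<le> w' \<Longrightarrow> weight_le p w'"
  by (auto simp: weight_le_def)

lemma weight_le_add: "weight_le p w \<Longrightarrow> weight_le q w \<Longrightarrow> weight_le (p + q) w"
  using Poly_Mapping.keys_add[of p q] unfolding weight_le_def by blast

lemma weight_le_mult:
  assumes "weight_le p v" "weight_le q w" shows "weight_le (p * q) (v + w)"
  unfolding weight_le_def
proof
  fix t assume "t \<in> Poly_Mapping.keys (p * q)"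
  then obtain a b where t: "t = a + b" and "a \<in> Poly_Mapping.keys p" "b \<in> Poly_Mapping.keys q"
    using keys_mult[of p q] by blast
  then show "expo_weight t \<le> v + w"
    using assms by (auto simp: weight_le_def expo_weight_add intro: add_mono)
qed

lemma weight_le_sum: "(\<And>x. x \<in> A \<Longrightarrow> weight_le (p x) w) \<Longrightarrow> weight_le (sum p A) w"
  by (induction A rule: infinite_finite_induct) (auto intro: weight_le_add)

lemma weight_le_prod:
  "(\<And>x. x \<in> A \<Longrightarrow> weight_le (p x) (w x)) \<Longrightarrow> weight_le (prod p A) (sum w A)"
  by (induction A rule: infinite_finite_induct) (auto intro: weight_le_mult weight_le_one)

text \<open>The monomial \<open>t\<close> occurs with coefficient 1 and every other term has strictly smaller weight, stated
  as a bound on the difference so that it combines with the additive behaviour of \<open>weight_le\<close>.\<close>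
definition lead :: "'k::field mpoly \<Rightarrow> expo \<Rightarrow> bool" where
  "lead p t \<longleftrightarrow> weight_le (p - mon t) (expo_weight t - 1)"

lemma lead_mon: "lead (mon t) t" by (simp add: lead_def)

lemma lead_imp_weight_le: "lead p t \<Longrightarrow> weight_le p (expo_weight t)"
  using weight_le_add[of "p - mon t" "expo_weight t" "mon t"]
    weight_le_mono[of "p - mon t" "expo_weight t - 1" "expo_weight t"]
  by (simp add: lead_def weight_le_def)

lemma lead_lookup:
  assumes "lead p t" shows "Poly_Mapping.lookup p t = 1"
proof -
  have "t \<notin> Poly_Mapping.keys (p - mon t)"
    using assms by (auto simp: lead_def weight_le_def)
  then show ?thesis by (simp add: in_keys_iff lookup_minus)
qed

lemma lead_unique:
  assumes "lead p t" "u \<in> Poly_Mapping.keys p" "expo_weight t \<le> expo_weight u" shows "u = t"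
proof (rule ccontr)
  assume "u \<noteq> t"
  then have "u \<in> Poly_Mapping.keys (p - mon t)"
    using assms(2) by (simp add: in_keys_iff lookup_minus lookup_single)
  then show False using assms by (auto simp: lead_def weight_le_def)
qed

lemma lead_nonzero: "lead p t \<Longrightarrow> p \<noteq> 0"
  using lead_lookup by fastforce

lemma lead_mult:
  assumes "lead p s" "lead q t" shows "lead (p * q) (s + t)"
proof -
  have "p * q - mon (s + t) = (p - mon s) * q + mon s * (q - mon t)"
    by (simp add: algebra_simps mult_single)
  moreover have "weight_le ((p - mon s) * q) ((expo_weight s - 1) + expo_weight t)"
    using assms by (intro weight_le_mult lead_imp_weight_le) (simp add: lead_def)
  moreover have "weight_le (mon s * (q - mon t)) (expo_weight s + (expo_weight t - 1))"
    using assms by (intro weight_le_mult lead_imp_weight_le lead_mon) (simp add: lead_def)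
  ultimately show ?thesis
    unfolding lead_def expo_weight_add
    using weight_le_add[of "(p - mon s) * q" "expo_weight s + expo_weight t - 1" "mon s * (q - mon t)"]
    by (simp only: add_diff_eq diff_add_eq)
qed

lemma lead_one: "lead 1 0" by (simp add: lead_def)

lemma lead_prod: "(\<And>x. x \<in> A \<Longrightarrow> lead (p x) (T x)) \<Longrightarrow> lead (prod p A) (sum T A)"
  by (induction A rule: infinite_finite_induct) (auto intro: lead_mult lead_one)

lemma lead_xvar: "lead (xvar i j) (Poly_Mapping.single (i, j) 1)"
  by (simp add: xvar_eq_mon lead_mon)

lemma weight_le_signof: "weight_le (signof \<pi> * p) w \<longleftrightarrow> weight_le p w"
  using signof_cases[of \<pi>] by (metis weight_le_def keys_minus mult_1 mult_minus1)

text \<open>If the weights of the entries are bounded by potentials of their rows and columns, then every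
  term of the Leibniz expansion has the same bound, because a permutation only reorders the column
  potentials.\<close>
lemma weight_le_det:
  assumes A: "A \<in> carrier_mat k k"
    and "\<And>i j. i < k \<Longrightarrow> j < k \<Longrightarrow> weight_le (A $$ (i, j)) (\<alpha> i + \<beta> j)"
  shows "weight_le (det A) (\<Sum>i<k. \<alpha> i + \<beta> i)"
  unfolding det_def'[OF A]
proof (rule weight_le_sum, unfold weight_le_signof)
  fix \<pi> assume "\<pi> \<in> {\<pi>. \<pi> permutes {0..<k}}"
  then have \<pi>: "\<pi> permutes {0..<k}" by simp
  have "(\<Sum>i\<in>{0..<k}. \<alpha> i + \<beta> (\<pi> i)) = (\<Sum>i<k. \<alpha> i + \<beta> i)"
    using sum.permute[OF \<pi>, of \<beta>] by (simp add: sum.distrib atLeast0LessThan comp_def)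
  moreover have "weight_le (\<Prod>i = 0..<k. A $$ (i, \<pi> i)) (\<Sum>i\<in>{0..<k}. \<alpha> i + \<beta> (\<pi> i))"
    using permutes_in_image[OF \<pi>] by (intro weight_le_prod assms) auto
  ultimately show "weight_le (\<Prod>i = 0..<k. A $$ (i, \<pi> i)) (\<Sum>i<k. \<alpha> i + \<beta> i)" by simp
qed

text \<open>When moreover the bound is attained exactly on the diagonal, a permutation other than the identity
  loses weight, so the product of the diagonal entries dominates. This applies to a diagonal minor
  itself, to its cofactors, and to the matrix formed by these cofactors.\<close>
lemma lead_det:
  assumes A: "A \<in> carrier_mat k k"
    and off: "\<And>i j. i < k \<Longrightarrow> j < k \<Longrightarrow> i \<noteq> j \<Longrightarrow> weight_le (A $$ (i, j)) (\<alpha> i + \<beta> j - 1)"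
    and diag: "\<And>i. i < k \<Longrightarrow> lead (A $$ (i, i)) (T i)"
    and wt: "\<And>i. i < k \<Longrightarrow> expo_weight (T i) = \<alpha> i + \<beta> i"
  shows "lead (det A) (\<Sum>i<k. T i)"
proof -
  let ?W = "\<Sum>i<k. \<alpha> i + \<beta> i"
  let ?S = "{\<pi>. \<pi> permutes {0..<k}}"
  have fin: "finite ?S" by (simp add: finite_permutations)
  have entry: "weight_le (A $$ (i, j)) (\<alpha> i + \<beta> j - (if i = j then 0 else 1))" if "i < k" "j < k" for i j
    using off[OF that] lead_imp_weight_le[OF diag[of i]] wt[of i] that by auto
  have other: "weight_le (\<Prod>i = 0..<k. A $$ (i, \<pi> i)) (?W - 1)"
    if \<pi>: "\<pi> permutes {0..<k}" "\<pi> \<noteq> id" for \<pi>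
  proof -
    obtain a where a: "a \<noteq> \<pi> a" using \<pi>(2) by (metis eq_id_iff)
    then have "a < k" using \<pi>(1) by (metis atLeastLessThan_iff le0 permutes_not_in)
    have "(\<Sum>i\<in>{0..<k}. \<alpha> i + \<beta> (\<pi> i)) = ?W"
      using sum.permute[OF \<pi>(1), of \<beta>] by (simp add: sum.distrib atLeast0LessThan comp_def)
    moreover have "(\<Sum>i\<in>{0..<k}. if i = \<pi> i then 0 else 1 :: int) \<ge> (\<Sum>i\<in>{a}. if i = \<pi> i then 0 else 1)"
      using \<open>a < k\<close> by (intro sum_mono2) auto
    ultimately have "(\<Sum>i\<in>{0..<k}. \<alpha> i + \<beta> (\<pi> i) - (if i = \<pi> i then 0 else 1)) \<le> ?W - 1"
      using a by (simp add: sum_subtractf)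
    moreover have "weight_le (\<Prod>i = 0..<k. A $$ (i, \<pi> i))
        (\<Sum>i\<in>{0..<k}. \<alpha> i + \<beta> (\<pi> i) - (if i = \<pi> i then 0 else 1))"
      using permutes_in_image[OF \<pi>(1)] by (intro weight_le_prod entry) auto
    ultimately show ?thesis by (blast intro: weight_le_mono)
  qed
  have W: "expo_weight (\<Sum>i<k. T i) = ?W"
    using wt by (simp add: expo_weight_sum)
  have main: "lead (\<Prod>i = 0..<k. A $$ (i, i)) (\<Sum>i<k. T i)"
    unfolding atLeast0LessThan using diag by (intro lead_prod) auto
  have "det A = (\<Prod>i = 0..<k. A $$ (i, i)) + (\<Sum>\<pi>\<in>?S - {id}. signof \<pi> * (\<Prod>i = 0..<k. A $$ (i, \<pi> i)))"
    unfolding det_def'[OF A] by (subst sum.remove[OF fin, of id]) (auto simp: permutes_id)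
  then have "det A - mon (\<Sum>i<k. T i) = ((\<Prod>i = 0..<k. A $$ (i, i)) - mon (\<Sum>i<k. T i)) +
      (\<Sum>\<pi>\<in>?S - {id}. signof \<pi> * (\<Prod>i = 0..<k. A $$ (i, \<pi> i)))" by simp
  also have "weight_le \<dots> (?W - 1)"
    using main other W by (intro weight_le_add weight_le_sum) (auto simp: lead_def weight_le_signof)
  finally show ?thesis by (simp add: lead_def W)
qed

section \<open>Ideals and colon ideals of the polynomial ring\<close>

lemma mpoly_idealI:
  fixes I :: "'k::field mpoly set"
  assumes "I \<subseteq> carrier (mpoly_ring m n)" "0 \<in> I"
    and "\<And>p q. p \<in> I \<Longrightarrow> q \<in> I \<Longrightarrow> p + q \<in> I"
    and "\<And>r p. r \<in> carrier (mpoly_ring m n) \<Longrightarrow> p \<in> I \<Longrightarrow> r * p \<in> I"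
  shows "ideal I (mpoly_ring m n)"
proof -
  interpret cring "mpoly_ring m n :: 'k mpoly ring" by (rule cring_mpoly_ring)
  show ?thesis
  proof (rule idealI)
    show "subgroup I (add_monoid (mpoly_ring m n))"
    proof (rule add.subgroupI)
      fix p assume p: "p \<in> I"
      have "\<ominus>\<^bsub>mpoly_ring m n\<^esub> \<one>\<^bsub>mpoly_ring m n\<^esub> \<otimes>\<^bsub>mpoly_ring m n\<^esub> p \<in> I"
        using assms(4) p by (metis a_inv_closed mpoly_ring_simps(1) one_closed)
      then show "\<ominus>\<^bsub>mpoly_ring m n\<^esub> p \<in> I"
        using p assms(1) by (simp add: l_minus subset_iff del: mpoly_ring_simps)
    qed (use assms in auto)
    fix a x :: "'k mpoly" assume "a \<in> I" "x \<in> carrier (mpoly_ring m n)"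
    then show "x \<otimes>\<^bsub>mpoly_ring m n\<^esub> a \<in> I" "a \<otimes>\<^bsub>mpoly_ring m n\<^esub> x \<in> I"
      using assms(4)[of x a] by (simp_all add: mult.commute[of a])
  qed (rule ring_axioms)
qed

context
  fixes m n :: nat and I :: "'k::field mpoly set"
  assumes I: "ideal I (mpoly_ring m n)"
begin

lemma mpoly_ideal_carrier: "p \<in> I \<Longrightarrow> p \<in> carrier (mpoly_ring m n)"
  by (rule ideal.Icarr[OF I])

lemma mpoly_ideal_zero: "0 \<in> I"
  using additive_subgroup.zero_closed[OF ideal.axioms(1)[OF I]] by simp

lemma mpoly_ideal_add: "p \<in> I \<Longrightarrow> q \<in> I \<Longrightarrow> p + q \<in> I"
  using additive_subgroup.a_closed[OF ideal.axioms(1)[OF I], of p q] by simp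

lemma mpoly_ideal_mult: "r \<in> carrier (mpoly_ring m n) \<Longrightarrow> p \<in> I \<Longrightarrow> r * p \<in> I"
  using ideal.I_l_closed[OF I, of p r] by simp

lemma mpoly_ideal_uminus: "p \<in> I \<Longrightarrow> - p \<in> I"
  using mpoly_ideal_mult[of "- 1" p]
  by (simp add: carrier_eq_poly_over poly_over_uminus)

lemma mpoly_ideal_diff: "p \<in> I \<Longrightarrow> q \<in> I \<Longrightarrow> p - q \<in> I"
  using mpoly_ideal_add[of p "- q"] mpoly_ideal_uminus[of q] by simp

lemma mpoly_ideal_sum: "(\<And>x. x \<in> A \<Longrightarrow> p x \<in> I) \<Longrightarrow> sum p A \<in> I"
  by (induction A rule: infinite_finite_induct) (auto intro: mpoly_ideal_add mpoly_ideal_zero)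

end

lemma Idl_ideal:
  fixes S :: "'k::field mpoly set"
  assumes "S \<subseteq> carrier (mpoly_ring m n)"
  shows "ideal (Idl\<^bsub>mpoly_ring m n\<^esub> S) (mpoly_ring m n)" "S \<subseteq> Idl\<^bsub>mpoly_ring m n\<^esub> S"
  using ring.genideal_ideal[OF cring.axioms(1)[OF cring_mpoly_ring] assms]
    ring.genideal_self[OF cring.axioms(1)[OF cring_mpoly_ring] assms] by auto

lemma Idl_minimal:
  fixes S :: "'k::field mpoly set"
  assumes "ideal I (mpoly_ring m n)" "S \<subseteq> I"
  shows "Idl\<^bsub>mpoly_ring m n\<^esub> S \<subseteq> I"
  using ring.genideal_minimal[OF cring.axioms(1)[OF cring_mpoly_ring] assms] .

lemma Idl_mono:
  fixes S :: "'k::field mpoly set"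
  assumes "S \<subseteq> T" "T \<subseteq> carrier (mpoly_ring m n)"
  shows "Idl\<^bsub>mpoly_ring m n\<^esub> S \<subseteq> Idl\<^bsub>mpoly_ring m n\<^esub> T"
  using assms Idl_ideal[of T m n] by (intro Idl_minimal) auto

lemma mult_Idl_subset:
  fixes S :: "'k::field mpoly set"
  assumes "ideal I (mpoly_ring m n)" "S \<subseteq> carrier (mpoly_ring m n)" "h \<in> carrier (mpoly_ring m n)"
    and "\<And>s. s \<in> S \<Longrightarrow> h * s \<in> I" and "p \<in> Idl\<^bsub>mpoly_ring m n\<^esub> S"
  shows "h * p \<in> I"
proof -
  have "ideal {p \<in> carrier (mpoly_ring m n). h * p \<in> I} (mpoly_ring m n)"
    using assms(1)
    by (intro mpoly_idealI)
      (auto simp: carrier_eq_poly_over distrib_left mult.left_commute[of h]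
        intro: poly_over_add poly_over_mult mpoly_ideal_zero mpoly_ideal_add mpoly_ideal_mult[unfolded carrier_eq_poly_over])
  then show ?thesis
    using Idl_minimal[of "{p \<in> carrier (mpoly_ring m n). h * p \<in> I}" m n S] assms by blast
qed

lemma Idl_singleton:
  fixes a :: "'k::field mpoly"
  assumes "a \<in> carrier (mpoly_ring m n)"
  shows "PIdl\<^bsub>mpoly_ring m n\<^esub> a = Idl\<^bsub>mpoly_ring m n\<^esub> {a}"
  using cring.cgenideal_eq_genideal[OF cring_mpoly_ring assms] .

lemma mem_PIdl_iff: "p \<in> PIdl\<^bsub>mpoly_ring m n\<^esub> a \<longleftrightarrow> (\<exists>r \<in> carrier (mpoly_ring m n). p = r * a)"
  by (auto simp: cgenideal_def)

lemma knutson_mpoly_ideal: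
  fixes f :: "'k::field mpoly"
  assumes "f \<in> carrier (mpoly_ring m n)" "I \<in> knutson_ideals (mpoly_ring m n) f"
  shows "ideal I (mpoly_ring m n)"
  by (rule knutson_ideals_contain(1)[OF cring_mpoly_ring assms])

text \<open>Colons by a principal ideal \<open>(h)\<close> suffice throughout, so membership in the colon only has to be
  tested on \<open>h\<close>.\<close>
lemma knutson_colon_element:
  fixes f :: "'k::field mpoly"
  assumes f: "f \<in> carrier (mpoly_ring m n)"
    and I: "I \<in> knutson_ideals (mpoly_ring m n) f"
    and h: "h \<in> carrier (mpoly_ring m n)"
    and P: "P \<subseteq> carrier (mpoly_ring m n)"
    and iff: "\<And>g. g \<in> carrier (mpoly_ring m n) \<Longrightarrow> g * h \<in> I \<longleftrightarrow> g \<in> P"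
  shows "P \<in> knutson_ideals (mpoly_ring m n) f"
proof -
  note idl = knutson_mpoly_ideal[OF f I]
  have "P = ideal_colon (mpoly_ring m n) I (PIdl\<^bsub>mpoly_ring m n\<^esub> h)"
  proof (intro equalityI subsetI)
    fix g assume "g \<in> P"
    then have g: "g \<in> carrier (mpoly_ring m n)" "g * h \<in> I" using P iff by auto
    have "g * b \<in> I" if "b \<in> PIdl\<^bsub>mpoly_ring m n\<^esub> h" for b
      using that mpoly_ideal_mult[OF idl _ g(2)] by (auto simp: mem_PIdl_iff mult.left_commute)
    then show "g \<in> ideal_colon (mpoly_ring m n) I (PIdl\<^bsub>mpoly_ring m n\<^esub> h)"
      using g by (simp add: ideal_colon_def)
  next
    fix g assume "g \<in> ideal_colon (mpoly_ring m n) I (PIdl\<^bsub>mpoly_ring m n\<^esub> h)"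
    then show "g \<in> P"
      using iff cring.cgenideal_ideal[OF cring_mpoly_ring h] ring.cgenideal_self[OF cring.axioms(1)[OF cring_mpoly_ring] h]
      by (auto simp: ideal_colon_def)
  qed
  also have "\<dots> \<in> knutson_ideals (mpoly_ring m n) f"
    by (intro knutson_ideals.colon I cring.cgenideal_ideal cring_mpoly_ring h)
  finally show ?thesis .
qed

text \<open>The prime \<open>P\<close> is given as the kernel of a multiplicative map into a domain: if \<open>g h \<in> I \<subseteq> P\<close> and
  \<open>h \<notin> P\<close>, then \<open>g \<in> P\<close>, so \<open>I : h = P\<close>.\<close>
lemma knutson_kernel:
  fixes f :: "'k::field mpoly" and \<Phi> :: "'k mpoly \<Rightarrow> 'k mpoly"
  assumes f: "f \<in> carrier (mpoly_ring m n)"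
    and I: "I \<in> knutson_ideals (mpoly_ring m n) f"
    and h: "h \<in> carrier (mpoly_ring m n)"
    and mult: "\<And>p q. \<Phi> (p * q) = \<Phi> p * \<Phi> q"
    and P: "P = {g \<in> carrier (mpoly_ring m n). \<Phi> g = 0}"
    and "I \<subseteq> P" "\<Phi> h \<noteq> 0" and hP: "\<And>p. p \<in> P \<Longrightarrow> h * p \<in> I"
  shows "P \<in> knutson_ideals (mpoly_ring m n) f"
proof (rule knutson_colon_element[OF f I h])
  fix g :: "'k mpoly" assume g: "g \<in> carrier (mpoly_ring m n)"
  have "g \<in> P" if "g * h \<in> I"
  proof -
    have "\<Phi> g * \<Phi> h = 0" using that \<open>I \<subseteq> P\<close> P mult by auto
    then show ?thesis using \<open>\<Phi> h \<noteq> 0\<close> g P by simp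
  qed
  then show "g * h \<in> I \<longleftrightarrow> g \<in> P" using hP by (auto simp: mult.commute)
qed (use P in auto)

lemma knutson_Idl_UN:
  fixes f :: "'k::field mpoly"
  assumes f: "f \<in> carrier (mpoly_ring m n)" and "finite A" "A \<noteq> {}"
    and "\<And>a. a \<in> A \<Longrightarrow> S a \<subseteq> carrier (mpoly_ring m n)"
    and "\<And>a. a \<in> A \<Longrightarrow> Idl\<^bsub>mpoly_ring m n\<^esub> (S a) \<in> knutson_ideals (mpoly_ring m n) f"
  shows "Idl\<^bsub>mpoly_ring m n\<^esub> (\<Union>a\<in>A. S a) \<in> knutson_ideals (mpoly_ring m n) f"
  using assms(2-)
proof (induction A rule: finite_ne_induct)
  case (insert a A)
  let ?R = "mpoly_ring m n :: 'k mpoly ring"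
  interpret cring ?R by (rule cring_mpoly_ring)
  let ?B = "\<Union>a\<in>A. S a"
  have sub: "S a \<subseteq> carrier ?R" "?B \<subseteq> carrier ?R" using insert.prems by auto
  have "Idl\<^bsub>?R\<^esub> (S a \<union> ?B) = Idl\<^bsub>?R\<^esub> (Idl\<^bsub>?R\<^esub> (S a) \<union> Idl\<^bsub>?R\<^esub> ?B)"
    (is "?L = ?M")
  proof
    have "Idl\<^bsub>?R\<^esub> (S a) \<union> Idl\<^bsub>?R\<^esub> ?B \<subseteq> carrier ?R"
      using Idl_ideal(1)[OF sub(1)] Idl_ideal(1)[OF sub(2)] mpoly_ideal_carrier by blast
    then show "?L \<subseteq> ?M"
      using Idl_ideal(2)[OF sub(1)] Idl_ideal(2)[OF sub(2)] by (intro Idl_mono) auto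
    show "?M \<subseteq> ?L"
      using sub by (intro Idl_minimal Idl_ideal Un_least Idl_mono) auto
  qed
  also have "\<dots> = Idl\<^bsub>?R\<^esub> (S a) <+>\<^bsub>?R\<^esub> Idl\<^bsub>?R\<^esub> ?B"
    by (rule union_genideal[OF Idl_ideal(1)[OF sub(1)] Idl_ideal(1)[OF sub(2)]])
  finally show ?case
    using insert by (simp add: knutson_ideals.sum)
qed simp

section \<open>The diagonal minors as linear forms in a column\<close>

text \<open>The determinant on the rows and columns of the diagonal \<open>c\<close> for an arbitrary matrix \<open>M\<close> in place of
  the generic one, so that a column can be exchanged.\<close>
definition diagonal_det :: "nat \<Rightarrow> nat \<Rightarrow> int \<Rightarrow> (nat \<Rightarrow> nat \<Rightarrow> 'k::field mpoly) \<Rightarrow> 'k mpoly" where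
  "diagonal_det m n c M =
     (let rs = diagonal_rows m n c
      in det (mat (length rs) (length rs) (\<lambda>(a, b). M (rs ! a) (nat (int (rs ! b) + c)))))"

lemma diagonal_minor_eq: "diagonal_minor m n c = diagonal_det m n c xvar"
  unfolding diagonal_minor_def minor_def diagonal_det_def Let_def
  by (intro arg_cong[of _ _ det] eq_matI) auto

lemma set_diagonal_rows: "set (diagonal_rows m n c) = {i. 1 \<le> i \<and> i \<le> m \<and> 1 \<le> int i + c \<and> int i + c \<le> int n}"
  by (auto simp: diagonal_rows_def)

lemma distinct_diagonal_rows: "distinct (diagonal_rows m n c)"
  by (simp add: diagonal_rows_def)

lemma diagonal_rows_nth:
  assumes "a < length (diagonal_rows m n c)"
  shows "diagonal_rows m n c ! a \<in> {1..m}" "nat (int (diagonal_rows m n c ! a) + c) \<in> {1..n}"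
    "int (nat (int (diagonal_rows m n c ! a) + c)) = int (diagonal_rows m n c ! a) + c"
  using nth_mem[OF assms] unfolding set_diagonal_rows by auto

lemma diagonal_column_eq_iff:
  assumes "a < length (diagonal_rows m n c)" "b < length (diagonal_rows m n c)"
  shows "nat (int (diagonal_rows m n c ! a) + c) = nat (int (diagonal_rows m n c ! b) + c) \<longleftrightarrow> a = b"
proof -
  have "nat (int (diagonal_rows m n c ! a) + c) = nat (int (diagonal_rows m n c ! b) + c) \<longleftrightarrow>
      diagonal_rows m n c ! a = diagonal_rows m n c ! b"
    using diagonal_rows_nth(3)[OF assms(1)] diagonal_rows_nth(3)[OF assms(2)] by linarith
  then show ?thesis
    using nth_eq_iff_index_eq[OF distinct_diagonal_rows assms] by simp
qed

lemma diagonal_position: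
  assumes "i \<in> {1..m}" "j \<in> {1..n}" "c = int j - int i"
  obtains b where "b < length (diagonal_rows m n c)" "diagonal_rows m n c ! b = i"
    "nat (int (diagonal_rows m n c ! b) + c) = j"
proof -
  have "i \<in> set (diagonal_rows m n c)" using assms by (auto simp: set_diagonal_rows)
  then show thesis using that assms(3) by (auto simp: in_set_conv_nth)
qed

lemma diagonal_det_poly_over:
  assumes "\<And>i j. i \<in> {1..m} \<Longrightarrow> j \<in> {1..n} \<Longrightarrow> M i j \<in> poly_over S"
  shows "diagonal_det m n c M \<in> poly_over S"
  unfolding diagonal_det_def Let_def
  by (rule poly_over_det[where k = "length (diagonal_rows m n c)"]) (auto intro!: assms diagonal_rows_nth[unfolded atLeastAtMost_iff] dest: diagonal_rows_nth)

text \<open>The coefficient of \<open>x\<^bsub>ij\<^esub>\<close> in the expansion of the diagonal minor along column \<open>j\<close>. Written with a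
  unit vector in that column, it is automatically zero for rows \<open>i\<close> off the minor, so that expansions may
  run over all rows \<open>1, \<dots>, m\<close>.\<close>
definition diagonal_cofactor :: "nat \<Rightarrow> nat \<Rightarrow> int \<Rightarrow> nat \<Rightarrow> nat \<Rightarrow> 'k::field mpoly" where
  "diagonal_cofactor m n c j i =
     diagonal_det m n c (\<lambda>i' j'. if j' = j then (if i' = i then 1 else 0) else xvar i' j')"

text \<open>Laplace expansion along column \<open>j\<close>, whose cofactors do not depend on the entries of that column.\<close>
lemma diagonal_det_replace_column:
  assumes "i\<^sub>0 \<in> {1..m}" "j \<in> {1..n}" and c: "c = int j - int i\<^sub>0"
  shows "diagonal_det m n c (\<lambda>i' j'. if j' = j then y i' else xvar i' j') =
    (\<Sum>i\<in>{1..m}. y i * (diagonal_cofactor m n c j i :: 'k::field mpoly))"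
proof -
  define rs where "rs = diagonal_rows m n c"
  define k where "k = length rs"
  obtain b where b: "b < k" "nat (int (rs ! b) + c) = j"
    using diagonal_position[OF assms] unfolding rs_def k_def by metis
  define A where "A y = mat k k (\<lambda>(a, b'). if nat (int (rs ! b') + c) = j then y (rs ! a) else xvar (rs ! a) (nat (int (rs ! b') + c)))"
    for y :: "nat \<Rightarrow> 'k mpoly"
  have col: "nat (int (rs ! b') + c) = j \<longleftrightarrow> b' = b" if "b' < k" for b'
    using diagonal_column_eq_iff[of b' m n c b] that b unfolding rs_def k_def by simp
  have cof: "cofactor (A y) a b = cofactor (A (\<lambda>_. 0)) a b" if "a < k" for y a
    unfolding cofactor_def mat_delete_def A_def using b(1) that
    by (intro arg_cong2[of _ _ _ _ "(*)"] arg_cong[of _ _ det] eq_matI) (auto simp: col)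
  have expand: "diagonal_det m n c (\<lambda>i' j'. if j' = j then y i' else xvar i' j') =
      (\<Sum>a<k. y (rs ! a) * cofactor (A (\<lambda>_. 0)) a b)" for y
  proof -
    have "diagonal_det m n c (\<lambda>i' j'. if j' = j then y i' else xvar i' j') = det (A y)"
      unfolding diagonal_det_def A_def rs_def k_def Let_def by simp
    also have "\<dots> = (\<Sum>a<k. A y $$ (a, b) * cofactor (A y) a b)"
      by (rule laplace_expansion_column) (use b in \<open>auto simp: A_def\<close>)
    also have "\<dots> = (\<Sum>a<k. y (rs ! a) * cofactor (A (\<lambda>_. 0)) a b)"
      using b cof by (intro sum.cong) (auto simp: A_def)
    finally show ?thesis .
  qed
  have "(\<Sum>i\<in>{1..m}. y i * diagonal_cofactor m n c j i) =
      (\<Sum>i\<in>{1..m}. \<Sum>a<k. if rs ! a = i then y (rs ! a) * cofactor (A (\<lambda>_. 0)) a b else 0)"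
    unfolding diagonal_cofactor_def expand sum_distrib_left by (intro sum.cong) auto
  also have "\<dots> = (\<Sum>a<k. \<Sum>i\<in>{1..m}. if rs ! a = i then y (rs ! a) * cofactor (A (\<lambda>_. 0)) a b else 0)"
    by (rule sum.swap)
  also have "\<dots> = (\<Sum>a<k. y (rs ! a) * cofactor (A (\<lambda>_. 0)) a b)"
    using diagonal_rows_nth(1)[of _ m n c] by (intro sum.cong) (auto simp: rs_def k_def)
  finally show ?thesis using expand by simp
qed

lemma diagonal_minor_expand_column:
  assumes "i\<^sub>0 \<in> {1..m}" "j \<in> {1..n}" "c = int j - int i\<^sub>0"
  shows "diagonal_minor m n c = (\<Sum>i\<in>{1..m}. xvar i j * (diagonal_cofactor m n c j i :: 'k::field mpoly))"
proof -
  have "diagonal_minor m n c = diagonal_det m n c (\<lambda>i' j'. if j' = j then xvar i' j else xvar i' j' :: 'k mpoly)"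
    unfolding diagonal_minor_eq by (intro arg_cong[of _ _ "diagonal_det m n c"] ext) auto
  then show ?thesis using diagonal_det_replace_column[OF assms, of "\<lambda>i. xvar i j"] by simp
qed

text \<open>The sum is the minor with column \<open>j\<close> overwritten by another of its columns, hence has two equal
  columns.\<close>
lemma diagonal_cofactor_foreign_column:
  assumes "i\<^sub>0 \<in> {1..m}" "j \<in> {1..n}" "c = int j - int i\<^sub>0"
    and "i\<^sub>1 \<in> {1..m}" "j' \<in> {1..n}" "c = int j' - int i\<^sub>1" and "j' \<noteq> j"
  shows "(\<Sum>i\<in>{1..m}. xvar i j' * (diagonal_cofactor m n c j i :: 'k::field mpoly)) = 0"
proof -
  define rs where "rs = diagonal_rows m n c"
  define k where "k = length rs"
  obtain b where b: "b < k" "nat (int (rs ! b) + c) = j"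
    using diagonal_position[OF assms(1-3)] unfolding rs_def k_def by metis
  obtain b' where b': "b' < k" "nat (int (rs ! b') + c) = j'"
    using diagonal_position[OF assms(4-6)] unfolding rs_def k_def by metis
  define A where "A = mat k k (\<lambda>(a, b'). if nat (int (rs ! b') + c) = j then xvar (rs ! a) j' else xvar (rs ! a) (nat (int (rs ! b') + c)) :: 'k mpoly)"
  have "b \<noteq> b'" using b b' assms(7) by auto
  have "col A b = col A b'"
    using b b' assms(7) by (intro eq_vecI) (auto simp: A_def)
  then have "det A = 0"
    using det_identical_columns[of A k b b'] b b' \<open>b \<noteq> b'\<close> by (simp add: A_def)
  then show ?thesis
    using diagonal_det_replace_column[OF assms(1-3), of "\<lambda>i. xvar i j' :: 'k mpoly"]
    unfolding A_def diagonal_det_def rs_def k_def Let_def by (simp only:)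
qed

lemma diagonal_cofactor_poly_over:
  "diagonal_cofactor m n c j i \<in> poly_over ({1..m} \<times> ({1..n} - {j}))"
  unfolding diagonal_cofactor_def
  by (rule diagonal_det_poly_over) (auto intro: xvar_in_poly_over)

definition diagonal_expo :: "nat \<Rightarrow> nat \<Rightarrow> int \<Rightarrow> expo" where
  "diagonal_expo m n c = (\<Sum>i\<in>set (diagonal_rows m n c). Poly_Mapping.single (i, nat (int i + c)) 1)"

lemma diagonal_expo_eq:
  "diagonal_expo m n c = (\<Sum>a<length (diagonal_rows m n c).
     Poly_Mapping.single (diagonal_rows m n c ! a, nat (int (diagonal_rows m n c ! a) + c)) 1)"
  unfolding diagonal_expo_def
  using sum.reindex_bij_betw[OF bij_betw_nth[OF distinct_diagonal_rows refl refl, of m n c],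
      of "\<lambda>i. Poly_Mapping.single (i, nat (int i + c)) 1"] by (rule sym)

section \<open>Initial terms of the diagonal minors and their cofactors\<close>

text \<open>With \<open>j = r + c\<close> this splits the weight of \<open>x\<^bsub>ij\<^esub>\<close> into potentials of the row \<open>i\<close> and of the diagonal
  position \<open>r\<close> of column \<open>j\<close>, minus a square that vanishes exactly on the diagonal.\<close>
lemma weight_shift: "2 * i * (r + c) = (i\<^sup>2 + 2 * c * i) + r\<^sup>2 - (i - r)\<^sup>2" for i r c :: int
  by (simp add: power2_eq_square algebra_simps)

lemma square_ge_one: "i \<noteq> r \<Longrightarrow> (i - r)\<^sup>2 \<ge> 1" for i r :: int
proof -
  assume "i \<noteq> r"
  then have "(i - r)\<^sup>2 > 0" by simp
  then show ?thesis by linarith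
qed

lemma weight_xvar: "weight_le (xvar i j) w \<longleftrightarrow> 2 * int i * int j \<le> w"
  by (simp add: xvar_eq_mon weight_le_def expo_weight_single del: One_nat_def)

lemma lead_diagonal_minor: "lead (diagonal_minor m n c :: 'k::field mpoly) (diagonal_expo m n c)"
proof -
  define rs where "rs = diagonal_rows m n c"
  define k where "k = length rs"
  have inj: "rs ! a = rs ! b \<longleftrightarrow> a = b" if "a < k" "b < k" for a b
    using nth_eq_iff_index_eq[OF distinct_diagonal_rows] that unfolding rs_def k_def by blast
  have col: "int (nat (int (rs ! a) + c)) = int (rs ! a) + c" if "a < k" for a
    using diagonal_rows_nth(3) that unfolding rs_def k_def by blast
  have nonneg: "0 \<le> int (rs ! a) + c" if "a < k" for a
    using col[OF that] by linarith
  have "lead (det (mat k k (\<lambda>(a, b). xvar (rs ! a) (nat (int (rs ! b) + c)) :: 'k mpoly)))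
      (\<Sum>a<k. Poly_Mapping.single (rs ! a, nat (int (rs ! a) + c)) 1)"
  proof (rule lead_det[where \<alpha> = "\<lambda>a. (int (rs ! a))\<^sup>2 + 2 * c * int (rs ! a)" and \<beta> = "\<lambda>b. (int (rs ! b))\<^sup>2"])
    fix a b assume ab: "a < k" "b < k" "a \<noteq> b"
    then have "(int (rs ! a) - int (rs ! b))\<^sup>2 \<ge> 1" using inj by (intro square_ge_one) auto
    moreover have "2 * int (rs ! a) * int (nat (int (rs ! b) + c)) =
        (int (rs ! a))\<^sup>2 + 2 * c * int (rs ! a) + (int (rs ! b))\<^sup>2 - (int (rs ! a) - int (rs ! b))\<^sup>2"
      unfolding col[OF ab(2)] by (rule weight_shift)
    ultimately have "2 * int (rs ! a) * int (nat (int (rs ! b) + c)) \<le>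
        (int (rs ! a))\<^sup>2 + 2 * c * int (rs ! a) + (int (rs ! b))\<^sup>2 - 1" by linarith
    then have "weight_le (xvar (rs ! a) (nat (int (rs ! b) + c)) :: 'k mpoly)
       ((int (rs ! a))\<^sup>2 + 2 * c * int (rs ! a) + (int (rs ! b))\<^sup>2 - 1)"
      unfolding weight_xvar .
    then show "weight_le (mat k k (\<lambda>(a, b). xvar (rs ! a) (nat (int (rs ! b) + c)) :: 'k mpoly) $$ (a, b))
       ((int (rs ! a))\<^sup>2 + 2 * c * int (rs ! a) + (int (rs ! b))\<^sup>2 - 1)"
      using ab by simp
  qed (use nonneg in \<open>auto simp: lead_xvar expo_weight_single weight_shift[of _ _ c] simp del: One_nat_def\<close>)
  then show ?thesis
    unfolding diagonal_minor_eq diagonal_det_def diagonal_expo_eq by (simp add: rs_def k_def Let_def)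
qed

text \<open>The bounds read as if the weight of \<open>x\<^bsub>ij\<^esub>\<close> had been taken off the weight of the minor: a cofactor
  attains this bound exactly when \<open>x\<^bsub>ij\<^esub>\<close> lies on the diagonal.\<close>
lemma diagonal_cofactor_weight:
  assumes i\<^sub>0: "i\<^sub>0 \<in> {1..m}" and j: "j \<in> {1..n}" and c: "c = int j - int i\<^sub>0"
  shows "i \<noteq> i\<^sub>0 \<Longrightarrow> weight_le (diagonal_cofactor m n c j i :: 'k::field mpoly)
      (expo_weight (diagonal_expo m n c) - 2 * int i * int j - 1)"
    and "\<exists>T. lead (diagonal_cofactor m n c j i\<^sub>0 :: 'k mpoly) T \<and>
      expo_weight T = expo_weight (diagonal_expo m n c) - 2 * int i\<^sub>0 * int j"
proof -
  define rs where "rs = diagonal_rows m n c"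
  define k where "k = length rs"
  obtain b\<^sub>0 where b\<^sub>0: "b\<^sub>0 < k" "rs ! b\<^sub>0 = i\<^sub>0" "nat (int (rs ! b\<^sub>0) + c) = j"
    using diagonal_position[OF assms] unfolding rs_def k_def by metis
  have inj: "rs ! a = rs ! b \<longleftrightarrow> a = b" if "a < k" "b < k" for a b
    using nth_eq_iff_index_eq[OF distinct_diagonal_rows] that unfolding rs_def k_def by blast
  have col: "int (nat (int (rs ! a) + c)) = int (rs ! a) + c" if "a < k" for a
    using diagonal_rows_nth(3) that unfolding rs_def k_def by blast
  have pos: "nat (int (rs ! b') + c) = j \<longleftrightarrow> b' = b\<^sub>0" if "b' < k" for b'
    using diagonal_column_eq_iff[of b' m n c b\<^sub>0] that b\<^sub>0 unfolding rs_def k_def by simp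
  define A where "A i = mat k k (\<lambda>(a, b). if nat (int (rs ! b) + c) = j then (if rs ! a = i then 1 else 0)
      else xvar (rs ! a) (nat (int (rs ! b) + c)) :: 'k mpoly)" for i
  have cof: "diagonal_cofactor m n c j i = det (A i)" for i
    unfolding diagonal_cofactor_def diagonal_det_def A_def rs_def k_def Let_def by simp
  define \<alpha> where "\<alpha> i = (int i)\<^sup>2 + 2 * c * int i" for i
  \<comment> \<open>Column \<open>b\<^sub>0\<close> holds the unit vector, whose entry 1 in row \<open>i\<close> has weight 0; its potential therefore
    cancels the potential of row \<open>i\<close>.\<close>
  define \<beta> where "\<beta> i b = (if b = b\<^sub>0 then - \<alpha> i else (int (rs ! b))\<^sup>2)" for i b
  have A: "A i \<in> carrier_mat k k" for i by (simp add: A_def)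
  have nonneg: "0 \<le> int (rs ! a) + c" if "a < k" for a
    using col[OF that] by linarith
  have entry: "weight_le (A i $$ (a, b)) (\<alpha> (rs ! a) + \<beta> i b - (if a = b \<or> b = b\<^sub>0 then 0 else 1))"
    if "a < k" "b < k" for i a b
    using that inj[of a b] square_ge_one[of "int (rs ! a)" "int (rs ! b)"]
    by (auto simp: A_def pos \<alpha>_def \<beta>_def weight_xvar nonneg weight_shift weight_le_one)
  have W: "expo_weight (diagonal_expo m n c) = (\<Sum>a<k. \<alpha> (rs ! a) + (int (rs ! a))\<^sup>2)"
    unfolding diagonal_expo_eq expo_weight_sum
    by (intro sum.cong) (auto simp: rs_def[symmetric] k_def[symmetric] expo_weight_single nonneg \<alpha>_def weight_shift[of _ _ c] simp del: One_nat_def)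
  have "(\<Sum>a<k. \<beta> i a) = (\<Sum>a<k. (int (rs ! a))\<^sup>2) - (int i\<^sub>0)\<^sup>2 - \<alpha> i" for i
  proof -
    have "(\<Sum>a<k. \<beta> i a) = \<beta> i b\<^sub>0 + (\<Sum>a\<in>{..<k} - {b\<^sub>0}. \<beta> i a)"
      using b\<^sub>0(1) by (simp add: sum.remove)
    also have "(\<Sum>a\<in>{..<k} - {b\<^sub>0}. \<beta> i a) = (\<Sum>a\<in>{..<k} - {b\<^sub>0}. (int (rs ! a))\<^sup>2)"
      by (intro sum.cong) (auto simp: \<beta>_def)
    also have "\<dots> = (\<Sum>a<k. (int (rs ! a))\<^sup>2) - (int i\<^sub>0)\<^sup>2"
      using b\<^sub>0 by (simp add: sum_diff1)
    finally show ?thesis by (simp add: \<beta>_def)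
  qed
  moreover have "2 * int i * int j = \<alpha> i + (int i\<^sub>0)\<^sup>2 - (int i - int i\<^sub>0)\<^sup>2" for i
    using weight_shift[of "int i" "int i\<^sub>0" c] c by (simp add: \<alpha>_def)
  ultimately have S: "(\<Sum>a<k. \<alpha> (rs ! a) + \<beta> i a) =
      expo_weight (diagonal_expo m n c) - 2 * int i * int j - (int i - int i\<^sub>0)\<^sup>2" for i
    by (simp add: W sum.distrib)
  show "weight_le (diagonal_cofactor m n c j i :: 'k mpoly)
      (expo_weight (diagonal_expo m n c) - 2 * int i * int j - 1)" if "i \<noteq> i\<^sub>0"
  proof -
    have "weight_le (det (A i)) (\<Sum>a<k. \<alpha> (rs ! a) + \<beta> i a)"
      by (rule weight_le_det[OF A]) (rule weight_le_mono[OF entry], auto)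
    then show ?thesis
      unfolding cof using S[of i] square_ge_one[of "int i" "int i\<^sub>0"] that by (auto intro: weight_le_mono)
  qed
  define T where "T a = (if a = b\<^sub>0 then 0 else Poly_Mapping.single (rs ! a, nat (int (rs ! a) + c)) (1::nat))" for a
  have wt: "expo_weight (T a) = \<alpha> (rs ! a) + \<beta> i\<^sub>0 a" if "a < k" for a
    using that b\<^sub>0 by (auto simp: T_def \<beta>_def \<alpha>_def expo_weight_single nonneg weight_shift[of _ _ c] simp del: One_nat_def)
  have "lead (det (A i\<^sub>0)) (\<Sum>a<k. T a)"
  proof (rule lead_det[OF A _ _ wt])
    fix a b assume "a < k" "b < k" "a \<noteq> b"
    then show "weight_le (A i\<^sub>0 $$ (a, b)) (\<alpha> (rs ! a) + \<beta> i\<^sub>0 b - 1)"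
      using entry[of a b i\<^sub>0] inj[of a b\<^sub>0] b\<^sub>0 by (cases "b = b\<^sub>0") (auto simp: A_def pos)
  next
    fix a assume "a < k"
    then show "lead (A i\<^sub>0 $$ (a, a)) (T a)"
      using b\<^sub>0 by (auto simp: A_def pos T_def lead_one lead_xvar simp del: One_nat_def)
  qed
  moreover have "expo_weight (\<Sum>a<k. T a) = expo_weight (diagonal_expo m n c) - 2 * int i\<^sub>0 * int j"
    using S[of i\<^sub>0] wt by (simp add: expo_weight_sum)
  ultimately show "\<exists>T. lead (diagonal_cofactor m n c j i\<^sub>0 :: 'k mpoly) T \<and>
      expo_weight T = expo_weight (diagonal_expo m n c) - 2 * int i\<^sub>0 * int j"
    unfolding cof by blast
qed

text \<open>Row \<open>a\<close> belongs to the diagonal through \<open>x\<^bsub>a+s+1,j\<^esub>\<close> and column \<open>b\<close> to the entry \<open>x\<^bsub>b+s+1,j\<^esub>\<close>, both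
  counted from 0. The rows \<open>1, \<dots>, s\<close> are left out: \<open>s = 0\<close> serves the ideal of a column, \<open>s = 1\<close> the
  2-minors that involve row 1.\<close>
definition cofactor_matrix :: "nat \<Rightarrow> nat \<Rightarrow> nat \<Rightarrow> nat \<Rightarrow> 'k::field mpoly mat" where
  "cofactor_matrix m n j s = mat (m - s) (m - s)
     (\<lambda>(a, b). diagonal_cofactor m n (int j - int (a + s + 1)) j (b + s + 1))"

lemma cofactor_matrix_carrier: "cofactor_matrix m n j s \<in> carrier_mat (m - s) (m - s)"
  by (simp add: cofactor_matrix_def)

lemma det_cofactor_matrix_poly_over:
  "det (cofactor_matrix m n j s) \<in> poly_over ({1..m} \<times> ({1..n} - {j}))"
  by (rule poly_over_det[OF cofactor_matrix_carrier])
    (auto simp: cofactor_matrix_def diagonal_cofactor_poly_over simp del: One_nat_def)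

text \<open>The cofactor of \<open>x\<^bsub>ij\<^esub>\<close> in the minor of the diagonal \<open>c\<close> is bounded by the weight of that minor minus the
  weight of \<open>x\<^bsub>ij\<^esub>\<close>, a sum of a row potential and a column potential that is attained on the diagonal.\<close>
lemma det_cofactor_matrix_nonzero:
  assumes j: "j \<in> {1..n}"
  shows "det (cofactor_matrix m n j s :: 'k::field mpoly mat) \<noteq> 0"
proof -
  let ?c = "\<lambda>a. int j - int (a + s + 1)"
  have row: "a + s + 1 \<in> {1..m}" if "a < m - s" for a using that by auto
  have "\<forall>a. \<exists>T. a < m - s \<longrightarrow> lead (diagonal_cofactor m n (?c a) j (a + s + 1) :: 'k mpoly) T \<and>
      expo_weight T = expo_weight (diagonal_expo m n (?c a)) - 2 * int (a + s + 1) * int j"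
    using diagonal_cofactor_weight(2)[OF row j refl, where 'k = 'k] by blast
  from choice[OF this] obtain T where T: "\<And>a. a < m - s \<Longrightarrow> lead (diagonal_cofactor m n (?c a) j (a + s + 1) :: 'k mpoly) (T a)"
    "\<And>a. a < m - s \<Longrightarrow> expo_weight (T a) = expo_weight (diagonal_expo m n (?c a)) - 2 * int (a + s + 1) * int j"
    by blast
  have "lead (det (cofactor_matrix m n j s :: 'k mpoly mat)) (\<Sum>a<m - s. T a)"
  proof (rule lead_det[OF cofactor_matrix_carrier, where
        \<alpha> = "\<lambda>a. expo_weight (diagonal_expo m n (?c a))" and \<beta> = "\<lambda>b. - (2 * int (b + s + 1) * int j)"])
    fix a b assume "a < m - s" "b < m - s" "a \<noteq> b"
    then show "weight_le (cofactor_matrix m n j s $$ (a, b) :: 'k mpoly)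
       (expo_weight (diagonal_expo m n (?c a)) + - (2 * int (b + s + 1) * int j) - 1)"
      using diagonal_cofactor_weight(1)[OF row[of a] j refl, of "b + s + 1", where 'k = 'k]
      by (simp add: cofactor_matrix_def)
  qed (use T in \<open>auto simp: cofactor_matrix_def\<close>)
  then show ?thesis by (rule lead_nonzero)
qed

text \<open>Multiply the system \<open>A y \<equiv> 0\<close> modulo \<open>I\<close> by the adjugate matrix.\<close>
lemma cramer_in_ideal:
  fixes A :: "'k::field mpoly mat"
  assumes I: "ideal I (mpoly_ring m n)" and A: "A \<in> carrier_mat N N"
    and ent: "\<And>a b. a < N \<Longrightarrow> b < N \<Longrightarrow> A $$ (a, b) \<in> carrier (mpoly_ring m n)"
    and z: "\<And>a. a < N \<Longrightarrow> (\<Sum>b<N. A $$ (a, b) * y b) \<in> I" and b: "b < N"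
  shows "det A * y b \<in> I"
proof -
  have B: "adj_mat A \<in> carrier_mat N N" and inv: "adj_mat A * A = det A \<cdot>\<^sub>m 1\<^sub>m N"
    using adj_mat[OF A] by auto
  have adj: "adj_mat A $$ (b, a) \<in> carrier (mpoly_ring m n)" if "a < N" for a
  proof -
    have "det (mat_delete A a b) \<in> carrier (mpoly_ring m n)"
      unfolding carrier_eq_poly_over
      by (rule poly_over_det[OF mat_delete_carrier[OF A]])
        (use A ent that b in \<open>auto simp: mat_delete_def carrier_eq_poly_over\<close>)
    then show ?thesis
      using A that b by (auto simp: adj_mat_def cofactor_def carrier_eq_poly_over
          intro!: poly_over_mult poly_over_power poly_over_uminus)
  qed
  have "det A * y b = (\<Sum>b'<N. (adj_mat A * A) $$ (b, b') * y b')"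
  proof -
    have "(\<Sum>b'<N. (adj_mat A * A) $$ (b, b') * y b') = (\<Sum>b'<N. if b' = b then det A * y b' else 0)"
      using b unfolding inv by (intro sum.cong) auto
    then show ?thesis using b by simp
  qed
  also have "\<dots> = (\<Sum>b'<N. (\<Sum>a<N. adj_mat A $$ (b, a) * A $$ (a, b')) * y b')"
    using A B b by (intro sum.cong) (auto simp: scalar_prod_def atLeast0LessThan)
  also have "\<dots> = (\<Sum>a<N. \<Sum>b'<N. adj_mat A $$ (b, a) * A $$ (a, b') * y b')"
    unfolding sum_distrib_right by (rule sum.swap)
  also have "\<dots> = (\<Sum>a<N. adj_mat A $$ (b, a) * (\<Sum>b'<N. A $$ (a, b') * y b'))"
    by (simp add: sum_distrib_left mult.assoc)
  also have "\<dots> \<in> I"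
    using adj z by (intro mpoly_ideal_sum[OF I]) (rule mpoly_ideal_mult[OF I], auto)
  finally show ?thesis .
qed

section \<open>The diagonal minors as Knutson ideals\<close>

lemma diagonal_minor_carrier: "diagonal_minor m n c \<in> carrier (mpoly_ring m n)"
  unfolding carrier_eq_poly_over diagonal_minor_eq
  by (rule diagonal_det_poly_over) (auto intro: xvar_in_poly_over)

lemma diagonal_product_carrier: "diagonal_product m n \<in> carrier (mpoly_ring m n)"
  using diagonal_minor_carrier unfolding carrier_eq_poly_over diagonal_product_def
  by (intro poly_over_prod) auto

text \<open>The ideal of a factor of \<open>f\<close> is the colon of \<open>(f)\<close> by the complementary factor, which is nonzero.\<close>
lemma knutson_diagonal_minor:
  fixes m n :: nat
  assumes c: "c \<in> {- (int m - 1)..int n - 1}"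
  shows "Idl\<^bsub>mpoly_ring m n\<^esub> {diagonal_minor m n c} \<in>
    knutson_ideals (mpoly_ring m n) (diagonal_product m n :: 'k::field mpoly)"
proof -
  let ?R = "mpoly_ring m n :: 'k mpoly ring"
  let ?d = "diagonal_minor m n c :: 'k mpoly"
  let ?f = "diagonal_product m n :: 'k mpoly"
  define h where "h = (\<Prod>c' \<in> {- (int m - 1)..int n - 1} - {c}. diagonal_minor m n c' :: 'k mpoly)"
  have f: "?f = ?d * h"
    unfolding diagonal_product_def h_def using c by (subst prod.remove[of _ c]) auto
  have h: "h \<in> carrier ?R"
    using diagonal_minor_carrier unfolding h_def carrier_eq_poly_over by (intro poly_over_prod) auto
  have "h \<noteq> 0"
    using lead_nonzero[OF lead_diagonal_minor] unfolding h_def by auto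
  have "PIdl\<^bsub>?R\<^esub> ?d \<in> knutson_ideals ?R ?f"
  proof (rule knutson_colon_element[OF diagonal_product_carrier knutson_ideals.principal h])
    show "PIdl\<^bsub>?R\<^esub> ?d \<subseteq> carrier ?R"
      using diagonal_minor_carrier by (auto simp: mem_PIdl_iff carrier_eq_poly_over intro!: poly_over_mult)
    fix g :: "'k mpoly" assume "g \<in> carrier ?R"
    have "g * h = r * ?f \<longleftrightarrow> g = r * ?d" for r
    proof -
      have "r * ?f = (r * ?d) * h" by (simp add: f mult_ac)
      then show ?thesis using mult_right_cancel[OF \<open>h \<noteq> 0\<close>] by metis
    qed
    then show "g * h \<in> PIdl\<^bsub>?R\<^esub> ?f \<longleftrightarrow> g \<in> PIdl\<^bsub>?R\<^esub> ?d"
      by (simp add: mem_PIdl_iff)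
  qed
  then show ?thesis by (simp add: Idl_singleton diagonal_minor_carrier)
qed

section \<open>Ideals of columns\<close>

lemma kernel_ideal:
  fixes \<Phi> :: "'k::field mpoly \<Rightarrow> 'k mpoly"
  assumes "\<And>p q. \<Phi> (p + q) = \<Phi> p + \<Phi> q" "\<And>p q. \<Phi> (p * q) = \<Phi> p * \<Phi> q"
  shows "ideal {g \<in> carrier (mpoly_ring m n). \<Phi> g = 0} (mpoly_ring m n)"
proof (rule mpoly_idealI)
  have "\<Phi> 0 = 0" using assms(1)[of 0 0] by (metis add_cancel_right_right add_0)
  then show "0 \<in> {g \<in> carrier (mpoly_ring m n). \<Phi> g = 0}" by (simp add: carrier_eq_poly_over)
qed (use assms in \<open>auto simp: carrier_eq_poly_over intro: poly_over_add poly_over_mult\<close>)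

lemma keys_add_nat: "Poly_Mapping.keys (s + t) = Poly_Mapping.keys s \<union> Poly_Mapping.keys (t :: expo)"
  by (auto simp: in_keys_iff lookup_add)

lemma keys_sum_nat: "finite A \<Longrightarrow> Poly_Mapping.keys (\<Sum>a\<in>A. T a :: expo) = (\<Union>a\<in>A. Poly_Mapping.keys (T a))"
  by (induction A rule: finite_induct) (auto simp: keys_add_nat)

lemma expo_split: "v \<in> Poly_Mapping.keys t \<Longrightarrow> Poly_Mapping.single v 1 + (t - Poly_Mapping.single v 1) = (t :: expo)"
  by (rule poly_mapping_eqI) (auto simp: lookup_add lookup_minus lookup_single when_def in_keys_iff)

lemma keys_diff_nat: "Poly_Mapping.keys (s - t) \<subseteq> Poly_Mapping.keys (s :: expo)"
  by (auto simp: in_keys_iff lookup_minus)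

definition kill_column :: "nat \<Rightarrow> 'k::field mpoly \<Rightarrow> 'k mpoly" where
  "kill_column v = monomial_hom (\<lambda>t. if v \<in> snd ` Poly_Mapping.keys t then 0 else mon t)"

lemma kill_column_mult: "kill_column v (p * q) = kill_column v p * kill_column v q"
  unfolding kill_column_def
  by (rule monomial_hom_mult) (auto simp: keys_add_nat mult_single image_Un)

lemma kill_column_add: "kill_column v (p + q) = kill_column v p + kill_column v q"
  by (simp add: kill_column_def monomial_hom_add)

lemma kill_column_diff: "kill_column v (p - q) = kill_column v p - kill_column v q"
  by (simp add: kill_column_def monomial_hom_diff)

lemma kill_column_zero [simp]: "kill_column v 0 = 0"
  by (simp add: kill_column_def)

lemma kill_column_single:
  "kill_column v (Poly_Mapping.single t c) =
     (if v \<in> snd ` Poly_Mapping.keys t then 0 else Poly_Mapping.single t c)"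
  by (simp add: kill_column_def mult_single)

lemma kill_column_xvar: "kill_column v (xvar i j) = (if j = v then 0 else xvar i j)"
  by (auto simp: xvar_def kill_column_single)

lemma kill_column_ident:
  assumes "p \<in> poly_over S" "v \<notin> snd ` S"
  shows "kill_column v p = p"
proof -
  have "v \<notin> snd ` Poly_Mapping.keys t" if "t \<in> Poly_Mapping.keys p" for t
    using assms that by (auto simp: poly_over_def)
  then have "kill_column v p =
      (\<Sum>t\<in>Poly_Mapping.keys p. Poly_Mapping.single t (Poly_Mapping.lookup p t))"
    unfolding kill_column_def monomial_hom_def by (intro sum.cong) (auto simp: mult_single)
  then show ?thesis by (simp only: mpoly_eq_sum)
qed

lemma kill_column_poly_over: "p \<in> poly_over S \<Longrightarrow> kill_column v p \<in> poly_over S"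
  unfolding kill_column_def monomial_hom_def
  by (intro poly_over_sum) (auto simp: mult_single poly_over_def)

definition column_gens :: "nat \<Rightarrow> nat set \<Rightarrow> 'k::field mpoly set" where
  "column_gens m S = {xvar i s | i s. i \<in> {1..m} \<and> s \<in> S}"

lemma column_gens_carrier: "S \<subseteq> {1..n} \<Longrightarrow> column_gens m S \<subseteq> carrier (mpoly_ring m n)"
  by (auto simp: column_gens_def carrier_eq_poly_over intro!: xvar_in_poly_over)

text \<open>Setting column \<open>v\<close> to zero removes exactly the terms divisible by some \<open>x\<^bsub>iv\<^esub>\<close>.\<close>
lemma minus_kill_column_mem:
  fixes p :: "'k::field mpoly"
  assumes p: "p \<in> carrier (mpoly_ring m n)" and v: "v \<in> {1..n}"
  shows "p - kill_column v p \<in> Idl\<^bsub>mpoly_ring m n\<^esub> (column_gens m {v})"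
proof -
  let ?I = "Idl\<^bsub>mpoly_ring m n\<^esub> (column_gens m {v}) :: 'k mpoly set"
  have gens: "column_gens m {v} \<subseteq> carrier (mpoly_ring m n :: 'k mpoly ring)" using v by (intro column_gens_carrier) auto
  note I = Idl_ideal(1)[OF gens]
  have mono: "Poly_Mapping.single t c - kill_column v (Poly_Mapping.single t c) \<in> ?I"
    if t: "Poly_Mapping.keys t \<subseteq> {1..m} \<times> {1..n}" for t c
  proof (cases "v \<in> snd ` Poly_Mapping.keys t")
    case True
    then obtain i where i: "(i, v) \<in> Poly_Mapping.keys t" by auto
    then have "i \<in> {1..m}" using t by auto
    then have "xvar i v \<in> column_gens m {v}" unfolding column_gens_def by blast
    then have "xvar i v \<in> ?I" using Idl_ideal(2)[OF gens] by blast
    moreover have "Poly_Mapping.single (t - Poly_Mapping.single (i, v) 1) c \<in> carrier (mpoly_ring m n)"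
      unfolding carrier_eq_poly_over using keys_diff_nat t by (intro poly_over_single) blast
    moreover have "Poly_Mapping.single t c = Poly_Mapping.single (t - Poly_Mapping.single (i, v) 1) c * xvar i v"
      unfolding xvar_def mult_single using expo_split[OF i] by (simp add: add.commute)
    ultimately have "Poly_Mapping.single t c \<in> ?I" using mpoly_ideal_mult[OF I] by metis
    then show ?thesis using True by (simp add: kill_column_single)
  qed (simp add: kill_column_single mpoly_ideal_zero[OF I])
  have ksum: "kill_column v (\<Sum>t\<in>A. q t) = (\<Sum>t\<in>A. kill_column v (q t))" for A and q :: "expo \<Rightarrow> 'k mpoly"
    by (induction A rule: infinite_finite_induct) (auto simp: kill_column_add)
  have "p - kill_column v p = (\<Sum>t\<in>Poly_Mapping.keys p. Poly_Mapping.single t (Poly_Mapping.lookup p t) -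
      kill_column v (Poly_Mapping.single t (Poly_Mapping.lookup p t)))"
    by (simp only: sum_subtractf mpoly_eq_sum flip: ksum)
  also have "\<dots> \<in> ?I"
    using p by (intro mpoly_ideal_sum[OF I] mono) (auto simp: mpoly_ring_carrier)
  finally show ?thesis .
qed

lemma column_ideal_eq_kernel:
  assumes v: "v \<in> {1..n}"
  shows "Idl\<^bsub>mpoly_ring m n\<^esub> (column_gens m {v}) =
    {g \<in> carrier (mpoly_ring m n). kill_column v g = (0 :: 'k::field mpoly)}"
proof (intro equalityI Idl_minimal)
  show "ideal {g \<in> carrier (mpoly_ring m n). kill_column v g = (0 :: 'k mpoly)} (mpoly_ring m n)"
    by (rule kernel_ideal[OF kill_column_add kill_column_mult])
  show "column_gens m {v} \<subseteq> {g \<in> carrier (mpoly_ring m n). kill_column v g = (0 :: 'k mpoly)}"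
    using column_gens_carrier[of "{v}" n m] v by (auto simp: column_gens_def kill_column_xvar)
  show "{g \<in> carrier (mpoly_ring m n). kill_column v g = (0 :: 'k mpoly)} \<subseteq> Idl\<^bsub>mpoly_ring m n\<^esub> (column_gens m {v})"
    using minus_kill_column_mem[OF _ v, where 'k = 'k] by fastforce
qed

lemma knutson_diagonal_minors:
  fixes m n :: nat
  assumes "j \<in> {1..n}" "B \<subseteq> {1..m}" "B \<noteq> {}"
  shows "Idl\<^bsub>mpoly_ring m n\<^esub> ((\<lambda>b. diagonal_minor m n (int j - int b)) ` B) \<in>
    knutson_ideals (mpoly_ring m n) (diagonal_product m n :: 'k::field mpoly)"
proof -
  have "Idl\<^bsub>mpoly_ring m n\<^esub> (\<Union>b\<in>B. {diagonal_minor m n (int j - int b) :: 'k mpoly}) \<in>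
    knutson_ideals (mpoly_ring m n) (diagonal_product m n)"
    using assms finite_subset[OF assms(2)]
    by (intro knutson_Idl_UN diagonal_product_carrier knutson_diagonal_minor)
      (auto simp: diagonal_minor_carrier)
  then show ?thesis by (simp add: UNION_singleton_eq_range)
qed

lemma xvar_carrier: "i \<in> {1..m} \<Longrightarrow> j \<in> {1..n} \<Longrightarrow> xvar i j \<in> carrier (mpoly_ring m n)"
  by (auto simp: carrier_eq_poly_over intro!: xvar_in_poly_over)

lemma diagonal_cofactor_carrier: "diagonal_cofactor m n c j i \<in> carrier (mpoly_ring m n)"
  unfolding carrier_eq_poly_over by (rule poly_over_mono[OF _ diagonal_cofactor_poly_over]) auto

lemma det_cofactor_matrix_carrier: "det (cofactor_matrix m n j s) \<in> carrier (mpoly_ring m n)"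
  unfolding carrier_eq_poly_over by (rule poly_over_mono[OF _ det_cofactor_matrix_poly_over]) auto

text \<open>The minors of the \<open>m\<close> diagonals that meet column \<open>s\<close> form a square linear system for its entries, so
  by Cramer's rule the determinant of the cofactors multiplies the ideal of the column into the ideal of
  these minors. That determinant is nonzero and does not involve column \<open>s\<close>, so it lies outside the
  prime generated by the column.\<close>
lemma knutson_column:
  fixes m n :: nat
  assumes "m \<ge> 1" and s: "s \<in> {1..n}"
  shows "Idl\<^bsub>mpoly_ring m n\<^esub> (column_gens m {s}) \<in>
    knutson_ideals (mpoly_ring m n) (diagonal_product m n :: 'k::field mpoly)"
proof -
  let ?R = "mpoly_ring m n :: 'k mpoly ring"
  let ?D = "(\<lambda>b. diagonal_minor m n (int s - int b)) ` {1..m} :: 'k mpoly set"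
  let ?I = "Idl\<^bsub>?R\<^esub> ?D"
  let ?Q = "Idl\<^bsub>?R\<^esub> (column_gens m {s})"
  let ?h = "det (cofactor_matrix m n s 0) :: 'k mpoly"
  have D: "?D \<subseteq> carrier ?R" using diagonal_minor_carrier by auto
  have G: "column_gens m {s} \<subseteq> carrier ?R" using s by (intro column_gens_carrier) auto
  note I = Idl_ideal(1)[OF D] and Q = Idl_ideal(1)[OF G]
  show ?thesis
  proof (rule knutson_kernel[OF diagonal_product_carrier _ _ kill_column_mult column_ideal_eq_kernel[OF s]])
    show "?I \<in> knutson_ideals ?R (diagonal_product m n)"
      by (rule knutson_diagonal_minors[OF s]) (use assms in auto)
    show "?h \<in> carrier ?R" by (rule det_cofactor_matrix_carrier)
    have "kill_column s ?h = ?h"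
      by (rule kill_column_ident[OF det_cofactor_matrix_poly_over]) auto
    then show "kill_column s ?h \<noteq> 0" using det_cofactor_matrix_nonzero[OF s] by metis
    show "?I \<subseteq> ?Q"
    proof (rule Idl_minimal[OF Q], safe)
      fix b assume b: "b \<in> {1..m}"
      have "xvar i s \<in> ?Q" if "i \<in> {1..m}" for i
        using Idl_ideal(2)[OF G] that by (auto simp: column_gens_def)
      then show "diagonal_minor m n (int s - int b) \<in> ?Q"
        unfolding diagonal_minor_expand_column[OF b s refl] mult.commute[of "xvar _ _"]
        by (intro mpoly_ideal_sum[OF Q] mpoly_ideal_mult[OF Q] diagonal_cofactor_carrier)
    qed
    fix p assume "p \<in> ?Q"
    then show "?h * p \<in> ?I"
    proof (rule mult_Idl_subset[OF I G det_cofactor_matrix_carrier, rotated])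
      fix g :: "'k mpoly" assume "g \<in> column_gens m {s}"
      then obtain i where i: "i \<in> {1..m}" "g = xvar i s" by (auto simp: column_gens_def)
      have "?h * xvar (i - 1 + 1) s \<in> ?I"
      proof (rule cramer_in_ideal[OF I cofactor_matrix_carrier, where y = "\<lambda>b. xvar (b + 1) s" and b = "i - 1"])
        show "i - 1 < m - 0" using i by auto
        show "(cofactor_matrix m n s 0 :: 'k mpoly mat) $$ (a, b) \<in> carrier ?R" if "a < m - 0" "b < m - 0" for a b
          using that diagonal_cofactor_carrier by (simp add: cofactor_matrix_def)
        fix a assume a: "a < m - 0"
        then have a': "a + 1 \<in> {1..m}" by auto
        have "(\<Sum>b<m - 0. cofactor_matrix m n s 0 $$ (a, b) * xvar (b + 1) s) =
            (\<Sum>b<m. xvar (Suc b) s * diagonal_cofactor m n (int s - int (a + 1)) s (Suc b) :: 'k mpoly)"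
          using a by (intro sum.cong) (auto simp: cofactor_matrix_def mult.commute)
        also have "\<dots> = (\<Sum>b\<in>{1..m}. xvar b s * diagonal_cofactor m n (int s - int (a + 1)) s b)"
          by (simp only: One_nat_def sum.atLeast1_atMost_eq)
        also have "\<dots> = diagonal_minor m n (int s - int (a + 1))"
          by (rule diagonal_minor_expand_column[OF a' s refl, symmetric])
        finally show "(\<Sum>b<m - 0. (cofactor_matrix m n s 0 :: 'k mpoly mat) $$ (a, b) * xvar (b + 1) s) \<in> ?I"
          using subsetD[OF Idl_ideal(2)[OF D] imageI[OF a']] by (simp only:)
      qed
      then show "?h * g \<in> ?I" using i by simp
    qed
  qed
qed

definition scale_expo :: "nat \<Rightarrow> expo \<Rightarrow> expo" where
  "scale_expo k t = Poly_Mapping.map ((*) k) t"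

lemma lookup_scale_expo [simp]: "Poly_Mapping.lookup (scale_expo k t) v = k * Poly_Mapping.lookup t v"
  by (simp add: scale_expo_def Poly_Mapping.map.rep_eq when_def)

lemma scale_expo_add: "scale_expo (k + l) t = scale_expo k t + scale_expo l t"
  by (rule poly_mapping_eqI) (simp add: lookup_add distrib_right)

section \<open>2-minors\<close>

text \<open>Both pairs of indices are unordered here; exchanging or repeating an index changes the sign or
  gives zero, which never affects the ideals.\<close>
definition two_minor :: "nat \<Rightarrow> nat \<Rightarrow> nat \<Rightarrow> nat \<Rightarrow> 'k::field mpoly" where
  "two_minor a b i j = xvar a i * xvar b j - xvar a j * xvar b i"

lemma minor_two: "minor [a, b] [i, j] = (two_minor a b i j :: 'k::field mpoly)"
proof -
  let ?A = "mat 2 2 (\<lambda>(k, l). xvar ([a, b] ! k) ([i, j] ! l)) :: 'k mpoly mat"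
  have "cofactor ?A 0 0 = xvar b j" "cofactor ?A 1 0 = - xvar a j"
    unfolding cofactor_def by (subst det_single; simp add: mat_delete_def)+
  then have "det ?A = two_minor a b i j"
    using laplace_expansion_column[of ?A 2 0]
    by (simp add: two_minor_def numeral_2_eq_2 mult.commute)
  then show ?thesis by (simp add: minor_def numeral_2_eq_2)
qed

lemma two_minor_zero [simp]: "two_minor a a i j = 0" "two_minor a b i i = 0"
  by (simp_all add: two_minor_def mult.commute)

lemma two_minor_swap: "two_minor b a i j = - two_minor a b i j" "two_minor a b j i = - two_minor a b i j"
  by (simp_all add: two_minor_def mult.commute)

definition minor_gens :: "nat \<Rightarrow> (nat \<times> nat) set \<Rightarrow> 'k::field mpoly set" where
  "minor_gens m A = {two_minor a b i j | a b i j. a \<in> {1..m} \<and> b \<in> {1..m} \<and> (i, j) \<in> A}"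

lemma two_minor_carrier:
  "a \<in> {1..m} \<Longrightarrow> b \<in> {1..m} \<Longrightarrow> i \<in> {1..n} \<Longrightarrow> j \<in> {1..n} \<Longrightarrow> two_minor a b i j \<in> carrier (mpoly_ring m n)"
  unfolding two_minor_def carrier_eq_poly_over
  by (intro poly_over_diff poly_over_mult xvar_in_poly_over) auto

lemma minor_gens_carrier: "A \<subseteq> {1..n} \<times> {1..n} \<Longrightarrow> minor_gens m A \<subseteq> carrier (mpoly_ring m n)"
  unfolding minor_gens_def using two_minor_carrier by blast

section \<open>The Segre substitution\<close>

text \<open>For columns \<open>j \<in> C\<close> this is the exponent of \<open>s\<^sub>i t\<^sub>j\<close>, where the variables \<open>x\<^bsub>i0\<^esub>\<close> and \<open>x\<^bsub>0j\<^esub>\<close> outside the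
  matrix play the roles of \<open>s\<^sub>i\<close> and \<open>t\<^sub>j\<close>; thus the substitution stays within the same domain.\<close>
definition segre_var :: "nat set \<Rightarrow> nat \<times> nat \<Rightarrow> expo" where
  "segre_var C v = (if snd v \<in> C then Poly_Mapping.single (fst v, 0) 1 + Poly_Mapping.single (0, snd v) 1
     else Poly_Mapping.single v 1)"

definition segre_expo :: "nat set \<Rightarrow> expo \<Rightarrow> expo" where
  "segre_expo C t = (\<Sum>v\<in>Poly_Mapping.keys t. scale_expo (Poly_Mapping.lookup t v) (segre_var C v))"

definition segre :: "nat set \<Rightarrow> 'k::field mpoly \<Rightarrow> 'k mpoly" where
  "segre C = monomial_hom (\<lambda>t. mon (segre_expo C t))"

lemma scale_expo_zero [simp]: "scale_expo 0 t = 0" "scale_expo k 0 = 0"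
  by (rule poly_mapping_eqI, simp)+

lemma scale_expo_one [simp]: "scale_expo (Suc 0) t = t"
  by (rule poly_mapping_eqI) simp

lemma segre_expo_superset:
  assumes "finite A" "Poly_Mapping.keys t \<subseteq> A"
  shows "segre_expo C t = (\<Sum>v\<in>A. scale_expo (Poly_Mapping.lookup t v) (segre_var C v))"
  unfolding segre_expo_def
  by (rule sum.mono_neutral_left) (use assms in \<open>auto simp: in_keys_iff\<close>)

lemma segre_expo_add: "segre_expo C (s + t) = segre_expo C s + segre_expo C t"
proof -
  let ?A = "Poly_Mapping.keys s \<union> Poly_Mapping.keys t"
  have "Poly_Mapping.keys (s + t) \<subseteq> ?A" by (rule Poly_Mapping.keys_add)
  then show ?thesis
    by (simp add: segre_expo_superset[of ?A] lookup_add scale_expo_add sum.distrib)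
qed

lemma segre_expo_single: "segre_expo C (Poly_Mapping.single v 1) = segre_var C v"
  by (simp add: segre_expo_def)

lemma keys_segre_expo: "Poly_Mapping.keys (segre_expo C t) = (\<Union>v\<in>Poly_Mapping.keys t. Poly_Mapping.keys (segre_var C v))"
  unfolding segre_expo_def by (subst keys_sum_nat) (auto simp: in_keys_iff)

lemma keys_segre_var: "Poly_Mapping.keys (segre_var C (i, j)) = (if j \<in> C then {(i, 0), (0, j)} else {(i, j)})"
  by (auto simp: segre_var_def keys_add_nat)

lemma segre_mult: "segre C (p * q) = segre C p * segre C q"
  unfolding segre_def by (rule monomial_hom_mult) (simp add: segre_expo_add mult_single)

lemma segre_add: "segre C (p + q) = segre C p + segre C q"
  by (simp add: segre_def monomial_hom_add)

lemma segre_diff: "segre C (p - q) = segre C p - segre C q"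
  by (simp add: segre_def monomial_hom_diff)

lemma segre_xvar: "segre C (xvar i j) = (if j \<in> C then xvar i 0 * xvar 0 j else xvar i j)"
  by (simp add: segre_def xvar_eq_mon segre_expo_single segre_var_def mult_single del: One_nat_def)

lemma segre_xvar_nonzero: "segre C (xvar i j) \<noteq> 0"
  using lead_nonzero[OF lead_mon]
  by (simp add: segre_def xvar_eq_mon segre_expo_single del: One_nat_def)

lemma segre_two_minor: "i \<in> C \<Longrightarrow> j \<in> C \<Longrightarrow> segre C (two_minor a b i j) = 0"
  by (simp add: two_minor_def segre_diff segre_mult segre_xvar)

text \<open>No cancellation occurs between monomials with different images.\<close>
lemma segre_nonzero:
  assumes "p \<noteq> 0" "inj_on (segre_expo C) (Poly_Mapping.keys p)"
  shows "segre C p \<noteq> 0"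
proof -
  obtain t where t: "t \<in> Poly_Mapping.keys p" using assms(1) by fastforce
  have "segre C p = (\<Sum>s\<in>Poly_Mapping.keys p. Poly_Mapping.single (segre_expo C s) (Poly_Mapping.lookup p s))"
    by (simp add: segre_def monomial_hom_def mult_single)
  then have "Poly_Mapping.lookup (segre C p) (segre_expo C t) =
      (\<Sum>s\<in>Poly_Mapping.keys p. if segre_expo C s = segre_expo C t then Poly_Mapping.lookup p s else 0)"
    by (simp add: lookup_sum lookup_single when_def)
  also have "\<dots> = (\<Sum>s\<in>Poly_Mapping.keys p. if s = t then Poly_Mapping.lookup p s else 0)"
    using inj_onD[OF assms(2) _ _ t] by (intro sum.cong if_cong) auto
  also have "\<dots> \<noteq> 0" using t by (simp add: in_keys_iff)
  finally show ?thesis by auto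
qed

lemma segre_expo_key_outside:
  assumes "(i, j) \<in> Poly_Mapping.keys t" "segre_expo C t = segre_expo C u" "j \<notin> C"
    and "Poly_Mapping.keys u \<subseteq> {1..m} \<times> {1..n}" "i \<noteq> 0" "j \<noteq> 0"
  shows "(i, j) \<in> Poly_Mapping.keys u"
proof -
  have "(i, j) \<in> Poly_Mapping.keys (segre_expo C t)"
    unfolding keys_segre_expo using assms(1,3) by (force simp: keys_segre_var)
  then obtain k l where "(k, l) \<in> Poly_Mapping.keys u" "(i, j) \<in> Poly_Mapping.keys (segre_var C (k, l))"
    unfolding assms(2) keys_segre_expo by auto
  then show ?thesis using assms(3-) by (auto simp: keys_segre_var split: if_splits)
qed

text \<open>The image of \<open>t\<close> records the degree of \<open>t\<close> in each column of \<open>C\<close> and, over all these columns, the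
  degree in each row, so another monomial with the same image has a variable in the same row and one in the same column.\<close>
lemma segre_expo_key_inside:
  assumes "(i, j) \<in> Poly_Mapping.keys t" "segre_expo C t = segre_expo C u" "j \<in> C"
    and u: "Poly_Mapping.keys u \<subseteq> {1..m} \<times> {1..n}" and "i \<noteq> 0" "j \<noteq> 0"
  shows "\<exists>j' \<in> C. (i, j') \<in> Poly_Mapping.keys u" "\<exists>i'. (i', j) \<in> Poly_Mapping.keys u"
proof -
  have mem: "(i, 0) \<in> Poly_Mapping.keys (segre_expo C t)" "(0, j) \<in> Poly_Mapping.keys (segre_expo C t)"
    unfolding keys_segre_expo using assms(1,3) by (force simp: keys_segre_var)+
  obtain k l where kl: "(k, l) \<in> Poly_Mapping.keys u" "(i, 0) \<in> Poly_Mapping.keys (segre_var C (k, l))"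
    using mem(1) unfolding assms(2) keys_segre_expo by auto
  have "k \<noteq> 0" "l \<noteq> 0" using kl(1) u by auto
  then show "\<exists>j' \<in> C. (i, j') \<in> Poly_Mapping.keys u"
    using kl \<open>i \<noteq> 0\<close> by (auto simp: keys_segre_var split: if_splits)
  obtain k' l' where kl': "(k', l') \<in> Poly_Mapping.keys u" "(0, j) \<in> Poly_Mapping.keys (segre_var C (k', l'))"
    using mem(2) unfolding assms(2) keys_segre_expo by auto
  have "k' \<noteq> 0" "l' \<noteq> 0" using kl'(1) u by auto
  then show "\<exists>i'. (i', j) \<in> Poly_Mapping.keys u"
    using kl' \<open>j \<noteq> 0\<close> by (auto simp: keys_segre_var split: if_splits)
qed

lemma segre_expo_cancel:
  assumes "v \<in> Poly_Mapping.keys t" "v \<in> Poly_Mapping.keys u" "segre_expo C t = segre_expo C u"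
  shows "segre_expo C (t - Poly_Mapping.single v 1) = segre_expo C (u - Poly_Mapping.single v 1)"
  using assms(3) expo_split[OF assms(1)] expo_split[OF assms(2)]
  by (metis add_left_cancel segre_expo_add)

lemma expo_weight_decrease:
  assumes "v \<in> Poly_Mapping.keys t" "Poly_Mapping.keys t \<subseteq> {1..m} \<times> {1..n}"
  shows "nat (expo_weight (t - Poly_Mapping.single v 1)) < nat (expo_weight t)"
proof -
  obtain i j where v: "v = (i, j)" by fastforce
  have "i \<ge> 1" "j \<ge> 1" using assms v by auto
  then have "expo_weight (Poly_Mapping.single v 1) > 0" unfolding v expo_weight_single by simp
  moreover have "expo_weight t = expo_weight (Poly_Mapping.single v 1) + expo_weight (t - Poly_Mapping.single v 1)"
    by (metis expo_split[OF assms(1)] expo_weight_add)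
  moreover have "expo_weight (t - Poly_Mapping.single v 1) \<ge> 0"
    unfolding expo_weight_def by (intro sum_nonneg) simp
  ultimately show ?thesis by linarith
qed

lemma segre_expo_eq_zero:
  assumes "segre_expo C u = 0" shows "u = 0"
proof -
  have "Poly_Mapping.keys (segre_var C v) \<noteq> {}" for v by (cases v) (simp only: keys_segre_var, auto)
  moreover have "(\<Union>v\<in>Poly_Mapping.keys u. Poly_Mapping.keys (segre_var C v)) = {}"
    using keys_segre_expo[of C u] assms by (simp only: keys_zero)
  ultimately have "Poly_Mapping.keys u = {}" by blast
  then show ?thesis by (simp only: keys_eq_empty)
qed

lemma expo_nonzero_key:
  fixes t :: expo assumes "t \<noteq> 0" shows "\<exists>i j. (i, j) \<in> Poly_Mapping.keys t"
proof -
  have "Poly_Mapping.keys t \<noteq> {}" using assms by (simp only: keys_eq_empty not_False_eq_True)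
  then show ?thesis by (metis ex_in_conv surj_pair)
qed

text \<open>With a single column \<open>s\<close> of \<open>C\<close> present, the row degrees determine the exponents in that column.\<close>
lemma segre_expo_inj:
  assumes "Poly_Mapping.keys t \<subseteq> S" "Poly_Mapping.keys u \<subseteq> S" "S \<subseteq> {1..m} \<times> {1..n}"
    and "\<And>i j. (i, j) \<in> S \<Longrightarrow> j \<in> C \<Longrightarrow> j = s"
    and "segre_expo C t = segre_expo C u"
  shows "t = u"
  using assms(1,2,5)
proof (induction "nat (expo_weight t)" arbitrary: t u rule: less_induct)
  case less
  show ?case
  proof (cases "t = 0")
    case True
    then show ?thesis using less.prems(3) segre_expo_eq_zero[of C u] by (simp add: segre_expo_def)
  next
    case False
    then obtain i j where ij: "(i, j) \<in> Poly_Mapping.keys t" using expo_nonzero_key by blast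
    have box: "Poly_Mapping.keys t \<subseteq> {1..m} \<times> {1..n}" "Poly_Mapping.keys u \<subseteq> {1..m} \<times> {1..n}"
      using less.prems assms(3) by auto
    then have nz: "i \<noteq> 0" "j \<noteq> 0" using ij by auto
    have u: "(i, j) \<in> Poly_Mapping.keys u"
    proof (cases "j \<in> C")
      case True
      then obtain j' where "j' \<in> C" "(i, j') \<in> Poly_Mapping.keys u"
        using segre_expo_key_inside(1)[OF ij less.prems(3) _ box(2) nz] by auto
      moreover have "j' = j" using calculation True ij less.prems assms(4) by blast
      ultimately show ?thesis by simp
    qed (use segre_expo_key_outside[OF ij less.prems(3) _ box(2) nz] in auto)
    have "t - Poly_Mapping.single (i, j) 1 = u - Poly_Mapping.single (i, j) 1"
      by (rule less.hyps[OF expo_weight_decrease[OF ij box(1)]])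
        (use segre_expo_cancel[OF ij u less.prems(3)] less.prems keys_diff_nat in blast)+
    then show ?thesis using expo_split[OF ij] expo_split[OF u] by metis
  qed
qed

lemma two_minor_mono_mult:
  "mon (Poly_Mapping.single (a, i) 1 + (Poly_Mapping.single (b, j) 1 + t)) -
     mon (Poly_Mapping.single (a, j) 1 + (Poly_Mapping.single (b, i) 1 + t)) = mon t * two_minor a b i j"
  by (simp add: two_minor_def xvar_eq_mon right_diff_distrib mult_single add_ac del: One_nat_def)

text \<open>Two monomials with the same image are congruent modulo the 2-minors. If \<open>x\<^bsub>ij\<^esub>\<close> divides the first,
  then the second is divisible by some \<open>x\<^bsub>ij'\<^esub> x\<^bsub>i'j\<^esub>\<close>, which a 2-minor replaces by \<open>x\<^bsub>ij\<^esub> x\<^bsub>i'j'\<^esub>\<close>; then \<open>x\<^bsub>ij\<^esub>\<close> can be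
  cancelled from both.\<close>
lemma segre_exchange:
  fixes m n :: nat
  assumes C: "C \<subseteq> {1..n}"
    and "Poly_Mapping.keys t \<subseteq> {1..m} \<times> {1..n}" "Poly_Mapping.keys u \<subseteq> {1..m} \<times> {1..n}"
    and "segre_expo C t = segre_expo C u"
  shows "mon t - mon u \<in> Idl\<^bsub>mpoly_ring m n\<^esub> (minor_gens m (C \<times> C) :: 'k::field mpoly set)"
  using assms(2-)
proof (induction "nat (expo_weight t)" arbitrary: t u rule: less_induct)
  case less
  let ?I = "Idl\<^bsub>mpoly_ring m n\<^esub> (minor_gens m (C \<times> C) :: 'k::field mpoly set)"
  have G: "minor_gens m (C \<times> C) \<subseteq> carrier (mpoly_ring m n :: 'k mpoly ring)"
    using C by (intro minor_gens_carrier) auto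
  note I = Idl_ideal(1)[OF G]
  show ?case
  proof (cases "t = 0")
    case True
    then show ?thesis
      using less.prems(3) segre_expo_eq_zero[of C u] mpoly_ideal_zero[OF I] by (simp add: segre_expo_def)
  next
    case False
    then obtain i j where ij: "(i, j) \<in> Poly_Mapping.keys t" using expo_nonzero_key by blast
    then have nz: "i \<noteq> 0" "j \<noteq> 0" and box: "i \<in> {1..m}" "j \<in> {1..n}" using less.prems(1) by auto
    obtain w where w: "(i, j) \<in> Poly_Mapping.keys w" "Poly_Mapping.keys w \<subseteq> {1..m} \<times> {1..n}"
      "segre_expo C w = segre_expo C u" "mon w - mon u \<in> ?I"
    proof (cases "(i, j) \<in> Poly_Mapping.keys u")
      case True
      then show thesis using that[of u] less.prems mpoly_ideal_zero[OF I] by simp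
    next
      case False
      then have jC: "j \<in> C"
        using segre_expo_key_outside[OF ij less.prems(3) _ less.prems(2) nz] by blast
      obtain j' where j': "j' \<in> C" "(i, j') \<in> Poly_Mapping.keys u"
        using segre_expo_key_inside(1)[OF ij less.prems(3) jC less.prems(2) nz] by blast
      obtain i' where i': "(i', j) \<in> Poly_Mapping.keys u"
        using segre_expo_key_inside(2)[OF ij less.prems(3) jC less.prems(2) nz] by blast
      have ne: "i' \<noteq> i" using False i' by auto
      let ?e = "\<lambda>a b. Poly_Mapping.single (a, b) (1::nat)"
      define r where "r = u - ?e i j' - ?e i' j"
      have "(i', j) \<in> Poly_Mapping.keys (u - ?e i j')"
        using i' ne by (simp add: in_keys_iff lookup_minus lookup_single)
      then have u: "u = ?e i j' + (?e i' j + r)"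
        using expo_split[OF j'(2)] expo_split[of "(i', j)" "u - ?e i j'"] by (simp add: r_def del: One_nat_def)
      define w where "w = ?e i j + (?e i' j' + r)"
      have r: "Poly_Mapping.keys r \<subseteq> {1..m} \<times> {1..n}"
        using keys_diff_nat less.prems(2) unfolding r_def by blast
      have boxes: "i' \<in> {1..m}" "j' \<in> {1..n}" using i' j' less.prems(2) by auto
      show thesis
      proof (rule that)
        show "(i, j) \<in> Poly_Mapping.keys w" by (simp add: w_def keys_add_nat)
        show "Poly_Mapping.keys w \<subseteq> {1..m} \<times> {1..n}"
          using r box boxes by (auto simp: w_def keys_add_nat)
        show "segre_expo C w = segre_expo C u"
          using jC j'(1) by (simp add: w_def u segre_expo_add segre_expo_single segre_var_def add_ac del: One_nat_def)
        have "two_minor i i' j j' \<in> minor_gens m (C \<times> C)"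
          using box boxes jC j'(1) unfolding minor_gens_def by blast
        then have "mon r * two_minor i i' j j' \<in> ?I"
          using Idl_ideal(2)[OF G] r
          by (intro mpoly_ideal_mult[OF I]) (auto simp: carrier_eq_poly_over intro!: poly_over_single)
        then show "mon w - mon u \<in> ?I" by (simp only: w_def u two_minor_mono_mult)
      qed
    qed
    have eq: "segre_expo C t = segre_expo C w" using w(3) less.prems(3) by simp
    let ?e = "Poly_Mapping.single (i, j) (1::nat)"
    have "mon (t - ?e) - mon (w - ?e) \<in> ?I"
      by (rule less.hyps[OF expo_weight_decrease[OF ij less.prems(1)]])
        (use segre_expo_cancel[OF ij w(1) eq] less.prems(1) w(2) keys_diff_nat in blast)+
    then have "mon ?e * (mon (t - ?e) - mon (w - ?e)) \<in> ?I"
      using box by (intro mpoly_ideal_mult[OF I]) (auto simp: carrier_eq_poly_over intro!: poly_over_single)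
    then have "mon t - mon w \<in> ?I"
      unfolding right_diff_distrib mult_single mult_1 expo_split[OF ij] expo_split[OF w(1)] .
    then show ?thesis using mpoly_ideal_add[OF I _ w(4)] by fastforce
  qed
qed

text \<open>A nonzero element of the kernel has two terms with the same image, and subtracting a multiple of
  their difference removes one of them. Hence the kernel is spanned by the differences treated in
  \<open>segre_exchange\<close>.\<close>
lemma segre_kernel:
  fixes m n :: nat
  assumes C: "C \<subseteq> {1..n}"
  shows "Idl\<^bsub>mpoly_ring m n\<^esub> (minor_gens m (C \<times> C)) =
    {g \<in> carrier (mpoly_ring m n). segre C g = (0 :: 'k::field mpoly)}"
proof (intro equalityI subsetI)
  let ?I = "Idl\<^bsub>mpoly_ring m n\<^esub> (minor_gens m (C \<times> C) :: 'k mpoly set)"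
  let ?K = "{g \<in> carrier (mpoly_ring m n). segre C g = (0 :: 'k mpoly)}"
  have G: "minor_gens m (C \<times> C) \<subseteq> carrier (mpoly_ring m n :: 'k mpoly ring)"
    using C by (intro minor_gens_carrier) auto
  note I = Idl_ideal(1)[OF G]
  have K: "?I \<subseteq> ?K"
  proof (rule Idl_minimal[OF kernel_ideal[OF segre_add segre_mult]], safe)
    fix g :: "'k mpoly" assume "g \<in> minor_gens m (C \<times> C)"
    then show "g \<in> carrier (mpoly_ring m n)" "segre C g = 0"
      using G by (blast, auto simp: minor_gens_def segre_two_minor)
  qed
  show "g \<in> ?K" if "g \<in> ?I" for g using that K by blast
  fix g assume "g \<in> ?K"
  then show "g \<in> ?I"
  proof (induction "card (Poly_Mapping.keys g)" arbitrary: g rule: less_induct)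
    case less
    show ?case
    proof (cases "g = 0")
      case False
      then obtain t where t: "t \<in> Poly_Mapping.keys g" by fastforce
      have "\<not> inj_on (segre_expo C) (Poly_Mapping.keys g)"
        using segre_nonzero[OF False] less.prems by auto
      then obtain t u where tu: "t \<in> Poly_Mapping.keys g" "u \<in> Poly_Mapping.keys g" "t \<noteq> u"
        "segre_expo C t = segre_expo C u"
        by (auto simp: inj_on_def)
      define c where "c = Poly_Mapping.single 0 (Poly_Mapping.lookup g t) * (mon t - mon u)"
      have box: "Poly_Mapping.keys t \<subseteq> {1..m} \<times> {1..n}" "Poly_Mapping.keys u \<subseteq> {1..m} \<times> {1..n}"
        using less.prems tu by (auto simp: mpoly_ring_carrier)
      have c: "c \<in> ?I" unfolding c_def
        by (intro mpoly_ideal_mult[OF I] segre_exchange[OF C box tu(4)])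
          (simp add: carrier_eq_poly_over poly_over_single)
      have look: "Poly_Mapping.lookup (g - c) s = Poly_Mapping.lookup g s -
          (if s = t then Poly_Mapping.lookup g t else 0) + (if s = u then Poly_Mapping.lookup g t else 0)" for s
        by (simp add: c_def right_diff_distrib mult_single lookup_minus lookup_single when_def)
      have "Poly_Mapping.keys (g - c) \<subseteq> Poly_Mapping.keys g - {t}"
        using tu by (auto simp: in_keys_iff look split: if_splits)
      then have "card (Poly_Mapping.keys (g - c)) < card (Poly_Mapping.keys g)"
        using tu(1) by (intro psubset_card_mono) auto
      moreover have "g - c \<in> ?K"
        using mpoly_ideal_diff[OF kernel_ideal[OF segre_add segre_mult] less.prems] c K by blast
      ultimately have "g - c \<in> ?I" by (rule less.hyps)
      then show ?thesis using mpoly_ideal_add[OF I _ c] by fastforce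
    qed (simp add: mpoly_ideal_zero[OF I])
  qed
qed

section \<open>Ideals of 2-minors of intervals of columns\<close>

lemma two_minor_common_column:
  "xvar r v * two_minor p q i j =
     xvar q j * two_minor r p v i - xvar p j * two_minor r q v i + xvar r i * two_minor p q v j"
  by (simp add: two_minor_def algebra_simps)

text \<open>Modulo the 2-minors that involve column \<open>v\<close> and one of the columns \<open>i, j\<close>, the entries of column \<open>v\<close>
  annihilate the 2-minors of \<open>i\<close> and \<open>j\<close>: over the locus where column \<open>v\<close> is nonzero, both columns are
  multiples of it.\<close>
lemma xvar_mult_two_minor_mem:
  fixes I :: "'k::field mpoly set"
  assumes I: "ideal I (mpoly_ring m n)" and "r \<in> {1..m}" "p \<in> {1..m}" "q \<in> {1..m}" "i \<in> {1..n}" "j \<in> {1..n}"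
    and "\<And>a b. a \<in> {1..m} \<Longrightarrow> b \<in> {1..m} \<Longrightarrow> two_minor a b v i \<in> I"
    and "\<And>a b. a \<in> {1..m} \<Longrightarrow> b \<in> {1..m} \<Longrightarrow> two_minor a b v j \<in> I"
  shows "xvar r v * two_minor p q i j \<in> I"
  using assms
  by (subst two_minor_common_column) (intro mpoly_ideal_add[OF I] mpoly_ideal_diff[OF I] mpoly_ideal_mult[OF I] xvar_carrier; simp)

lemma minor_gens_mono: "A \<subseteq> B \<Longrightarrow> minor_gens m A \<subseteq> minor_gens m B"
  unfolding minor_gens_def by blast

lemma two_minor_mem_gens:
  "a \<in> {1..m} \<Longrightarrow> b \<in> {1..m} \<Longrightarrow> (i, j) \<in> A \<Longrightarrow> two_minor a b i j \<in> minor_gens m A"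
  unfolding minor_gens_def by blast

text \<open>Subtracting \<open>x\<^bsub>1,s+1\<^esub>\<close> times the vanishing expansion with column \<open>s\<close> in the place of column \<open>s + 1\<close> turns
  the linear form in column \<open>s + 1\<close> into one in the 2-minors on row 1, with the same cofactors as
  coefficients.\<close>
lemma diagonal_minor_two_columns:
  assumes s: "s \<in> {1..n}" "Suc s \<in> {1..n}" and b: "b \<in> {2..m}"
  shows "xvar 1 s * diagonal_minor m n (int (Suc s) - int b) =
    (\<Sum>i\<in>{1..m}. diagonal_cofactor m n (int (Suc s) - int b) (Suc s) i * (two_minor 1 i s (Suc s) :: 'k::field mpoly))"
proof -
  let ?c = "int (Suc s) - int b"
  let ?A = "\<lambda>i. diagonal_cofactor m n ?c (Suc s) i :: 'k mpoly"
  have b': "b \<in> {1..m}" "b - 1 \<in> {1..m}" "?c = int s - int (b - 1)" using b by auto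
  have "xvar 1 s * diagonal_minor m n ?c =
      xvar 1 s * (\<Sum>i\<in>{1..m}. xvar i (Suc s) * ?A i) - xvar 1 (Suc s) * (\<Sum>i\<in>{1..m}. xvar i s * ?A i)"
    using diagonal_minor_expand_column[OF b'(1) s(2) refl, where 'k = 'k]
      diagonal_cofactor_foreign_column[OF b'(1) s(2) refl b'(2) s(1) b'(3), where 'k = 'k] by simp
  also have "\<dots> = (\<Sum>i\<in>{1..m}. ?A i * two_minor 1 i s (Suc s))"
    unfolding sum_distrib_left sum_subtractf[symmetric] two_minor_def
    by (intro sum.cong refl) (simp add: algebra_simps)
  finally show ?thesis .
qed

lemma segre_sum: "segre C (sum q A) = (\<Sum>i\<in>A. segre C (q i))"
proof (induction A rule: infinite_finite_induct)
  case (insert x A)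
  then show ?case by (simp add: segre_add)
qed (simp_all add: segre_def)

text \<open>Cramer's rule for the \<open>m - 1\<close> minors of diagonals that meet both columns, with the 2-minors on rows
  \<open>1, i\<close> as unknowns; the factor \<open>x\<^bsub>1s\<^esub>\<close> in \<open>h\<close> then reaches all other 2-minors. The determinant does not
  involve column \<open>s + 1\<close>, and the Segre substitution is injective on polynomials without that column, so
  \<open>h\<close> is not in the kernel.\<close>
lemma knutson_adjacent_columns:
  fixes m n :: nat
  assumes m: "m \<ge> 2" and s: "s \<in> {1..n}" "Suc s \<in> {1..n}"
  shows "Idl\<^bsub>mpoly_ring m n\<^esub> (minor_gens m ({s, Suc s} \<times> {s, Suc s})) \<in>
    knutson_ideals (mpoly_ring m n) (diagonal_product m n :: 'k::field mpoly)"
proof -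
  let ?R = "mpoly_ring m n :: 'k mpoly ring"
  let ?C = "{s, Suc s}"
  let ?D = "(\<lambda>b. diagonal_minor m n (int (Suc s) - int b)) ` {2..m} :: 'k mpoly set"
  let ?I = "Idl\<^bsub>?R\<^esub> ?D"
  let ?P = "Idl\<^bsub>?R\<^esub> (minor_gens m (?C \<times> ?C))"
  let ?M = "cofactor_matrix m n (Suc s) 1 :: 'k mpoly mat"
  let ?h = "xvar 1 s * det ?M"
  have D: "?D \<subseteq> carrier ?R" using diagonal_minor_carrier by auto
  have C: "?C \<subseteq> {1..n}" using s by auto
  have G: "minor_gens m (?C \<times> ?C) \<subseteq> carrier ?R" using C by (intro minor_gens_carrier) auto
  note I = Idl_ideal(1)[OF D] and P = Idl_ideal(1)[OF G]
  have x: "xvar i s \<in> carrier ?R" if "i \<in> {1..m}" for i using xvar_carrier[OF that s(1)] .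
  have "1 \<in> {1..m}" using m by simp
  have h: "?h \<in> carrier ?R"
    using x[OF \<open>1 \<in> {1..m}\<close>] det_cofactor_matrix_carrier unfolding carrier_eq_poly_over by (rule poly_over_mult)
  have cramer: "det ?M * two_minor 1 i s (Suc s) \<in> ?I" if i: "i \<in> {1..m}" for i
  proof (cases "i = 1")
    case True
    show ?thesis unfolding True two_minor_zero mult_zero_right by (rule mpoly_ideal_zero[OF I])
  next
    case False
    then have i2: "i - 2 + 2 = i" "i - 2 < m - 1" using i by auto
    have "det ?M * two_minor 1 (i - 2 + 2) s (Suc s) \<in> ?I"
    proof (rule cramer_in_ideal[OF I cofactor_matrix_carrier, where y = "\<lambda>b. two_minor 1 (b + 2) s (Suc s)" and b = "i - 2"])
      show "i - 2 < m - 1" by (rule i2)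
      show "?M $$ (a, b) \<in> carrier ?R" if "a < m - 1" "b < m - 1" for a b
        using that diagonal_cofactor_carrier by (simp add: cofactor_matrix_def)
      fix a assume a: "a < m - 1"
      let ?A = "diagonal_cofactor m n (int (Suc s) - int (a + 2)) (Suc s) :: nat \<Rightarrow> 'k mpoly"
      have b: "a + 2 \<in> {2..m}" using a by auto
      have "(\<Sum>b<m - 1. ?M $$ (a, b) * two_minor 1 (b + 2) s (Suc s)) =
          (\<Sum>b<m - 1. ?A (b + 2) * two_minor 1 (b + 2) s (Suc s))"
        using a by (intro sum.cong) (auto simp: cofactor_matrix_def)
      also have "\<dots> = (\<Sum>b\<in>{2..m}. ?A b * two_minor 1 b s (Suc s))"
        by (rule sum.reindex_bij_witness[of _ "\<lambda>b. b - 2" "\<lambda>b. b + 2"]) auto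
      also have "\<dots> = (\<Sum>b\<in>{1..m}. ?A b * two_minor 1 b s (Suc s))"
        by (rule sum.mono_neutral_left) (auto simp: Suc_le_eq le_eq_less_or_eq[of _ m] not_le less_2_cases_iff)
      also have "\<dots> = xvar 1 s * diagonal_minor m n (int (Suc s) - int (a + 2))"
        by (rule diagonal_minor_two_columns[OF s b, symmetric])
      also have "\<dots> \<in> ?I"
        using subsetD[OF Idl_ideal(2)[OF D] imageI[OF b]] x[OF \<open>1 \<in> {1..m}\<close>] by (intro mpoly_ideal_mult[OF I])
      finally show "(\<Sum>b<m - 1. ?M $$ (a, b) * two_minor 1 (b + 2) s (Suc s)) \<in> ?I" .
    qed
    then show ?thesis unfolding i2 .
  qed
  have gen: "?h * two_minor a b s (Suc s) \<in> ?I" if "a \<in> {1..m}" "b \<in> {1..m}" for a b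
  proof -
    have "?h * two_minor a b s (Suc s) = xvar a s * (det ?M * two_minor 1 b s (Suc s)) -
        xvar b s * (det ?M * two_minor 1 a s (Suc s))"
      by (simp add: two_minor_def algebra_simps)
    then show ?thesis
      using that by (simp only:) (intro mpoly_ideal_diff[OF I] mpoly_ideal_mult[OF I x] cramer)
  qed
  show ?thesis
  proof (rule knutson_kernel[OF diagonal_product_carrier _ h segre_mult segre_kernel[OF C]])
    show "?I \<in> knutson_ideals ?R (diagonal_product m n)"
      by (rule knutson_diagonal_minors[OF s(2)]) (use m in auto)
    have "inj_on (segre_expo ?C) (Poly_Mapping.keys (det ?M))"
    proof (rule inj_onI)
      fix t u assume "t \<in> Poly_Mapping.keys (det ?M)" "u \<in> Poly_Mapping.keys (det ?M)"
        "segre_expo ?C t = segre_expo ?C u"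
      then show "t = u"
        using det_cofactor_matrix_poly_over[of m n "Suc s" 1, where 'a = 'k]
        by (intro segre_expo_inj[of t "{1..m} \<times> ({1..n} - {Suc s})" u m n ?C s])
          (auto simp: poly_over_def simp del: One_nat_def)
    qed
    then have "segre ?C (det ?M) \<noteq> 0"
      by (rule segre_nonzero[OF det_cofactor_matrix_nonzero[OF s(2)]])
    then show "segre ?C ?h \<noteq> 0" by (simp add: segre_mult segre_xvar_nonzero)
    show "?I \<subseteq> ?P"
    proof (rule Idl_minimal[OF P], safe)
      fix b assume b: "b \<in> {2..m}"
      have "segre ?C (xvar 1 s) * segre ?C (diagonal_minor m n (int (Suc s) - int b)) =
          segre ?C (\<Sum>i\<in>{1..m}. diagonal_cofactor m n (int (Suc s) - int b) (Suc s) i * (two_minor 1 i s (Suc s) :: 'k mpoly))"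
        using diagonal_minor_two_columns[OF s b, where 'k = 'k] by (simp only: segre_mult[symmetric])
      also have "\<dots> = 0" by (simp add: segre_sum segre_mult segre_two_minor)
      finally have "segre ?C (diagonal_minor m n (int (Suc s) - int b) :: 'k mpoly) = 0"
        using segre_xvar_nonzero by (metis mult_eq_0_iff)
      then show "diagonal_minor m n (int (Suc s) - int b) \<in> ?P"
        unfolding segre_kernel[OF C] using diagonal_minor_carrier by simp
    qed
    fix p assume "p \<in> ?P"
    then show "?h * p \<in> ?I"
    proof (rule mult_Idl_subset[OF I G h, rotated])
      fix g :: "'k mpoly" assume "g \<in> minor_gens m (?C \<times> ?C)"
      then obtain a b i j where g: "g = two_minor a b i j" "a \<in> {1..m}" "b \<in> {1..m}" "i \<in> ?C" "j \<in> ?C"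
        by (auto simp: minor_gens_def)
      show "?h * g \<in> ?I"
        using g(4,5) gen[OF g(2,3)] mpoly_ideal_uminus[OF I gen[OF g(2,3)]] mpoly_ideal_zero[OF I]
        unfolding g(1) by (auto simp: two_minor_swap(2)[of a b "Suc s"])
    qed
  qed
qed

text \<open>The interval is extended by one column at a time: adjoining column \<open>k + 1\<close>, the sum of the ideals for
  \<open>{i..k}\<close> and \<open>{k, k + 1}\<close> contains all 2-minors involving the common column \<open>k\<close>, so \<open>x\<^bsub>1k\<^esub>\<close> multiplies the
  ideal of \<open>{i..k + 1}\<close> into it.\<close>
lemma knutson_column_interval:
  fixes m n :: nat
  assumes m: "m \<ge> 2" and "1 \<le> i" "i < k" "k \<le> n"
  shows "Idl\<^bsub>mpoly_ring m n\<^esub> (minor_gens m ({i..k} \<times> {i..k})) \<in>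
    knutson_ideals (mpoly_ring m n) (diagonal_product m n :: 'k::field mpoly)"
  using Suc_leI[OF \<open>i < k\<close>] \<open>k \<le> n\<close>
proof (induction k rule: dec_induct)
  case base
  have "{i..Suc i} = {i, Suc i}" by auto
  then show ?case using knutson_adjacent_columns[OF m, of i n, where 'k = 'k] assms(2) base by simp
next
  case (step k)
  let ?R = "mpoly_ring m n :: 'k mpoly ring"
  let ?g = "\<lambda>C. minor_gens m (C \<times> C) :: 'k mpoly set"
  let ?F = "{{i..k}, {k, Suc k}}"
  let ?I = "Idl\<^bsub>?R\<^esub> (\<Union>C\<in>?F. ?g C)"
  let ?C = "{i..Suc k}"
  let ?P = "Idl\<^bsub>?R\<^esub> (?g ?C)"
  have k: "k \<in> {1..n}" "Suc k \<in> {1..n}" "1 \<in> {1..m}" using step assms by auto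
  have C: "?C \<subseteq> {1..n}" using step.prems assms by auto
  have G: "?g ?C \<subseteq> carrier ?R" using C by (intro minor_gens_carrier) auto
  have sub: "(\<Union>C\<in>?F. ?g C) \<subseteq> ?g ?C" using step.hyps by (auto intro!: UN_least minor_gens_mono)
  then have D: "(\<Union>C\<in>?F. ?g C) \<subseteq> carrier ?R" using G by blast
  note I = Idl_ideal(1)[OF D] and P = Idl_ideal(1)[OF G]
  show ?case
  proof (rule knutson_kernel[OF diagonal_product_carrier _ xvar_carrier[OF k(3,1)] segre_mult segre_kernel[OF C] _ segre_xvar_nonzero])
    show "?I \<in> knutson_ideals ?R (diagonal_product m n)"
      using D step knutson_adjacent_columns[OF m k(1,2)] by (intro knutson_Idl_UN diagonal_product_carrier) auto
    show "?I \<subseteq> ?P" by (rule Idl_mono[OF sub G])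
    fix p assume "p \<in> ?P"
    then show "xvar 1 k * p \<in> ?I"
    proof (rule mult_Idl_subset[OF I G xvar_carrier[OF k(3,1)], rotated])
      fix g :: "'k mpoly" assume "g \<in> ?g ?C"
      then obtain a b j l where g: "g = two_minor a b j l" "a \<in> {1..m}" "b \<in> {1..m}" "j \<in> ?C" "l \<in> ?C"
        by (auto simp: minor_gens_def)
      have "two_minor a b k j \<in> ?I" if "a \<in> {1..m}" "b \<in> {1..m}" "j \<in> ?C" for a b j
      proof -
        have "two_minor a b k j \<in> (\<Union>C\<in>?F. ?g C)"
          using that step.hyps
          by (cases "j = Suc k") (auto intro!: two_minor_mem_gens simp del: One_nat_def)
        then show ?thesis using Idl_ideal(2)[OF D] by blast
      qed
      then show "xvar 1 k * g \<in> ?I"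
        using g k C unfolding g(1) by (intro xvar_mult_two_minor_mem[OF I]) auto
    qed
  qed
qed

section \<open>Binomial edge ideals with deleted vertices\<close>

text \<open>The vertices in \<open>S\<close> count as deleted: their columns are among the generators, which makes the edges
  at \<open>S\<close> irrelevant, so they may stay in the relation \<open>A\<close>. Loops in \<open>A\<close> only contribute zero minors.\<close>
definition graph_ideal :: "nat \<Rightarrow> nat \<Rightarrow> nat set \<Rightarrow> (nat \<times> nat) set \<Rightarrow> 'k::field mpoly set" where
  "graph_ideal m n S A = Idl\<^bsub>mpoly_ring m n\<^esub> (column_gens m S \<union> minor_gens m A)"

lemma graph_gens_carrier:
  "S \<subseteq> {1..n} \<Longrightarrow> A \<subseteq> {1..n} \<times> {1..n} \<Longrightarrow> (column_gens m S \<union> minor_gens m A :: 'k::field mpoly set) \<subseteq> carrier (mpoly_ring m n)"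
  by (intro Un_least column_gens_carrier minor_gens_carrier)

lemma graph_ideal_facts:
  assumes "S \<subseteq> {1..n}" "A \<subseteq> {1..n} \<times> {1..n}"
  shows "ideal (graph_ideal m n S A :: 'k::field mpoly set) (mpoly_ring m n)"
    and "\<And>i s. i \<in> {1..m} \<Longrightarrow> s \<in> S \<Longrightarrow> xvar i s \<in> (graph_ideal m n S A :: 'k mpoly set)"
    and "\<And>a b i j. a \<in> {1..m} \<Longrightarrow> b \<in> {1..m} \<Longrightarrow> (i, j) \<in> A \<Longrightarrow> two_minor a b i j \<in> (graph_ideal m n S A :: 'k mpoly set)"
    and "\<And>a b s i. a \<in> {1..m} \<Longrightarrow> b \<in> {1..m} \<Longrightarrow> s \<in> S \<Longrightarrow> i \<in> {1..n} \<Longrightarrow> two_minor a b s i \<in> (graph_ideal m n S A :: 'k mpoly set)"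
proof -
  note G = graph_gens_carrier[OF assms, where m = m and 'k = 'k]
  show I: "ideal (graph_ideal m n S A :: 'k mpoly set) (mpoly_ring m n)"
    unfolding graph_ideal_def by (rule Idl_ideal(1)[OF G])
  show x: "xvar i s \<in> (graph_ideal m n S A :: 'k mpoly set)" if "i \<in> {1..m}" "s \<in> S" for i s
    unfolding graph_ideal_def using that by (intro subsetD[OF Idl_ideal(2)[OF G]]) (auto simp: column_gens_def)
  show "two_minor a b i j \<in> (graph_ideal m n S A :: 'k mpoly set)" if "a \<in> {1..m}" "b \<in> {1..m}" "(i, j) \<in> A" for a b i j
    unfolding graph_ideal_def using that by (intro subsetD[OF Idl_ideal(2)[OF G]]) (auto intro: two_minor_mem_gens)
  show "two_minor a b s i \<in> (graph_ideal m n S A :: 'k mpoly set)" if "a \<in> {1..m}" "b \<in> {1..m}" "s \<in> S" "i \<in> {1..n}" for a b s i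
    unfolding two_minor_def mult.commute[of "xvar a s"] using that
    by (intro mpoly_ideal_diff[OF I] mpoly_ideal_mult[OF I] x xvar_carrier)
qed

lemma kill_column_two_minor:
  "kill_column v (two_minor a b i j) = (if i = v \<or> j = v then 0 else two_minor a b i j)"
  by (auto simp: two_minor_def kill_column_diff kill_column_mult kill_column_xvar)

text \<open>The edge ideal is the intersection of the ideal with the neighbourhood \<open>N\<close> of \<open>v\<close> completed and the
  ideal with \<open>v\<close> deleted. Entries of column \<open>v\<close> multiply the new 2-minors into the edge ideal. So an
  element \<open>g\<close> of the first ideal is unchanged modulo the edge ideal when column \<open>v\<close> is set to zero; if
  \<open>g\<close> also lies in the second ideal, then setting the column to zero puts it into the edge ideal.\<close>
lemma graph_ideal_split:
  fixes m n :: nat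
  assumes S: "S \<subseteq> {1..n}" and A: "A \<subseteq> {1..n} \<times> {1..n}" and "sym A" and v: "v \<in> {1..n}" "v \<notin> S"
  defines "N \<equiv> {i. (i, v) \<in> A}"
  shows "graph_ideal m n S A =
    graph_ideal m n S (A \<union> N \<times> N) \<inter> (graph_ideal m n (insert v S) A :: 'k::field mpoly set)"
proof (intro equalityI Int_greatest subsetI)
  let ?R = "mpoly_ring m n :: 'k mpoly ring"
  let ?J = "graph_ideal m n S A :: 'k mpoly set"
  let ?J1 = "graph_ideal m n S (A \<union> N \<times> N) :: 'k mpoly set"
  let ?J2 = "graph_ideal m n (insert v S) A :: 'k mpoly set"
  have N: "N \<subseteq> {1..n}" using A by (auto simp: N_def)
  have A1: "A \<union> N \<times> N \<subseteq> {1..n} \<times> {1..n}" using A N by auto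
  have S2: "insert v S \<subseteq> {1..n}" using S v by auto
  note J = graph_ideal_facts[OF S A, where m = m and 'k = 'k]
  note J1 = graph_ideal_facts[OF S A1, where m = m and 'k = 'k] and J2 = graph_ideal_facts[OF S2 A, where m = m and 'k = 'k]
  note G1 = graph_gens_carrier[OF S A1, where m = m and 'k = 'k] and G2 = graph_gens_carrier[OF S2 A, where m = m and 'k = 'k]
  show "g \<in> ?J1" if "g \<in> ?J" for g
  proof -
    have "column_gens m S \<union> minor_gens m A \<subseteq> column_gens m S \<union> minor_gens m (A \<union> N \<times> N)"
      using minor_gens_mono[of A "A \<union> N \<times> N" m] by blast
    from Idl_mono[OF this G1] show ?thesis using that unfolding graph_ideal_def by blast
  qed
  show "g \<in> ?J2" if "g \<in> ?J" for g
  proof -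
    have "column_gens m S \<union> minor_gens m A \<subseteq> column_gens m (insert v S) \<union> minor_gens m A"
      unfolding column_gens_def by blast
    from Idl_mono[OF this G2] show ?thesis using that unfolding graph_ideal_def by blast
  qed
  have adj: "(v, i) \<in> A" if "i \<in> N" for i using that \<open>sym A\<close> by (auto simp: N_def sym_def)
  have xJ1: "xvar r v * g \<in> ?J" if r: "r \<in> {1..m}" and g: "g \<in> ?J1" for r g
    using g unfolding graph_ideal_def[of _ _ _ "A \<union> N \<times> N"]
  proof (rule mult_Idl_subset[OF J(1) G1 xvar_carrier[OF r v(1)], rotated])
    fix g :: "'k mpoly" assume "g \<in> column_gens m S \<union> minor_gens m (A \<union> N \<times> N)"
    then consider "g \<in> ?J" | a b i j where "g = two_minor a b i j" "a \<in> {1..m}" "b \<in> {1..m}" "i \<in> N" "j \<in> N"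
    proof (elim UnE)
      assume "g \<in> column_gens m S"
      then show thesis using J(2) that(1) by (auto simp: column_gens_def simp del: One_nat_def)
    next
      assume "g \<in> minor_gens m (A \<union> N \<times> N)"
      then obtain a b i j where g: "g = two_minor a b i j" "a \<in> {1..m}" "b \<in> {1..m}" "(i, j) \<in> A \<union> N \<times> N"
        by (auto simp: minor_gens_def)
      show thesis
      proof (cases "(i, j) \<in> A")
        case True
        then show thesis using J(3)[OF g(2,3)] g(1) that(1) by simp
      next
        case False
        then show thesis using that(2)[OF g(1-3)] g(4) by blast
      qed
    qed
    then show "xvar r v * g \<in> ?J"
    proof cases
      case 1
      then show ?thesis by (intro mpoly_ideal_mult[OF J(1)] xvar_carrier r v)
    next
      case 2
      then show ?thesis
        using N r J(3) adj unfolding 2(1) by (intro xvar_mult_two_minor_mem[OF J(1)]) auto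
    qed
  qed
  have V: "column_gens m {v} \<subseteq> carrier ?R" using v by (intro column_gens_carrier) auto
  have kJ1: "(r - kill_column v r) * g \<in> ?J" if r: "r \<in> carrier ?R" and g: "g \<in> ?J1" for r g
  proof -
    have "g * (r - kill_column v r) \<in> ?J"
    proof (rule mult_Idl_subset[OF J(1) V mpoly_ideal_carrier[OF J1(1) g] _ minus_kill_column_mem[OF r v(1)]])
      show "g * s \<in> ?J" if "s \<in> column_gens m {v}" for s
        using that xJ1 g by (auto simp: column_gens_def mult.commute[of g])
    qed
    then show ?thesis by (simp add: mult.commute)
  qed
  have kcarr: "kill_column v r \<in> carrier ?R" if "r \<in> carrier ?R" for r
    using that unfolding carrier_eq_poly_over by (rule kill_column_poly_over)
  have T1: "ideal {g \<in> ?J1. g - kill_column v g \<in> ?J} ?R"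
  proof (rule mpoly_idealI)
    show "{g \<in> ?J1. g - kill_column v g \<in> ?J} \<subseteq> carrier ?R" using mpoly_ideal_carrier[OF J1(1)] by auto
    show "0 \<in> {g \<in> ?J1. g - kill_column v g \<in> ?J}" using J J1 by (simp add: mpoly_ideal_zero)
    fix p q :: "'k mpoly" assume pq: "p \<in> {g \<in> ?J1. g - kill_column v g \<in> ?J}" "q \<in> {g \<in> ?J1. g - kill_column v g \<in> ?J}"
    have "p + q - kill_column v (p + q) = (p - kill_column v p) + (q - kill_column v q)"
      by (simp add: kill_column_add)
    then show "p + q \<in> {g \<in> ?J1. g - kill_column v g \<in> ?J}"
      using pq mpoly_ideal_add[OF J(1)] mpoly_ideal_add[OF J1(1)] by (metis (no_types, lifting) mem_Collect_eq)
  next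
    fix r p :: "'k mpoly" assume r: "r \<in> carrier ?R" and p: "p \<in> {g \<in> ?J1. g - kill_column v g \<in> ?J}"
    have "r * p - kill_column v (r * p) = (r - kill_column v r) * p + kill_column v r * (p - kill_column v p)"
      by (simp add: kill_column_mult algebra_simps)
    also have "\<dots> \<in> ?J"
      using p r by (intro mpoly_ideal_add[OF J(1)] kJ1 mpoly_ideal_mult[OF J(1)] kcarr) auto
    finally show "r * p \<in> {g \<in> ?J1. g - kill_column v g \<in> ?J}"
      using p mpoly_ideal_mult[OF J1(1) r] by auto
  qed
  have "?J1 \<subseteq> {g \<in> ?J1. g - kill_column v g \<in> ?J}"
    unfolding graph_ideal_def[of _ _ _ "A \<union> N \<times> N"]
  proof (rule Idl_minimal[OF T1[unfolded graph_ideal_def[of _ _ _ "A \<union> N \<times> N"]]], rule subsetI, rule CollectI, rule conjI)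
    fix g :: "'k mpoly" assume g: "g \<in> column_gens m S \<union> minor_gens m (A \<union> N \<times> N)"
    then show "g \<in> Idl\<^bsub>?R\<^esub> (column_gens m S \<union> minor_gens m (A \<union> N \<times> N))"
      using Idl_ideal(2)[OF G1] by blast
    show "g - kill_column v g \<in> ?J"
      using g
    proof
      assume "g \<in> column_gens m S"
      then show ?thesis
        using v(2) mpoly_ideal_zero[OF J(1)] by (auto simp: column_gens_def kill_column_xvar)
    next
      assume "g \<in> minor_gens m (A \<union> N \<times> N)"
      then obtain a b i j where g: "g = two_minor a b i j" "a \<in> {1..m}" "b \<in> {1..m}" "(i, j) \<in> A \<union> N \<times> N"
        by (auto simp: minor_gens_def)
      show ?thesis
      proof (cases "i = v \<or> j = v")
        case True
        then have "(i, j) \<in> A" using g(4) adj by (auto simp: N_def)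
        then show ?thesis using True J(3)[OF g(2,3)] by (simp add: g(1) kill_column_two_minor)
      next
        case False
        then show ?thesis by (simp add: g(1) kill_column_two_minor mpoly_ideal_zero[OF J(1)])
      qed
    qed
  qed
  then have claim1: "g - kill_column v g \<in> ?J" if "g \<in> ?J1" for g using that by blast
  have T2: "ideal {g \<in> carrier ?R. kill_column v g \<in> ?J} ?R"
  proof (rule mpoly_idealI)
    show "{g \<in> carrier ?R. kill_column v g \<in> ?J} \<subseteq> carrier ?R" by blast
    show "0 \<in> {g \<in> carrier ?R. kill_column v g \<in> ?J}"
      by (simp add: mpoly_ideal_zero[OF J(1)] carrier_eq_poly_over)
  next
    fix p q assume "p \<in> {g \<in> carrier ?R. kill_column v g \<in> ?J}" "q \<in> {g \<in> carrier ?R. kill_column v g \<in> ?J}"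
    then show "p + q \<in> {g \<in> carrier ?R. kill_column v g \<in> ?J}"
      by (simp add: kill_column_add mpoly_ideal_add[OF J(1)] mpoly_ring_add_closed)
  next
    fix r p assume "r \<in> carrier ?R" "p \<in> {g \<in> carrier ?R. kill_column v g \<in> ?J}"
    then show "r * p \<in> {g \<in> carrier ?R. kill_column v g \<in> ?J}"
      by (simp add: kill_column_mult mpoly_ideal_mult[OF J(1) kcarr] mpoly_ring_mult_closed)
  qed
  have "?J2 \<subseteq> {g \<in> carrier ?R. kill_column v g \<in> ?J}"
    unfolding graph_ideal_def[of _ _ "insert v S"]
  proof (rule Idl_minimal[OF T2], rule subsetI, rule CollectI, rule conjI)
    fix g :: "'k mpoly" assume g: "g \<in> column_gens m (insert v S) \<union> minor_gens m A"
    then show "g \<in> carrier ?R" using G2 by blast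
    show "kill_column v g \<in> ?J"
      using g
    proof (elim UnE)
      assume "g \<in> column_gens m (insert v S)"
      then obtain i s where "g = xvar i s" "i \<in> {1..m}" "s \<in> insert v S" by (auto simp: column_gens_def)
      then show ?thesis using J(2)[of i s] mpoly_ideal_zero[OF J(1)] by (auto simp: kill_column_xvar)
    next
      assume "g \<in> minor_gens m A"
      then obtain a b i j where "g = two_minor a b i j" "a \<in> {1..m}" "b \<in> {1..m}" "(i, j) \<in> A"
        by (auto simp: minor_gens_def)
      then show ?thesis using J(3)[of a b i j] mpoly_ideal_zero[OF J(1)] by (simp add: kill_column_two_minor)
    qed
  qed
  then have claim2: "kill_column v g \<in> ?J" if "g \<in> ?J2" for g using that by blast
  fix g assume "g \<in> ?J1 \<inter> ?J2"
  then have "(g - kill_column v g) + kill_column v g \<in> ?J"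
    by (intro mpoly_ideal_add[OF J(1)] claim1 claim2) auto
  then show "g \<in> ?J" by simp
qed

text \<open>For adjacent \<open>i < k\<close>, weak closedness joins every remaining vertex between them to \<open>i\<close> or \<open>k\<close>, and
  completeness of the neighbourhoods then makes all remaining vertices of \<open>{i..k}\<close> pairwise adjacent.
  The 2-minors involving deleted columns are in the ideal anyway, so it contains all 2-minors of the
  interval.\<close>
lemma graph_ideal_locally_complete:
  fixes m n :: nat
  assumes S: "S \<subseteq> {1..n}" and A: "A \<subseteq> {1..n} \<times> {1..n}" and "sym A"
    and wc: "\<And>i j k. i < j \<Longrightarrow> j < k \<Longrightarrow> {i, j, k} \<inter> S = {} \<Longrightarrow> (i, k) \<in> A \<Longrightarrow> (i, j) \<in> A \<or> (j, k) \<in> A"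
    and cl: "\<And>v i k. v \<notin> S \<Longrightarrow> (i, v) \<in> A \<Longrightarrow> (k, v) \<in> A \<Longrightarrow> (i, k) \<in> A"
  shows "graph_ideal m n S A = Idl\<^bsub>mpoly_ring m n\<^esub> ((\<Union>s\<in>S. column_gens m {s}) \<union>
    (\<Union>(i, k) \<in> {(i, k) \<in> A. i < k \<and> i \<notin> S \<and> k \<notin> S}. minor_gens m ({i..k} \<times> {i..k})) :: 'k::field mpoly set)"
    (is "_ = Idl\<^bsub>?R\<^esub> ?H")
proof
  let ?J = "graph_ideal m n S A :: 'k mpoly set"
  note J = graph_ideal_facts[OF S A, where m = m and 'k = 'k] and G = graph_gens_carrier[OF S A, where m = m and 'k = 'k]
  have symA: "(j, i) \<in> A" if "(i, j) \<in> A" for i j using that \<open>sym A\<close> by (auto simp: sym_def)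
  have range: "i \<ge> 1" "k \<le> n" if "(i, k) \<in> A" for i k using that A by auto
  have H: "?H \<subseteq> carrier ?R"
  proof -
    have "column_gens m {s} \<subseteq> carrier ?R" if "s \<in> S" for s
      using S that by (intro column_gens_carrier) auto
    moreover have "minor_gens m ({i..k} \<times> {i..k}) \<subseteq> carrier ?R" if "(i, k) \<in> A" for i k
      using range[OF that] by (intro minor_gens_carrier) auto
    ultimately show ?thesis by fast
  qed
  note I = Idl_ideal(1)[OF H] and sub = Idl_ideal(2)[OF H]
  have x: "xvar i s \<in> Idl\<^bsub>?R\<^esub> ?H" if "i \<in> {1..m}" "s \<in> S" for i s
    using that by (intro subsetD[OF sub]) (auto simp: column_gens_def)
  have edge: "two_minor a b i j \<in> Idl\<^bsub>?R\<^esub> ?H"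
    if "a \<in> {1..m}" "b \<in> {1..m}" "(i, j) \<in> A" "i < j" "i \<notin> S" "j \<notin> S" for a b i j
    using that by (intro subsetD[OF sub] UnI2 UN_I[of "(i, j)"]) (auto intro!: two_minor_mem_gens)
  have edge': "two_minor a b i j \<in> Idl\<^bsub>?R\<^esub> ?H" if ab: "a \<in> {1..m}" "b \<in> {1..m}" and ij: "(i, j) \<in> A" for a b i j
  proof -
    have bx: "i \<in> {1..n}" "j \<in> {1..n}" using ij A by auto
    consider "i \<in> S" | "j \<in> S" | "i = j" | "i < j" "i \<notin> S" "j \<notin> S" | "j < i" "i \<notin> S" "j \<notin> S" by force
    then show ?thesis
    proof cases
      case 1
      then show ?thesis unfolding two_minor_def mult.commute[of "xvar a i"] using ab bx
        by (intro mpoly_ideal_diff[OF I] mpoly_ideal_mult[OF I] x xvar_carrier)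
    next
      case 2
      then show ?thesis unfolding two_minor_def mult.commute[of "xvar a j"] using ab bx
        by (intro mpoly_ideal_diff[OF I] mpoly_ideal_mult[OF I] x xvar_carrier)
    next
      case 3
      then show ?thesis by (simp add: mpoly_ideal_zero[OF I])
    next
      case 4
      then show ?thesis using edge ab ij by blast
    next
      case 5
      then show ?thesis
        using mpoly_ideal_uminus[OF I edge[OF ab symA[OF ij]]] by (simp add: two_minor_swap(2)[of a b i])
    qed
  qed
  show "?J \<subseteq> Idl\<^bsub>?R\<^esub> ?H"
    unfolding graph_ideal_def using x edge' by (intro Idl_minimal[OF I]) (auto simp: column_gens_def minor_gens_def simp del: One_nat_def)
  have inner: "(p, i) \<in> A" if ik: "(i, k) \<in> A" "i < k" "i \<notin> S" "k \<notin> S" and p: "i < p" "p \<le> k" "p \<notin> S" for i k p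
  proof (cases "p = k")
    case True
    then show ?thesis using symA ik by blast
  next
    case False
    then have "(i, p) \<in> A \<or> (p, k) \<in> A" using wc[of i p k] ik p by auto
    then show ?thesis
    proof
      assume "(p, k) \<in> A"
      then show ?thesis using cl[of k p i] ik by blast
    qed (rule symA)
  qed
  show "Idl\<^bsub>?R\<^esub> ?H \<subseteq> ?J"
  proof (rule Idl_minimal[OF J(1)], rule subsetI)
    fix g assume "g \<in> ?H"
    then consider i s where "g = xvar i s" "i \<in> {1..m}" "s \<in> S"
      | i k a b p q where "g = two_minor a b p q" "(i, k) \<in> A" "i < k" "i \<notin> S" "k \<notin> S"
        "a \<in> {1..m}" "b \<in> {1..m}" "p \<in> {i..k}" "q \<in> {i..k}"
      by (auto simp: column_gens_def minor_gens_def)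
    then show "g \<in> ?J"
    proof cases
      case 1
      then show ?thesis using J(2) by simp
    next
      case 2
      have bx: "p \<in> {1..n}" "q \<in> {1..n}" using 2 range[of i k] by auto
      consider "p \<in> S" | "q \<in> S" | "p \<notin> S" "q \<notin> S" by blast
      then show ?thesis
      proof cases
        case 1
        then show ?thesis using J(4) 2 bx by simp
      next
        case q: 2
        then show ?thesis
          using mpoly_ideal_uminus[OF J(1) J(4)[OF 2(6,7) q bx(1)]]
          by (simp add: 2(1) two_minor_swap(2)[of a b p])
      next
        case 3
        have ends: "p = i \<or> (p, i) \<in> A" "q = i \<or> (q, i) \<in> A"
          using inner[OF 2(2-5)] 2(8,9) 3 by (auto simp: le_less)
        show ?thesis
        proof (cases "p = q")
          case True
          then show ?thesis by (simp add: 2(1) mpoly_ideal_zero[OF J(1)])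
        next
          case False
          then have "(p, q) \<in> A"
            using ends cl[of i p q] 2(4) symA by blast
          then show ?thesis using J(3) 2 by simp
        qed
      qed
    qed
  qed
qed

text \<open>Induction on the number of remaining vertices plus the number of missing edges, splitting at a
  vertex whose neighbourhood is incomplete. The last hypothesis excludes the zero ideal, which does not
  contain \<open>f\<close>.\<close>
lemma knutson_graph_ideal:
  fixes m n :: nat
  assumes m: "m \<ge> 2" and "S \<subseteq> {1..n}" and "A \<subseteq> {1..n} \<times> {1..n}" and "sym A"
    and "\<And>i j k. i < j \<Longrightarrow> j < k \<Longrightarrow> {i, j, k} \<inter> S = {} \<Longrightarrow> (i, k) \<in> A \<Longrightarrow> (i, j) \<in> A \<or> (j, k) \<in> A"
    and "S \<noteq> {} \<or> (\<exists>(i, j) \<in> A. i \<noteq> j)"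
  shows "graph_ideal m n S A \<in> knutson_ideals (mpoly_ring m n) (diagonal_product m n :: 'k::field mpoly)"
  using assms(2-)
proof (induction "card ({1..n} - S) + card ({1..n} \<times> {1..n} - A)" arbitrary: S A rule: less_induct)
  case less
  let ?R = "mpoly_ring m n :: 'k mpoly ring"
  let ?K = "knutson_ideals ?R (diagonal_product m n)"
  note S = less.prems(1) and A = less.prems(2) and symA = less.prems(3) and wc = less.prems(4) and ne = less.prems(5)
  show ?case
  proof (cases "\<exists>v i k. v \<notin> S \<and> (i, v) \<in> A \<and> (k, v) \<in> A \<and> (i, k) \<notin> A")
    case True
    then obtain v i k where v: "v \<notin> S" "(i, v) \<in> A" "(k, v) \<in> A" "(i, k) \<notin> A" by blast
    then have vn: "v \<in> {1..n}" and ik: "i \<in> {1..n}" "k \<in> {1..n}" using A by auto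
    define N where "N = {i. (i, v) \<in> A}"
    have N: "N \<subseteq> {1..n}" using A by (auto simp: N_def)
    have sy: "(b, a) \<in> A" if "(a, b) \<in> A" for a b using that symA by (auto simp: sym_def)
    have "graph_ideal m n S (A \<union> N \<times> N) \<in> ?K"
    proof (rule less.hyps)
      have "card ({1..n} \<times> {1..n} - (A \<union> N \<times> N)) < card ({1..n} \<times> {1..n} - A)"
      proof (intro psubset_card_mono psubsetI)
        have "(i, k) \<in> {1..n} \<times> {1..n} - A" "(i, k) \<in> N \<times> N"
          using v ik by (auto simp only: N_def)
        then show "{1..n} \<times> {1..n} - (A \<union> N \<times> N) \<noteq> {1..n} \<times> {1..n} - A" by blast
      qed blast+
      then show "card ({1..n} - S) + card ({1..n} \<times> {1..n} - (A \<union> N \<times> N)) <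
          card ({1..n} - S) + card ({1..n} \<times> {1..n} - A)" by simp
      show "A \<union> N \<times> N \<subseteq> {1..n} \<times> {1..n}" using A N by auto
      show "sym (A \<union> N \<times> N)" using symA by (auto simp: sym_def)
      show "S \<noteq> {} \<or> (\<exists>(i, j)\<in>A \<union> N \<times> N. i \<noteq> j)" using ne by blast
      fix i j k assume ijk: "i < j" "j < k" "{i, j, k} \<inter> S = {}" "(i, k) \<in> A \<union> N \<times> N"
      \<comment> \<open>For a new edge between neighbours of \<open>v\<close>, one of the edges \<open>{v, k}\<close> and \<open>{i, v}\<close> passes over \<open>j\<close>,
        unless \<open>v = j\<close>.\<close>
      show "(i, j) \<in> A \<union> N \<times> N \<or> (j, k) \<in> A \<union> N \<times> N"
      proof (cases "(i, k) \<in> A")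
        case True
        then show ?thesis using wc[OF ijk(1-3)] by blast
      next
        case False
        then have iN: "(i, v) \<in> A" "(k, v) \<in> A" using ijk(4) by (auto simp: N_def)
        consider "v = j" | "v < j" | "j < v" by linarith
        then show ?thesis
        proof cases
          case 1
          then show ?thesis using iN by blast
        next
          case 2
          then have "(v, j) \<in> A \<or> (j, k) \<in> A" using wc[of v j k] ijk v(1) sy[OF iN(2)] by auto
          then show ?thesis using iN sy by (auto simp: N_def)
        next
          case 3
          then have "(i, j) \<in> A \<or> (j, v) \<in> A" using wc[of i j v] ijk v(1) iN(1) by auto
          then show ?thesis using iN sy by (auto simp: N_def)
        qed
      qed
    qed (rule S)
    moreover have "graph_ideal m n (insert v S) A \<in> ?K"
    proof (rule less.hyps)
      have "card ({1..n} - insert v S) < card ({1..n} - S)"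
        using v(1) vn by (intro psubset_card_mono psubsetI) blast+
      then show "card ({1..n} - insert v S) + card ({1..n} \<times> {1..n} - A) <
          card ({1..n} - S) + card ({1..n} \<times> {1..n} - A)" by simp
      show "insert v S \<subseteq> {1..n}" using S vn by auto
    qed (use A symA wc in auto)
    ultimately show ?thesis
      unfolding graph_ideal_split[OF S A symA vn v(1), folded N_def] by (rule knutson_ideals.inter)
  next
    case False
    let ?E = "{(i, k) \<in> A. i < k \<and> i \<notin> S \<and> k \<notin> S}"
    let ?g = "case_sum (\<lambda>s. column_gens m {s}) (\<lambda>(i, k). minor_gens m ({i..k} \<times> {i..k})) :: nat + nat \<times> nat \<Rightarrow> 'k mpoly set"
    have cl: "(i, k) \<in> A" if "v \<notin> S" "(i, v) \<in> A" "(k, v) \<in> A" for v i k using False that by blast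
    have "(\<Union>a\<in>S <+> ?E. ?g a) = (\<Union>s\<in>S. column_gens m {s}) \<union> (\<Union>(i, k) \<in> ?E. minor_gens m ({i..k} \<times> {i..k}))"
      by (simp add: Plus_def UN_Un)
    then have "graph_ideal m n S A = Idl\<^bsub>?R\<^esub> (\<Union>a\<in>S <+> ?E. ?g a)"
      using graph_ideal_locally_complete[OF S A symA wc cl, where 'k = 'k and m = m] by (simp only:)
    also have "\<dots> \<in> ?K"
    proof (rule knutson_Idl_UN[OF diagonal_product_carrier])
      have "finite A" using A finite_subset by blast
      then show "finite (S <+> ?E)"
        using S finite_subset[OF S] finite_subset[of ?E A] by auto
      show "S <+> ?E \<noteq> {}"
      proof (cases "S = {}")
        case True
        then obtain i j where "(i, j) \<in> A" "i \<noteq> j" using ne by auto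
        then have "(i, j) \<in> ?E \<or> (j, i) \<in> ?E" using True symA by (auto simp: sym_def)
        then show ?thesis by (auto simp: Plus_def)
      qed auto
      fix a assume a: "a \<in> S <+> ?E"
      show "?g a \<subseteq> carrier ?R"
        using a
      proof (rule PlusE)
        fix s assume "s \<in> S" "a = Inl s"
        then show ?thesis using S by (auto intro!: column_gens_carrier simp del: One_nat_def)
      next
        fix e assume "e \<in> ?E" "a = Inr e"
        then obtain i k where "a = Inr (i, k)" "1 \<le> i" "k \<le> n" using A by auto
        moreover from this have "{i..k} \<times> {i..k} \<subseteq> {1..n} \<times> {1..n}" by auto
        ultimately show ?thesis using minor_gens_carrier by simp
      qed
      show "Idl\<^bsub>?R\<^esub> (?g a) \<in> ?K"
        using a
      proof (rule PlusE)
        fix s assume "s \<in> S" "a = Inl s"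
        then show ?thesis using knutson_column[of m s n] m S by auto
      next
        fix e assume "e \<in> ?E" "a = Inr e"
        then obtain i k where "a = Inr (i, k)" "1 \<le> i" "i < k" "k \<le> n" using A by auto
        then show ?thesis using knutson_column_interval[OF m, of i k n, where 'k = 'k] by simp
      qed
    qed
    finally show ?thesis .
  qed
qed

section \<open>F-purity from splittings\<close>

text \<open>A splitting \<open>\<psi>\<close> of the Frobenius map induces \<open>M \<otimes> F\<^sub>*R \<rightarrow> M\<close>, \<open>x \<otimes> s \<mapsto> \<psi>(s) x\<close>, which is a left inverse of
  \<open>x \<mapsto> x \<otimes> 1\<close>. On the level of the presentation of the tensor product, it is a homomorphism \<open>h\<close> from the
  free abelian group that vanishes on all relations.\<close>
lemma (in cring) F_pure_if_splitting:
  fixes p :: nat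
  assumes p: "prime p" "[p] \<cdot> \<one> = \<zero>"
    and \<psi>: "\<And>x. x \<in> carrier R \<Longrightarrow> \<psi> x \<in> carrier R"
    and add: "\<And>x y. x \<in> carrier R \<Longrightarrow> y \<in> carrier R \<Longrightarrow> \<psi> (x \<oplus> y) = \<psi> x \<oplus> \<psi> y"
    and linear: "\<And>r x. r \<in> carrier R \<Longrightarrow> x \<in> carrier R \<Longrightarrow> \<psi> (r [^] p \<otimes> x) = r \<otimes> \<psi> x"
    and one: "\<psi> \<one> = \<one>"
  shows "F_pure TYPE('m) p R"
  unfolding F_pure_def
proof (intro conjI allI impI inj_onI)
  fix M :: "('a, 'm) module" and x y
  assume M: "module R M" and x: "x \<in> carrier M" and y: "y \<in> carrier M"
    and eq: "pure_tensor R M (frobenius_module p R) x \<one> = pure_tensor R M (frobenius_module p R) y \<one>"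
  interpret M: module R M by fact
  define A where "A = free_Abelian_group (carrier M \<times> carrier R)"
  define N where "N = frobenius_module p R"
  have N: "carrier N = carrier R" "ring.add N = ring.add R" "module.smult N = (\<lambda>r x. r [^] p \<otimes> x)"
    by (simp_all add: N_def frobenius_module_def)
  let ?f = "\<lambda>(m, s). \<psi> s \<odot>\<^bsub>M\<^esub> m"
  have "?f ` (carrier M \<times> carrier R) \<subseteq> carrier (add_monoid M)"
    using \<psi> by auto
  then obtain h where h: "h \<in> hom A (add_monoid M)"
    and hf': "\<And>z. z \<in> carrier M \<times> carrier R \<Longrightarrow> h (frag_of z) = ?f z"
    using comm_group.free_Abelian_group_universal[OF M.a_comm_group, of ?f "carrier M \<times> carrier R"]
    unfolding A_def by blast
  have hf: "h (frag_of (m, s)) = \<psi> s \<odot>\<^bsub>M\<^esub> m" if "m \<in> carrier M" "s \<in> carrier R" for m s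
    using hf'[of "(m, s)"] that by simp
  interpret A: group A by (simp add: A_def)
  interpret h: group_hom A "add_monoid M" h
    using h M.a_group by (simp add: group_hom_def group_hom_axioms_def A.group_axioms)
  have cA [simp]: "c \<in> carrier A \<longleftrightarrow> Poly_Mapping.keys c \<subseteq> carrier M \<times> carrier R" for c
    by (simp add: A_def)
  have hdiff: "h (c - d) = h c \<ominus>\<^bsub>M\<^esub> h d" if "c \<in> carrier A" "d \<in> carrier A" for c d
  proof -
    have "h (c \<otimes>\<^bsub>A\<^esub> inv\<^bsub>A\<^esub> d) = h c \<oplus>\<^bsub>M\<^esub> \<ominus>\<^bsub>M\<^esub> (h d)"
      using that h.hom_mult[of c "inv\<^bsub>A\<^esub> d"] h.hom_inv[of d] A.inv_closed[of d] by (simp add: a_inv_def)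
    then show ?thesis using that by (simp add: A_def a_minus_def)
  qed
  have frag: "frag_of (u, s) \<in> carrier A" if "u \<in> carrier M" "s \<in> carrier R" for u s
    using that by (simp add: keys_frag_of)
  have diffA: "c - d \<in> carrier A" if "c \<in> carrier A" "d \<in> carrier A" for c d
    using that keys_diff[of c d] by auto
  have "tensor_relations R M N \<subseteq> kernel A (add_monoid M) h"
  proof
    fix z assume "z \<in> tensor_relations R M N"
    then consider u u' s where "z = frag_of (u \<oplus>\<^bsub>M\<^esub> u', s) - frag_of (u, s) - frag_of (u', s)"
        "u \<in> carrier M" "u' \<in> carrier M" "s \<in> carrier R"
      | u s s' where "z = frag_of (u, s \<oplus> s') - frag_of (u, s) - frag_of (u, s')"
        "u \<in> carrier M" "s \<in> carrier R" "s' \<in> carrier R"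
      | r u s where "z = frag_of (r \<odot>\<^bsub>M\<^esub> u, s) - frag_of (u, r [^] p \<otimes> s)"
        "r \<in> carrier R" "u \<in> carrier M" "s \<in> carrier R"
      unfolding tensor_relations_def N by blast
    then have "z \<in> carrier A \<and> h z = \<zero>\<^bsub>M\<^esub>"
    proof cases
      case 1
      have "h z = \<psi> s \<odot>\<^bsub>M\<^esub> (u \<oplus>\<^bsub>M\<^esub> u') \<ominus>\<^bsub>M\<^esub> \<psi> s \<odot>\<^bsub>M\<^esub> u \<ominus>\<^bsub>M\<^esub> \<psi> s \<odot>\<^bsub>M\<^esub> u'"
        using 1 by (simp only: hdiff diffA frag hf M.add.m_closed)
      also have "\<dots> = \<zero>\<^bsub>M\<^esub>"
        using 1 \<psi>[of s] by (simp add: M.smult_r_distr a_minus_def M.minus_add M.a_ac M.r_neg)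
      finally show ?thesis using 1 by (simp only: diffA frag M.add.m_closed)
    next
      case 2
      have "h z = \<psi> (s \<oplus> s') \<odot>\<^bsub>M\<^esub> u \<ominus>\<^bsub>M\<^esub> \<psi> s \<odot>\<^bsub>M\<^esub> u \<ominus>\<^bsub>M\<^esub> \<psi> s' \<odot>\<^bsub>M\<^esub> u"
        using 2 by (simp only: hdiff diffA frag hf add.m_closed)
      also have "\<dots> = \<zero>\<^bsub>M\<^esub>"
        using 2 \<psi>[of s] \<psi>[of s'] by (simp add: add M.smult_l_distr a_minus_def M.minus_add M.a_ac M.r_neg)
      finally show ?thesis using 2 by (simp only: diffA frag add.m_closed)
    next
      case 3
      have rs: "r [^] p \<otimes> s \<in> carrier R" "r \<odot>\<^bsub>M\<^esub> u \<in> carrier M" using 3 by auto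
      have "h z = \<psi> s \<odot>\<^bsub>M\<^esub> (r \<odot>\<^bsub>M\<^esub> u) \<ominus>\<^bsub>M\<^esub> \<psi> (r [^] p \<otimes> s) \<odot>\<^bsub>M\<^esub> u"
        using 3 rs by (simp only: hdiff frag hf)
      also have "\<dots> = \<zero>\<^bsub>M\<^esub>"
        using 3 \<psi>[of s] by (simp add: linear M.smult_assoc1[symmetric] m_comm[of "\<psi> s"] a_minus_def M.r_neg)
      finally show ?thesis using 3 rs by (simp only: diffA frag)
    qed
    then show "z \<in> kernel A (add_monoid M) h" by (simp add: kernel_def)
  qed
  then have ker: "generate A (tensor_relations R M N) \<subseteq> kernel A (add_monoid M) h"
    by (intro A.generate_subgroup_incl h.subgroup_kernel)
  have eq': "generate A (tensor_relations R M N) #>\<^bsub>A\<^esub> frag_of (x, \<one>) =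
      generate A (tensor_relations R M N) #>\<^bsub>A\<^esub> frag_of (y, \<one>)"
    using eq by (simp add: pure_tensor_def Let_def N_def A_def frobenius_module_def)
  have "\<one>\<^bsub>A\<^esub> \<otimes>\<^bsub>A\<^esub> frag_of (x, \<one>) \<in> generate A (tensor_relations R M N) #>\<^bsub>A\<^esub> frag_of (x, \<one>)"
    unfolding r_coset_def by (auto intro: generate.one)
  then obtain k where k: "k \<in> generate A (tensor_relations R M N)"
    "\<one>\<^bsub>A\<^esub> \<otimes>\<^bsub>A\<^esub> frag_of (x, \<one>) = k \<otimes>\<^bsub>A\<^esub> frag_of (y, \<one>)"
    unfolding eq' by (auto simp: r_coset_def)
  have k0: "k \<in> carrier A" "h k = \<zero>\<^bsub>M\<^esub>" using k(1) ker by (auto simp: kernel_def)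
  have "h (frag_of (x, \<one>)) = h k \<oplus>\<^bsub>M\<^esub> h (frag_of (y, \<one>))"
    using k(2) h.hom_mult[OF k0(1) frag[OF y one_closed]] frag[OF x one_closed] by simp
  then show "x = y" using x y k0 by (simp add: hf one)
qed (use p is_cring in auto)

text \<open>A splitting that maps \<open>J\<close> into itself descends to the quotient by \<open>J\<close>.\<close>
lemma (in cring) F_pure_quotient:
  fixes p :: nat
  assumes p: "prime p" "[p] \<cdot> \<one> = \<zero>" and J: "ideal J R"
    and \<phi>: "\<And>x. x \<in> carrier R \<Longrightarrow> \<phi> x \<in> carrier R"
    and add: "\<And>x y. x \<in> carrier R \<Longrightarrow> y \<in> carrier R \<Longrightarrow> \<phi> (x \<oplus> y) = \<phi> x \<oplus> \<phi> y"
    and linear: "\<And>r x. r \<in> carrier R \<Longrightarrow> x \<in> carrier R \<Longrightarrow> \<phi> (r [^] p \<otimes> x) = r \<otimes> \<phi> x"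
    and one: "\<phi> \<one> = \<one>" and compat: "\<And>x. x \<in> J \<Longrightarrow> \<phi> x \<in> J"
  shows "F_pure TYPE('m) p (R Quot J)"
proof -
  interpret J: ideal J R by fact
  interpret Q: cring "R Quot J" by (rule J.quotient_is_cring[OF is_cring])
  interpret hom: ring_hom_ring R "R Quot J" "(+>) J" by (rule J.rcos_ring_hom_ring)
  define \<psi> where "\<psi> X = J +> \<phi> (SOME x. x \<in> carrier R \<and> X = J +> x)" for X
  have rep: "\<psi> (J +> x) = J +> \<phi> x" if x: "x \<in> carrier R" for x
  proof -
    define y where "y = (SOME y. y \<in> carrier R \<and> J +> x = J +> y)"
    have y: "y \<in> carrier R" "J +> x = J +> y"
      using someI[of "\<lambda>y. y \<in> carrier R \<and> J +> x = J +> y" x] x unfolding y_def by auto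
    have d: "x \<ominus> y \<in> J"
      using quotient_eq_iff_same_a_r_cos[OF J x y(1)] y(2) by simp
    have "\<phi> x = \<phi> (x \<ominus> y) \<oplus> \<phi> y"
      using add[of "x \<ominus> y" y] x y(1) by (simp add: a_minus_def a_assoc l_neg)
    then have "\<phi> x \<ominus> \<phi> y = \<phi> (x \<ominus> y)"
      using \<phi>[of "x \<ominus> y"] \<phi>[OF y(1)] x y(1) by (simp add: a_minus_def a_assoc r_neg)
    then have "J +> \<phi> x = J +> \<phi> y"
      using quotient_eq_iff_same_a_r_cos[OF J \<phi>[OF x] \<phi>[OF y(1)]] compat[OF d] by simp
    then show ?thesis by (simp add: \<psi>_def y_def)
  qed
  have coset: "\<exists>x \<in> carrier R. X = J +> x" if "X \<in> carrier (R Quot J)" for X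
    using that unfolding FactRing_def A_RCOSETS_def' partial_object.simps by blast
  show ?thesis
  proof (rule Q.F_pure_if_splitting[where \<psi> = \<psi>, OF p(1)])
    show "[p] \<cdot>\<^bsub>R Quot J\<^esub> \<one>\<^bsub>R Quot J\<^esub> = \<zero>\<^bsub>R Quot J\<^esub>"
    proof -
      have "J +> ([k] \<cdot> \<one>) = [k] \<cdot>\<^bsub>R Quot J\<^esub> \<one>\<^bsub>R Quot J\<^esub>" for k :: nat
        by (induction k) simp_all
      then show ?thesis using p(2) by (metis hom.hom_zero)
    qed
    show "\<psi> X \<in> carrier (R Quot J)" if "X \<in> carrier (R Quot J)" for X
      using coset[OF that] rep \<phi> by auto
    show "\<psi> (X \<oplus>\<^bsub>R Quot J\<^esub> Y) = \<psi> X \<oplus>\<^bsub>R Quot J\<^esub> \<psi> Y"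
      if XY: "X \<in> carrier (R Quot J)" "Y \<in> carrier (R Quot J)" for X Y
    proof -
      obtain x y where "x \<in> carrier R" "X = J +> x" "y \<in> carrier R" "Y = J +> y"
        using coset XY by metis
      then show ?thesis
        using rep[of x] rep[of y] rep[of "x \<oplus> y"] add[of x y] \<phi>[of x] \<phi>[of y] by simp
    qed
    show "\<psi> (X [^]\<^bsub>R Quot J\<^esub> p \<otimes>\<^bsub>R Quot J\<^esub> Y) = X \<otimes>\<^bsub>R Quot J\<^esub> \<psi> Y"
      if XY: "X \<in> carrier (R Quot J)" "Y \<in> carrier (R Quot J)" for X Y
    proof -
      obtain x y where xy: "x \<in> carrier R" "X = J +> x" "y \<in> carrier R" "Y = J +> y"
        using coset XY by metis
      then have "X [^]\<^bsub>R Quot J\<^esub> p = J +> (x [^] p)" by (simp add: hom.hom_nat_pow)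
      then show ?thesis
        using xy rep[of y] rep[of "x [^] p \<otimes> y"] linear[of x y] \<phi>[of y] by (simp flip: hom.hom_mult)
    qed
    show "\<psi> \<one>\<^bsub>R Quot J\<^esub> = \<one>\<^bsub>R Quot J\<^esub>"
      using rep[OF one_closed] one by simp
  qed
qed

section \<open>The Frobenius trace of the polynomial ring\<close>

lemma char_mpoly: "CHAR(('k::field) mpoly) = CHAR('k::field)"
proof (rule CHAR_eqI)
  have "(of_nat k :: 'k mpoly) = 0 \<longleftrightarrow> (of_nat k :: 'k) = 0" for k
    unfolding single_of_nat[symmetric] by (metis lookup_single_eq lookup_zero single_zero)
  then show "(of_nat CHAR('k) :: 'k mpoly) = 0" "\<And>x. (of_nat x :: 'k mpoly) = 0 \<Longrightarrow> CHAR('k) dvd x"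
    by (simp_all add: of_nat_eq_0_iff_char_dvd)
qed

text \<open>The field is a vector space over itself with scalars acting through their \<open>p\<close>-th powers, and
  \<open>{1}\<close> extends to a basis. For a perfect field this is the \<open>p\<close>-th root.\<close>
lemma frobenius_functional:
  assumes "prime CHAR('k::field)"
  obtains l :: "'k::field \<Rightarrow> 'k::field" where "\<And>x y. l (x + y) = l x + l y" "\<And>a x. l (a ^ CHAR('k) * x) = a * l x" "l 1 = 1"
proof -
  interpret vs: vector_space "\<lambda>a x :: 'k. a ^ CHAR('k) * x"
    by standard (simp_all add: algebra_simps freshmans_dream[OF assms refl] power_mult_distrib)
  interpret vector_space_pair "\<lambda>a x :: 'k. a ^ CHAR('k) * x" "(*) :: 'k \<Rightarrow> 'k \<Rightarrow> 'k"
    by standard (simp_all add: algebra_simps)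
  have "vs.independent {1}" by (simp add: vs.dependent_single)
  from linear_independent_extend[OF this, of "\<lambda>_. 1"]
  obtain l where l: "Vector_Spaces.linear (\<lambda>a x :: 'k. a ^ CHAR('k) * x) (*) l" "l 1 = 1" by auto
  show thesis
    using that[of l] linear_add[OF l(1)] linear_scale[OF l(1)] l(2) by blast
qed

lemma inj_frobenius_expo: "k > 0 \<Longrightarrow> inj (\<lambda>u. t + scale_expo k u)"
  by (rule injI, rule poly_mapping_eqI) (metis add_left_cancel lookup_scale_expo mult_cancel1 not_gr_zero)

text \<open>Only monomials \<open>x\<^bsup>t\<^esup> u\<^bsup>p\<^esup>\<close> survive; they are sent to \<open>u\<close>, and \<open>l\<close> acts on the coefficients.\<close>
definition frobenius_trace :: "nat \<Rightarrow> ('k \<Rightarrow> 'k) \<Rightarrow> expo \<Rightarrow> 'k::field mpoly \<Rightarrow> 'k mpoly" where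
  "frobenius_trace p l t q = Poly_Mapping.map l (Poly_Mapping.map_key (\<lambda>u. t + scale_expo p u) q)"

locale frobenius_section =
  fixes p :: nat and l :: "'k::field \<Rightarrow> 'k" and t :: expo
  assumes char: "p = CHAR('k)" "prime CHAR('k)"
    and l_add: "l (x + y) = l x + l y" and l_scale: "l (a ^ p * x) = a * l x" and l_one: "l 1 = 1"
    and small: "Poly_Mapping.lookup t v < p"
begin

lemma l_zero [simp]: "l 0 = 0" using l_add[of 0 0] by (metis add_cancel_right_right add_0)

lemma lookup_trace:
  "Poly_Mapping.lookup (frobenius_trace p l t q) u = l (Poly_Mapping.lookup q (t + scale_expo p u))"
proof -
  have "inj (\<lambda>u. t + scale_expo p u)" using char by (intro inj_frobenius_expo) (simp add: prime_gt_0_nat)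
  then show ?thesis
    by (simp add: frobenius_trace_def Poly_Mapping.map.rep_eq map_key.rep_eq when_def)
qed

lemma trace_add: "frobenius_trace p l t (q + q') = frobenius_trace p l t q + frobenius_trace p l t q'"
  by (rule poly_mapping_eqI) (simp add: lookup_trace lookup_add l_add)

lemma trace_zero [simp]: "frobenius_trace p l t 0 = 0"
  by (rule poly_mapping_eqI) (simp add: lookup_trace)

lemma power_p_add: "(x + y) ^ p = x ^ p + (y :: 'k mpoly) ^ p"
  using freshmans_dream[of p x y] char by (simp add: char_mpoly)

lemma single_power: "Poly_Mapping.single s c ^ k = Poly_Mapping.single (scale_expo k s) (c ^ k :: 'k)"
proof (induction k)
  case (Suc k)
  have "scale_expo (Suc k) s = s + scale_expo k s" by (rule poly_mapping_eqI) (simp add: lookup_add)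
  then show ?case using Suc by (simp add: mult_single)
qed simp

text \<open>Linearity over \<open>p\<close>-th powers, on monomials. As the entries of \<open>t\<close> are smaller than \<open>p\<close>, multiplication
  by \<open>x\<^bsup>ps\<^esup>\<close> creates no new monomial of the form \<open>x\<^bsup>t\<^esup> u\<^bsup>p\<^esup>\<close>: from \<open>p s \<le> t + p u\<close> follows \<open>s \<le> u\<close>.\<close>
lemma trace_single_single:
  "frobenius_trace p l t (Poly_Mapping.single s c ^ p * Poly_Mapping.single s' d) =
     Poly_Mapping.single s c * frobenius_trace p l t (Poly_Mapping.single s' d)"
proof (cases "\<exists>u. s' = t + scale_expo p u")
  case True
  then obtain u where u: "s' = t + scale_expo p u" by blast
  have inj: "scale_expo p u = scale_expo p u' \<longleftrightarrow> u = u'" for u u'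
    using inj_frobenius_expo[of p t] char by (auto simp: inj_def prime_gt_0_nat)
  have single: "frobenius_trace p l t (Poly_Mapping.single (t + scale_expo p u) e) = Poly_Mapping.single u (l e)" for u e
    by (rule poly_mapping_eqI) (auto simp: lookup_trace lookup_single when_def inj)
  have "scale_expo p s + (t + scale_expo p u) = t + scale_expo p (s + u)"
    by (rule poly_mapping_eqI) (simp add: lookup_add distrib_left)
  then have "Poly_Mapping.single s c ^ p * Poly_Mapping.single s' d = Poly_Mapping.single (t + scale_expo p (s + u)) (c ^ p * d)"
    by (simp add: single_power mult_single u)
  then show ?thesis by (simp add: u single mult_single l_scale)
next
  case False
  have no: "scale_expo p s + s' \<noteq> t + scale_expo p u" for u
  proof
    assume eq: "scale_expo p s + s' = t + scale_expo p u"
    have "Poly_Mapping.lookup s v \<le> Poly_Mapping.lookup u v" for v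
    proof -
      have "p * Poly_Mapping.lookup s v + Poly_Mapping.lookup s' v = Poly_Mapping.lookup t v + p * Poly_Mapping.lookup u v"
        using arg_cong[OF eq, of "\<lambda>f. Poly_Mapping.lookup f v"] by (simp add: lookup_add)
      then have "p * Poly_Mapping.lookup s v < p * Suc (Poly_Mapping.lookup u v)"
        using small[of v] by simp
      then show ?thesis by (metis less_Suc_eq_le mult_less_cancel1)
    qed
    then have "u = s + (u - s)"
      by (intro poly_mapping_eqI) (simp add: lookup_add lookup_minus)
    then have "scale_expo p u = scale_expo p s + scale_expo p (u - s)"
      by (intro poly_mapping_eqI) (metis distrib_left lookup_add lookup_scale_expo)
    then have "s' = t + scale_expo p (u - s)"
      using eq by (simp add: add.left_commute[of t])
    then show False using False by blast
  qed
  have "frobenius_trace p l t (Poly_Mapping.single (scale_expo p s + s') e) = 0" for e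
    by (rule poly_mapping_eqI) (simp add: lookup_trace lookup_single when_def no)
  moreover have "frobenius_trace p l t (Poly_Mapping.single s' d) = 0"
    using False by (intro poly_mapping_eqI) (auto simp: lookup_trace lookup_single when_def)
  ultimately show ?thesis by (simp add: single_power mult_single)
qed

lemma trace_linear: "frobenius_trace p l t (r ^ p * q) = r * frobenius_trace p l t q"
proof (induction r rule: mpoly_induct)
  case zero
  have "p > 0" using char by (simp add: prime_gt_0_nat)
  then show ?case by (simp add: power_0_left)
next
  case (single s c)
  show ?case
    by (induction q rule: mpoly_induct) (simp_all add: trace_single_single distrib_left trace_add)
qed (simp add: power_p_add distrib_right trace_add)

lemma trace_poly_over:
  assumes "q \<in> poly_over S" shows "frobenius_trace p l t q \<in> poly_over S"
proof -
  have p: "p > 0" using char by (simp add: prime_gt_0_nat)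
  have "Poly_Mapping.keys u \<subseteq> S" if "u \<in> Poly_Mapping.keys (frobenius_trace p l t q)" for u
  proof -
    have "t + scale_expo p u \<in> Poly_Mapping.keys q"
      using that by (auto simp: in_keys_iff lookup_trace)
    then have "Poly_Mapping.keys (t + scale_expo p u) \<subseteq> S" using assms by (auto simp: poly_over_def)
    moreover have "Poly_Mapping.keys u \<subseteq> Poly_Mapping.keys (t + scale_expo p u)"
      using p by (auto simp: in_keys_iff lookup_add)
    ultimately show ?thesis by blast
  qed
  then show ?thesis by (simp add: poly_over_def)
qed

text \<open>A further term \<open>x\<^bsup>t\<^esup> u\<^bsup>p\<^esup>\<close> of \<open>q\<close> would have at least the weight of the dominating term \<open>x\<^bsup>t\<^esup>\<close>.\<close>
lemma trace_lead:
  assumes "lead q t"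
  shows "frobenius_trace p l t q = 1"
proof (rule poly_mapping_eqI)
  fix u
  have p: "p > 0" using char by (simp add: prime_gt_0_nat)
  show "Poly_Mapping.lookup (frobenius_trace p l t q) u = Poly_Mapping.lookup 1 u"
  proof (cases "u = 0")
    case True
    then show ?thesis using lead_lookup[OF assms] by (simp add: lookup_trace l_one)
  next
    case False
    have "t + scale_expo p u \<notin> Poly_Mapping.keys q"
    proof
      assume k: "t + scale_expo p u \<in> Poly_Mapping.keys q"
      have "expo_weight (scale_expo p u) \<ge> 0"
        unfolding expo_weight_def by (intro sum_nonneg) simp
      then have "t + scale_expo p u = t"
        using lead_unique[OF assms k] by (simp add: expo_weight_add)
      then have "scale_expo p u = 0" by simp
      then have "u = 0" using p by (intro poly_mapping_eqI) (metis lookup_scale_expo lookup_zero mult_eq_0_iff not_gr_zero)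
      then show False using False by simp
    qed
    then show ?thesis using False by (simp add: lookup_trace lookup_one in_keys_iff)
  qed
qed

end

section \<open>Knutson ideals are compatibly split\<close>

lemma lead_power: "lead p t \<Longrightarrow> lead (p ^ k) (scale_expo k t)"
proof (induction k)
  case (Suc k)
  have "scale_expo (Suc k) t = t + scale_expo k t" by (rule poly_mapping_eqI) (simp add: lookup_add)
  then show ?case using lead_mult[OF Suc.prems Suc.IH[OF Suc.prems]] by simp
qed (simp add: lead_one)

lemma lookup_diagonal_expo:
  "Poly_Mapping.lookup (diagonal_expo m n c) (i, j) \<le> (if c = int j - int i then 1 else 0)"
proof -
  have "Poly_Mapping.lookup (diagonal_expo m n c) (i, j) =
      (\<Sum>i'\<in>set (diagonal_rows m n c). if i' = i then (if nat (int i + c) = j then 1 else 0) else 0)"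
    unfolding diagonal_expo_def lookup_sum lookup_single when_def by (intro sum.cong) auto
  also have "\<dots> = (if i \<in> set (diagonal_rows m n c) \<and> nat (int i + c) = j then 1 else 0)" by simp
  also have "\<dots> \<le> (if c = int j - int i then 1 else 0)" by (auto simp: set_diagonal_rows)
  finally show ?thesis .
qed

definition diagonal_product_expo :: "nat \<Rightarrow> nat \<Rightarrow> expo" where
  "diagonal_product_expo m n = (\<Sum>c \<in> {- (int m - 1)..int n - 1}. diagonal_expo m n c)"

lemma lead_diagonal_product: "lead (diagonal_product m n) (diagonal_product_expo m n)"
  unfolding diagonal_product_def diagonal_product_expo_def by (intro lead_prod lead_diagonal_minor)

text \<open>The initial term of \<open>f\<close> is squarefree because each entry of the matrix lies on one diagonal only.\<close>
lemma lookup_diagonal_product_expo: "Poly_Mapping.lookup (diagonal_product_expo m n) v \<le> 1"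
proof -
  obtain i j where v: "v = (i, j)" by fastforce
  have "Poly_Mapping.lookup (diagonal_product_expo m n) v \<le>
      (\<Sum>c \<in> {- (int m - 1)..int n - 1}. if c = int j - int i then 1 else 0)"
    unfolding diagonal_product_expo_def lookup_sum v by (intro sum_mono lookup_diagonal_expo)
  also have "\<dots> \<le> 1" by simp
  finally show ?thesis .
qed

text \<open>For the principal ideal, \<open>f\<^bsup>p-1\<^esup> (r f) = f\<^bsup>p\<^esup> r\<close> and \<open>f\<close> leaves the trace. For a colon \<open>I : J\<close> and \<open>b \<in> J\<close>, the
  product of \<open>b\<close> with the image of \<open>g\<close> is the image of \<open>b\<^bsup>p\<^esup> g = b\<^bsup>p-1\<^esup> (g b)\<close>, an element of \<open>I\<close>. Sums and
  intersections are clear.\<close>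
lemma (in frobenius_section) knutson_compatible:
  fixes f :: "'k mpoly"
  assumes f: "f \<in> carrier (mpoly_ring m n)" and "I \<in> knutson_ideals (mpoly_ring m n) f" "g \<in> I"
  shows "frobenius_trace p l t (f ^ (p - 1) * g) \<in> I"
  using assms(2,3)
proof (induction arbitrary: g)
  have p: "p > 0" using char by (simp add: prime_gt_0_nat)
  then have power_p: "x ^ (p - 1) * x = x ^ p" for x :: "'k mpoly" by (rule power_minus_mult)
  {
    case principal
    then obtain r where r: "r \<in> carrier (mpoly_ring m n)" "g = r * f" by (auto simp: mem_PIdl_iff)
    have "f ^ (p - 1) * g = f ^ p * r" unfolding r(2) power_p[symmetric] by (simp add: mult_ac)
    then have "frobenius_trace p l t (f ^ (p - 1) * g) = f * frobenius_trace p l t r"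
      by (simp only: trace_linear)
    also have "\<dots> = frobenius_trace p l t r * f" by (rule mult.commute)
    finally have "frobenius_trace p l t (f ^ (p - 1) * g) = frobenius_trace p l t r * f" .
    then show ?case using r(1) trace_poly_over[of r] by (auto simp: mem_PIdl_iff carrier_eq_poly_over)
  next
    case (colon I J)
    note I = knutson_mpoly_ideal[OF f colon.hyps(1)]
    have g: "g \<in> carrier (mpoly_ring m n)" "\<And>b. b \<in> J \<Longrightarrow> g * b \<in> I"
      using colon.prems by (auto simp: ideal_colon_def)
    have "frobenius_trace p l t (f ^ (p - 1) * g) * b \<in> I" if b: "b \<in> J" for b
    proof -
      have "b \<in> carrier (mpoly_ring m n)" using mpoly_ideal_carrier[OF colon.hyps(2) b] .
      then have bp: "b ^ (p - 1) \<in> carrier (mpoly_ring m n)"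
        unfolding carrier_eq_poly_over by (rule poly_over_power)
      have "b ^ (p - 1) * (g * b) \<in> I"
        by (rule mpoly_ideal_mult[OF I bp g(2)[OF b]])
      then have "frobenius_trace p l t (f ^ (p - 1) * (b ^ (p - 1) * (g * b))) \<in> I" by (rule colon.IH)
      moreover have "f ^ (p - 1) * (b ^ (p - 1) * (g * b)) = b ^ p * (f ^ (p - 1) * g)"
        unfolding power_p[symmetric] by (simp add: mult_ac)
      ultimately show ?thesis by (simp only: trace_linear mult.commute[of _ b])
    qed
    moreover have "frobenius_trace p l t (f ^ (p - 1) * g) \<in> carrier (mpoly_ring m n)"
      using f g(1) unfolding carrier_eq_poly_over by (intro trace_poly_over poly_over_mult poly_over_power)
    ultimately show ?case by (simp add: ideal_colon_def)
  next
    case (sum I J)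
    then obtain x y where "x \<in> I" "y \<in> J" "g = x + y" by (auto simp: set_add_def')
    then show ?case using sum.IH by (auto simp: set_add_def' distrib_left trace_add)
  next
    case (inter I J)
    then show ?case by blast
  }
qed

lemma mpoly_ring_pow: "x \<in> carrier (mpoly_ring m n) \<Longrightarrow> x [^]\<^bsub>mpoly_ring m n\<^esub> (k::nat) = (x :: 'k::field mpoly) ^ k"
proof (induction k)
  interpret cring "mpoly_ring m n :: 'k mpoly ring" by (rule cring_mpoly_ring)
  case 0
  show ?case by simp
next
  interpret cring "mpoly_ring m n :: 'k mpoly ring" by (rule cring_mpoly_ring)
  case (Suc k)
  then show ?case by (simp add: mult.commute)
qed

lemma mpoly_ring_add_pow_one: "[k] \<cdot>\<^bsub>mpoly_ring m n\<^esub> \<one>\<^bsub>mpoly_ring m n\<^esub> = (of_nat k :: 'k::field mpoly)"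
proof (induction k)
  interpret cring "mpoly_ring m n :: 'k mpoly ring" by (rule cring_mpoly_ring)
  case 0
  show ?case by simp
next
  interpret cring "mpoly_ring m n :: 'k mpoly ring" by (rule cring_mpoly_ring)
  case (Suc k)
  then show ?case by (simp add: add.commute)
qed

text \<open>The zero ideal is compatible with every splitting but is not a Knutson ideal of \<open>f\<close>; it is the
  edge ideal of a graph without edges.\<close>
lemma F_pure_knutson_quotient:
  fixes J :: "'k::field mpoly set"
  assumes char: "CHAR('k) > 0"
    and J: "J \<in> knutson_ideals (mpoly_ring m n) (diagonal_product m n) \<or> J = {0}"
  shows "F_pure TYPE('b) CHAR('k) (mpoly_ring m n Quot J)"
proof -
  let ?R = "mpoly_ring m n :: 'k mpoly ring"
  let ?f = "diagonal_product m n :: 'k mpoly"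
  define p where "p = CHAR('k)"
  define t where "t = scale_expo (p - 1) (diagonal_product_expo m n)"
  have prime: "prime CHAR('k)" using char by (rule prime_CHAR_semidom)
  obtain l :: "'k \<Rightarrow> 'k" where l: "\<And>x y. l (x + y) = l x + l y" "\<And>a x. l (a ^ CHAR('k) * x) = a * l x" "l 1 = 1"
    using frobenius_functional[OF prime] by blast
  have "Poly_Mapping.lookup t v < p" for v
  proof -
    have "(p - 1) * Poly_Mapping.lookup (diagonal_product_expo m n) v \<le> (p - 1) * 1"
      by (intro mult_le_mono2 lookup_diagonal_product_expo)
    also have "\<dots> < p" using char by (simp add: p_def)
    finally show ?thesis by (simp add: t_def)
  qed
  then interpret frobenius_section p l t
    using l prime by unfold_locales (simp_all add: p_def)
  let ?\<phi> = "\<lambda>g. frobenius_trace p l t (?f ^ (p - 1) * g)"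
  interpret cring ?R by (rule cring_mpoly_ring)
  have f: "?f ^ (p - 1) \<in> poly_over ({1..m} \<times> {1..n})"
    using diagonal_product_carrier[of m n] unfolding carrier_eq_poly_over by (rule poly_over_power)
  have "F_pure TYPE('b) p (?R Quot J)"
  proof (rule F_pure_quotient[where \<phi> = ?\<phi>])
    show "prime p" using prime by (simp add: p_def)
    show "[p] \<cdot>\<^bsub>?R\<^esub> \<one>\<^bsub>?R\<^esub> = \<zero>\<^bsub>?R\<^esub>"
      unfolding mpoly_ring_add_pow_one by (simp add: p_def of_nat_eq_0_iff_char_dvd char_mpoly)
    show "ideal J ?R"
      using J knutson_mpoly_ideal[OF diagonal_product_carrier] zeroideal by auto
    show "?\<phi> x \<in> carrier ?R" if "x \<in> carrier ?R" for x
      using that f unfolding carrier_eq_poly_over by (intro trace_poly_over poly_over_mult)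
    show "?\<phi> (x \<oplus>\<^bsub>?R\<^esub> y) = ?\<phi> x \<oplus>\<^bsub>?R\<^esub> ?\<phi> y" for x y
      by (simp add: distrib_left trace_add)
    show "?\<phi> (r [^]\<^bsub>?R\<^esub> p \<otimes>\<^bsub>?R\<^esub> x) = r \<otimes>\<^bsub>?R\<^esub> ?\<phi> x" if "r \<in> carrier ?R" for r x
      using that by (simp add: mpoly_ring_pow mult.left_commute[of _ "r ^ p"] trace_linear)
    have "?\<phi> 1 = 1"
      using trace_lead[OF lead_power[OF lead_diagonal_product, of m n "p - 1", folded t_def]] by simp
    then show "?\<phi> \<one>\<^bsub>?R\<^esub> = \<one>\<^bsub>?R\<^esub>" by simp
    show "?\<phi> x \<in> J" if "x \<in> J" for x
      using J that knutson_compatible[OF diagonal_product_carrier] by auto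
  qed
  then show ?thesis by (simp add: p_def)
qed

section \<open>Generalized binomial edge ideals\<close>

lemma gen_binomial_edge_ideal_eq_graph_ideal:
  assumes E: "\<And>i j. {i, j} \<in> E \<Longrightarrow> i \<in> {1..n} \<and> j \<in> {1..n}"
  shows "gen_binomial_edge_ideal m n E = (graph_ideal m n {} {(i, j). {i, j} \<in> E} :: 'k::field mpoly set)"
proof
  let ?R = "mpoly_ring m n :: 'k mpoly ring"
  let ?A = "{(i, j). {i, j} \<in> E}"
  let ?G = "\<Union>{two_minors_ideal m n i j | i j. {i, j} \<in> E} :: 'k mpoly set"
  have A: "?A \<subseteq> {1..n} \<times> {1..n}" using E by blast
  note J = graph_ideal_facts[OF empty_subsetI A, where m = m and 'k = 'k]
  have gens: "{minor [a, b] [i, j] | a b. 1 \<le> a \<and> a < b \<and> b \<le> m} \<subseteq> carrier ?R" if "{i, j} \<in> E" for i j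
    using E[OF that] by (auto simp: minor_two intro!: two_minor_carrier simp del: One_nat_def)
  have G: "?G \<subseteq> carrier ?R"
    using mpoly_ideal_carrier[OF Idl_ideal(1)[OF gens]] by (auto simp: two_minors_ideal_def)
  show "gen_binomial_edge_ideal m n E \<subseteq> (graph_ideal m n {} ?A :: 'k mpoly set)"
    unfolding gen_binomial_edge_ideal_def
  proof (rule Idl_minimal[OF J(1)], rule Union_least)
    fix X :: "'k mpoly set" assume "X \<in> {two_minors_ideal m n i j | i j. {i, j} \<in> E}"
    then obtain i j where ij: "X = two_minors_ideal m n i j" "{i, j} \<in> E" by blast
    show "X \<subseteq> graph_ideal m n {} ?A"
      unfolding ij(1) two_minors_ideal_def using J(3)[of _ _ i j] ij(2)
      by (intro Idl_minimal[OF J(1)]) (auto simp: minor_two simp del: One_nat_def)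
  qed
  have mem: "two_minor a b i j \<in> (gen_binomial_edge_ideal m n E :: 'k mpoly set)"
    if "{i, j} \<in> E" "1 \<le> a" "a < b" "b \<le> m" for a b i j
  proof -
    have "two_minor a b i j \<in> (two_minors_ideal m n i j :: 'k mpoly set)"
      unfolding two_minors_ideal_def minor_two[symmetric] using that Idl_ideal(2)[OF gens[OF that(1)]] by blast
    then have "two_minor a b i j \<in> ?G" using that(1) by blast
    then show ?thesis unfolding gen_binomial_edge_ideal_def using Idl_ideal(2)[OF G] by blast
  qed
  have I: "ideal (gen_binomial_edge_ideal m n E :: 'k mpoly set) ?R"
    unfolding gen_binomial_edge_ideal_def by (rule Idl_ideal(1)[OF G])
  show "graph_ideal m n {} ?A \<subseteq> (gen_binomial_edge_ideal m n E :: 'k mpoly set)"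
    unfolding graph_ideal_def
  proof (rule Idl_minimal[OF I], rule subsetI)
    fix g :: "'k mpoly" assume "g \<in> column_gens m {} \<union> minor_gens m ?A"
    then obtain a b i j where g: "g = two_minor a b i j" "a \<in> {1..m}" "b \<in> {1..m}" "{i, j} \<in> E"
      by (auto simp: column_gens_def minor_gens_def)
    consider "a = b" | "a < b" | "b < a" by linarith
    then show "g \<in> gen_binomial_edge_ideal m n E"
    proof cases
      case 1
      then show ?thesis by (simp add: g(1) mpoly_ideal_zero[OF I])
    next
      case 2
      then show ?thesis using mem[OF g(4), of a b] g by simp
    next
      case 3
      then show ?thesis
        using mpoly_ideal_uminus[OF I mem[OF g(4), of b a]] g by (simp add: two_minor_swap(1)[of b a])
    qed
  qed
qed

theorem proposition3:
  fixes m n :: nat and V :: "'v set" and E :: "'v set set"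
  assumes "m \<ge> 2"
    and "simple_graph V E"
    and "card V = n"
    and "weakly_closed V E"
  shows "\<exists>\<sigma>. labeling V \<sigma> \<and>
    (E \<noteq> {} \<longrightarrow>
       gen_binomial_edge_ideal m n (labeled_edges \<sigma> E) \<in>
         knutson_ideals (mpoly_ring m n) (diagonal_product m n :: 'k::field mpoly)) \<and>
    (CHAR('k) > 0 \<longrightarrow>
       F_pure TYPE('b) CHAR('k)
         ((mpoly_ring m n :: 'k mpoly ring) Quot
            gen_binomial_edge_ideal m n (labeled_edges \<sigma> E)))"
proof -
  obtain \<sigma> where \<sigma>: "labeling V \<sigma>"
    and wc: "\<And>i j k. 1 \<le> i \<Longrightarrow> i < j \<Longrightarrow> j < k \<Longrightarrow> k \<le> n \<Longrightarrow> {i, k} \<in> labeled_edges \<sigma> E \<Longrightarrow>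
      {i, j} \<in> labeled_edges \<sigma> E \<or> {j, k} \<in> labeled_edges \<sigma> E"
    using assms(3,4) unfolding weakly_closed_def by blast
  let ?E = "labeled_edges \<sigma> E"
  let ?A = "{(i, j). {i, j} \<in> ?E}"
  let ?J = "gen_binomial_edge_ideal m n ?E :: 'k mpoly set"
  have bij: "bij_betw \<sigma> V {1..n}" using \<sigma> assms(3) by (simp add: labeling_def)
  have edge: "e \<subseteq> {1..n} \<and> card e = 2" if e: "e \<in> ?E" for e
  proof -
    obtain d where d: "d \<in> E" "e = \<sigma> ` d" using e unfolding labeled_edges_def by blast
    then have dV: "d \<subseteq> V" "card d = 2" using assms(2) by (auto simp: simple_graph_def)
    then have "card e = 2"
      using d(2) bij card_image[OF inj_on_subset[OF bij_betw_imp_inj_on[OF bij] dV(1)]] by simp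
    moreover have "e \<subseteq> {1..n}" using d(2) dV(1) bij_betw_imp_surj_on[OF bij] by blast
    ultimately show ?thesis by blast
  qed
  have range: "i \<in> {1..n} \<and> j \<in> {1..n}" if "{i, j} \<in> ?E" for i j using edge[OF that] by auto
  have J: "?J = graph_ideal m n {} ?A" by (rule gen_binomial_edge_ideal_eq_graph_ideal[OF range])
  have knutson: "?J \<in> knutson_ideals (mpoly_ring m n) (diagonal_product m n)" if nonempty: "E \<noteq> {}"
    unfolding J
  proof (rule knutson_graph_ideal[OF assms(1) empty_subsetI])
    show "?A \<subseteq> {1..n} \<times> {1..n}" using range by blast
    show "sym ?A" by (auto simp: sym_def insert_commute)
    show "(i, j) \<in> ?A \<or> (j, k) \<in> ?A" if "i < j" "j < k" "(i, k) \<in> ?A" for i j k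
      using wc[of i j k] range[of i k] that by auto
    obtain d where "d \<in> E" using nonempty by blast
    then have e: "\<sigma> ` d \<in> ?E" by (auto simp: labeled_edges_def)
    then obtain i j where "\<sigma> ` d = {i, j}" "i \<noteq> j" using edge by (meson card_2_iff)
    then show "{} \<noteq> {} \<or> (\<exists>(i, j)\<in>?A. i \<noteq> j)" using e by auto
  qed
  have "?J \<in> knutson_ideals (mpoly_ring m n) (diagonal_product m n) \<or> ?J = {0}"
  proof (cases "E = {}")
    case True
    have "Idl\<^bsub>mpoly_ring m n\<^esub> ({} :: 'k mpoly set) = {0}"
    proof
      have "ideal {0} (mpoly_ring m n :: 'k mpoly ring)"
        by (rule mpoly_idealI) (auto simp: carrier_eq_poly_over)
      then show "Idl\<^bsub>mpoly_ring m n\<^esub> {} \<subseteq> {0 :: 'k mpoly}" by (rule Idl_minimal) simp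
      show "{0 :: 'k mpoly} \<subseteq> Idl\<^bsub>mpoly_ring m n\<^esub> {}"
        using mpoly_ideal_zero[OF Idl_ideal(1)[OF empty_subsetI]] by simp
    qed
    then show ?thesis using True by (simp add: gen_binomial_edge_ideal_def labeled_edges_def)
  qed (use knutson in blast)
  then show ?thesis using \<sigma> knutson F_pure_knutson_quotient by blast
qed

end
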